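(* Let $k>2$ be an even integer and let $D$ be a positive integer with $D\equiv 0,1 \pmod 4$. Define \[ \omega_{k+1,D}(z) := \sum_{Q\in\mathcal{Q}_D}\frac{Q_z}{Q(z,1)^{k+1}},\qquad z=x+iy\in\mathbb{H}. \] Then: (i) $\omega_{k+1,D}$ is a weak Maa{\ss} form of weight $2k+2$ for $\mathrm{SL}_2(\mathbb{Z})$ with eigenvalue $2k$ under the hyperbolic Laplace operator $\Delta_{2k+2}$, i.e. $\Delta_{2k+2}\,\omega_{k+1,D}=2k\,\omega_{k+1,D}$. Furthermore, $\lim_{z\to i\infty}\omega_{k+1,D}(z)=0$. (ii) For all $z\in\mathbb{H}$, \[ \omega_{k+1,D}(z) = -i\sum_{Q\in\mathcal{Q}_D}\frac{Q'(z,1)}{Q(z,1)^{k+1}} + \frac{1}{y}\,f_{k,D}(z),\qquad Q'(z,1):=\frac{d}{dz}Q(z,1). \] (iii) Assume $f_{k,D}$ is not identically zero and let $c_{f_{k,D}}$ be the first non-vanishing Fourier coefficient of $f_{k,D}$ in its Fourier expansion about $i\infty$. Let $E_2^*(z):=E_2(z)-\frac{3}{\pi y}$. Then \[ \frac{1}{c_{f_{k,D}}}\,f_{k,D}^{\mathrm{div}}(z) = \frac{k}{2\pi}\,\frac{\omega_{k+1,D}(z)}{f_{k,D}(z)} + \frac{k}{6}\,E_2^*(z). \]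
   Context: $\mathbb{H}=\{z=x+iy\in\mathbb{C}: y>0\}$, $q=e^{2\pi i z}$. $\mathcal{Q}_D=\{Q(X,Y)=aX^2+bXY+cY^2: a,b,c\in\mathbb{Z},\ b^2-4ac=D\}$. For $Q=[a,b,c]\in\mathcal{Q}_D$ and $z=x+iy\in\mathbb{H}$, $Q_z:=\frac{1}{y}(a|z|^2+bx+c)\in\mathbb{R}$. The function $f_{k,D}(z):=\sum_{Q\in\mathcal{Q}_D}Q(z,1)^{-k}$ (Zagier's function) is a weight $2k$ cusp form for $\mathrm{SL}_2(\mathbb{Z})$. $E_2(z)=1-24\sum_{n\ge1}\sum_{d\mid n}d\,q^n$. Weight $\kappa\in\mathbb{Z}$ slash action: $(f|_\kappa\gamma)(z)=(cz+d)^{-\kappa}f(\gamma z)$ for $\gamma=\begin{pmatrix}a&b\\c&d\end{pmatrix}\in\mathrm{SL}_2(\mathbb{Z})$. The hyperbolic Laplacian of weight $\kappa$ is $\Delta_\kappa=-y^2\left(\frac{\partial^2}{\partial x^2}+\frac{\partial^2}{\partial y^2}\right)+i\kappa y\left(\frac{\partial}{\partial x}+i\frac{\partial}{\partial y}\right)$. A weak Maa{\ss} form of weight $\kappa$ and eigenvalue $\lambda$ for $\mathrm{SL}_2(\mathbb{Z})$ is a smooth $f:\mathbb{H}\to\mathbb{C}$ with $f|_\kappa\gamma=f$ for all $\gamma\in\mathrm{SL}_2(\mathbb{Z})$, $\Delta_\kappa f=\lambda f$, and at most linear exponential growth at the cusp. Divisor modular form: let $j(z)=q^{-1}+744+O(q)$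 be Klein's $j$-invariant and, for $z\in\mathbb{H}$, let $H_z(\tau):=\frac{\frac{1}{2\pi i}\frac{d}{d\tau}j(\tau)}{j(z)-j(\tau)}$ (which for $\mathrm{Im}\,\tau>\mathrm{Im}\,z$ equals $\sum_{n\ge0}j_n(z)e^{2\pi i n\tau}$, where $j_n$ is the unique modular function for $\mathrm{SL}_2(\mathbb{Z})$, holomorphic on $\mathbb{H}$, with expansion $q^{-n}+O(q)$). For a meromorphic modular form $f$ of weight $\kappa$ for $\mathrm{SL}_2(\mathbb{Z})$, not identically zero, \[ f^{\mathrm{div}}(\tau):=\sum_{z\in\mathrm{SL}_2(\mathbb{Z})\backslash\mathbb{H}}\frac{2}{|\mathrm{Stab}_z(\mathrm{SL}_2(\mathbb{Z}))|}\,\mathrm{ord}_z(f)\,H_z(\tau), \] where the weight $\frac{2}{|\mathrm{Stab}_z|}$ equals $\frac12$ if $z$ is equivalent to $i$, $\frac13$ if $z$ is equivalent to $e^{2\pi i/3}$, and $1$ otherwise.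
   Formalization: In (iii) the scalar multiple (1/c_f)·f^div is replaced by (f/c_f)^div, which equals f^div: f^div depends only on the divisor of f, and the printed identity fails e.g. for k=8, D=1, where f^div=E_6/(3E_4) is nonzero and c_f is not 1. *)

theory Defs
  imports "HOL-Complex_Analysis.Complex_Analysis" "HOL-Library.Landau_Symbols"
begin

section \<open>The upper half plane and the modular group\<close>

definition upper_half :: "complex set" where
  "upper_half = {z. Im z > 0}"

text \<open>The filter of \<open>z \<rightarrow> i\<infinity>\<close>: \<open>Im z\<close> tends to infinity, uniformly in \<open>Re z\<close>.\<close>

definition at_i_inf :: "complex filter" where
  "at_i_inf = filtercomap Im at_top"

definition SL2Z :: "(int^2^2) set" where
  "SL2Z = {\<gamma>. det \<gamma> = 1}"

definition aut_factor :: "int^2^2 \<Rightarrow> complex \<Rightarrow> complex" where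
  "aut_factor \<gamma> z = of_int (\<gamma> $ 2 $ 1) * z + of_int (\<gamma> $ 2 $ 2)"

definition moebius :: "int^2^2 \<Rightarrow> complex \<Rightarrow> complex" where
  "moebius \<gamma> z = (of_int (\<gamma> $ 1 $ 1) * z + of_int (\<gamma> $ 1 $ 2)) / aut_factor \<gamma> z"

definition slash :: "int \<Rightarrow> int^2^2 \<Rightarrow> (complex \<Rightarrow> complex) \<Rightarrow> complex \<Rightarrow> complex" where
  "slash \<kappa> \<gamma> f z = aut_factor \<gamma> z powi (- \<kappa>) * f (moebius \<gamma> z)"

definition orbit_rel :: "(complex \<times> complex) set" where
  "orbit_rel = {(z, w). z \<in> upper_half \<and> w \<in> upper_half \<and> (\<exists>\<gamma>\<in>SL2Z. w = moebius \<gamma> z)}"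

definition stab :: "complex \<Rightarrow> (int^2^2) set" where
  "stab z = {\<gamma> \<in> SL2Z. moebius \<gamma> z = z}"


section \<open>Weak Maass forms\<close>

definition partial_x :: "(complex \<Rightarrow> complex) \<Rightarrow> complex \<Rightarrow> complex" where
  "partial_x f z = vector_derivative (\<lambda>t. f (Complex t (Im z))) (at (Re z))"

definition partial_y :: "(complex \<Rightarrow> complex) \<Rightarrow> complex \<Rightarrow> complex" where
  "partial_y f z = vector_derivative (\<lambda>t. f (Complex (Re z) t)) (at (Im z))"

text \<open>
  Differentiability is real (Frechet) differentiability on an open subset of the plane
  throughout; \<open>C_diff n S f\<close> says that \<open>f\<close> is of class \<open>C\<^sup>n\<close> on the open set \<open>S\<close>.
\<close>

primrec C_diff :: "nat \<Rightarrow> complex set \<Rightarrow> (complex \<Rightarrow> complex) \<Rightarrow> bool" where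
  "C_diff 0 S f \<longleftrightarrow> continuous_on S f"
| "C_diff (Suc n) S f \<longleftrightarrow>
     f differentiable_on S \<and> C_diff n S (partial_x f) \<and> C_diff n S (partial_y f)"

definition smooth_fun_on :: "complex set \<Rightarrow> (complex \<Rightarrow> complex) \<Rightarrow> bool" where
  "smooth_fun_on S f \<longleftrightarrow> (\<forall>n. C_diff n S f)"

definition hyp_laplace :: "int \<Rightarrow> (complex \<Rightarrow> complex) \<Rightarrow> complex \<Rightarrow> complex" where
  "hyp_laplace \<kappa> f z =
     - (of_real (Im z))\<^sup>2 * (partial_x (partial_x f) z + partial_y (partial_y f) z)
     + \<i> * of_int \<kappa> * of_real (Im z) * (partial_x f z + \<i> * partial_y f z)"

definition weak_maass_form :: "int \<Rightarrow> complex \<Rightarrow> (complex \<Rightarrow> complex) \<Rightarrow> bool" where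
  "weak_maass_form \<kappa> ev f \<longleftrightarrow>
     smooth_fun_on upper_half f \<and>
     (\<forall>\<gamma>\<in>SL2Z. \<forall>z\<in>upper_half. slash \<kappa> \<gamma> f z = f z) \<and>
     (\<forall>z\<in>upper_half. hyp_laplace \<kappa> f z = ev * f z) \<and>
     (\<exists>C::real. (\<lambda>z. norm (f z)) \<in> O[at_i_inf](\<lambda>z. exp (C * Im z)))"


section \<open>Binary quadratic forms and the series attached to them\<close>

text \<open>The triple \<open>(a, b, c)\<close> stands for the form \<open>a X\<^sup>2 + b X Y + c Y\<^sup>2\<close>.\<close>

type_synonym bqf = "int \<times> int \<times> int"

definition bqf_of_disc :: "int \<Rightarrow> bqf set" where
  "bqf_of_disc D = {(a, b, c). b\<^sup>2 - 4 * a * c = D}"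

definition bqf_eval :: "bqf \<Rightarrow> complex \<Rightarrow> complex \<Rightarrow> complex" where
  "bqf_eval = (\<lambda>(a, b, c) X Y. of_int a * X\<^sup>2 + of_int b * X * Y + of_int c * Y\<^sup>2)"

definition bqf_real :: "bqf \<Rightarrow> complex \<Rightarrow> real" where
  "bqf_real = (\<lambda>(a, b, c) z.
     1 / Im z * (of_int a * (cmod z)\<^sup>2 + of_int b * Re z + of_int c))"

definition zagier_f :: "nat \<Rightarrow> int \<Rightarrow> complex \<Rightarrow> complex" where
  "zagier_f k D z = (\<Sum>\<^sub>\<infinity>Q\<in>bqf_of_disc D. 1 / bqf_eval Q z 1 ^ k)"

text \<open>The first index is the exponent of \<open>Q(z,1)\<close> in the denominator.\<close>

definition omega :: "nat \<Rightarrow> int \<Rightarrow> complex \<Rightarrow> complex" where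
  "omega m D z = (\<Sum>\<^sub>\<infinity>Q\<in>bqf_of_disc D. of_real (bqf_real Q z) / bqf_eval Q z 1 ^ m)"


section \<open>Fourier coefficients, Eisenstein series and the \<open>j\<close>-invariant\<close>

definition qexp :: "complex \<Rightarrow> complex" where
  "qexp z = exp (2 * of_real pi * \<i> * z)"

text \<open>
  The coefficients of the expansion about \<open>i\<infinity>\<close> of a 1-periodic function that is holomorphic on
  the upper half plane and at \<open>i\<infinity>\<close>; they are unique because power series coefficients are.
\<close>

definition fourier_coeff :: "(complex \<Rightarrow> complex) \<Rightarrow> nat \<Rightarrow> complex" where
  "fourier_coeff f = (THE a. \<forall>z\<in>upper_half. (\<lambda>n. a n * qexp z ^ n) sums f z)"

definition first_fourier_coeff :: "(complex \<Rightarrow> complex) \<Rightarrow> complex" where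
  "first_fourier_coeff f = fourier_coeff f (LEAST n. fourier_coeff f n \<noteq> 0)"

definition divisor_sum :: "nat \<Rightarrow> nat \<Rightarrow> nat" where
  "divisor_sum s n = (\<Sum>d | d dvd n. d ^ s)"

definition E2 :: "complex \<Rightarrow> complex" where
  "E2 z = 1 - 24 * (\<Sum>\<^sub>\<infinity>n\<in>{1..}. of_nat (divisor_sum 1 n) * qexp z ^ n)"

definition E4 :: "complex \<Rightarrow> complex" where
  "E4 z = 1 + 240 * (\<Sum>\<^sub>\<infinity>n\<in>{1..}. of_nat (divisor_sum 3 n) * qexp z ^ n)"

definition E6 :: "complex \<Rightarrow> complex" where
  "E6 z = 1 - 504 * (\<Sum>\<^sub>\<infinity>n\<in>{1..}. of_nat (divisor_sum 5 n) * qexp z ^ n)"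

definition E2_star :: "complex \<Rightarrow> complex" where
  "E2_star z = E2 z - of_real (3 / (pi * Im z))"

text \<open>With \<open>E\<^sub>4\<^sup>3 - E\<^sub>6\<^sup>2 = 1728 \<Delta>\<close> this is Klein's invariant \<open>E\<^sub>4\<^sup>3 / \<Delta> = 1 / q + 744 + O(q)\<close>.\<close>

definition klein_j :: "complex \<Rightarrow> complex" where
  "klein_j z = 1728 * E4 z ^ 3 / (E4 z ^ 3 - E6 z ^ 2)"


section \<open>Divisor modular forms\<close>

definition H_fun :: "complex \<Rightarrow> complex \<Rightarrow> complex" where
  "H_fun z \<tau> = (1 / (2 * of_real pi * \<i>) * deriv klein_j \<tau>) / (klein_j z - klein_j \<tau>)"

definition div_term :: "(complex \<Rightarrow> complex) \<Rightarrow> complex \<Rightarrow> complex \<Rightarrow> complex" where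
  "div_term f \<tau> z = 2 / of_nat (card (stab z)) * of_int (zorder f z) * H_fun z \<tau>"

text \<open>
  The sum runs over the orbits. For \<open>f\<close> modular and not identically zero the summand does not
  depend on the representative and vanishes for all but finitely many orbits. If \<open>\<tau>\<close> is neither
  a zero nor a pole of \<open>f\<close>, then no \<open>H_fun z \<tau>\<close> with vanishing denominator contributes, since
  \<open>klein_j z = klein_j \<tau>\<close> makes \<open>z\<close> equivalent to \<open>\<tau>\<close>, so that \<open>zorder f z = 0\<close>.
  Multiplying \<open>f\<close> by a nonzero constant does not change \<open>fdiv f\<close>.
\<close>

definition fdiv :: "(complex \<Rightarrow> complex) \<Rightarrow> complex \<Rightarrow> complex" where
  "fdiv f \<tau> = (\<Sum>\<^sub>\<infinity>orb \<in> upper_half // orbit_rel. div_term f \<tau> (SOME z. z \<in> orb))"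

end

theory Submission
  imports Defs "HOL-Computational_Algebra.Fundamental_Theorem_Algebra"
begin

text \<open>
  Writing \<open>f = f\<^bsub>k,D\<^esub>\<close>, the identity \<open>Q\<^sub>z = Q(z,1)/y - i Q'(z,1)\<close> gives
  \<open>\<omega> = (i/k) f' + f/y\<close>, from which the Laplace equation and the behaviour at the cusp follow.
  For the divisor formula the maximum principle on the \<open>q\<close>-disc shows that a modular function
  without poles in the half plane is a polynomial in \<open>j\<close>. Hence \<open>f\<^sup>6 = \<Delta>\<^sup>k p(j)\<close>, and the logarithmic
  derivative expresses \<open>- (2\<pi>i)\<^sup>-\<^sup>1 f'/f + k E\<^sub>2/6\<close> as a sum over the roots of \<open>p\<close>, because
  \<open>\<Delta>'/\<Delta> = 2\<pi>i E\<^sub>2\<close>. The fibres of \<open>j\<close> are single orbits, on which \<open>j - j(z)\<close> vanishes to order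
  \<open>\<bar>Stab\<^sub>z\<bar>/2\<close>, so that the roots of \<open>p\<close> are the orbits of zeros of \<open>f\<close> with the weights of the
  divisor. No contour integral over a fundamental domain is used: \<open>\<Delta>\<close> is defined as the
  exponential of a primitive of \<open>2\<pi>i E\<^sub>2\<close>, so it has no zeros, and injectivity of \<open>j\<close> on orbits is
  a connectedness argument.
\<close>

section \<open>The modular group\<close>

text \<open>The sixth power comes from the weights: f has weight 2k and \<Delta> has weight 12, so
  f^6 / \<Delta>^k is a modular function without poles in the half plane, and counting the roots of
  p takes the place of the valence formula. The obstacle is that E2, E4, E6, and with them j, are
  given by q-expansions only. The law of E2 under z -> -1/z is therefore the analytic core: it says
  that the exponential of the primitive has weight 12, and that q d/dq, corrected by a multiple of
  E2, raises weights by 2. Since \<Delta> has no zeros, a form of weight k < 12 that vanishes at the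
  cusp is zero, because its twelfth power divided by \<Delta>^k has weight 0. So E4 and E6 can be
  recognised among the derivatives of E2 and E4 by their first two coefficients, and 1728 arises as
  720 + 1008 from E4^3 - E6^2. The connectedness argument for j needs control of how fibres vary:
  compactness at bounded height, and a separate treatment of the cusp, where 1/j has a simple zero
  in q.\<close>

no_notation fps_nth (infixl "$" 75)

lemma upper_half_iff [simp]: "z \<in> upper_half \<longleftrightarrow> Im z > 0"
  by (simp add: upper_half_def)

lemma open_upper_half [simp]: "open upper_half"
  by (simp add: upper_half_def open_halfspace_Im_gt)

lemma convex_upper_half [simp]: "convex upper_half"
  by (simp add: upper_half_def convex_halfspace_Im_gt)

lemma Im_neg_inverse: "Im (- 1 / z) = Im z / (cmod z)\<^sup>2"
  by (simp add: Im_divide cmod_def)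

lemma Im_inverse_neg [simp]:
  assumes "Im z > 0"
  shows "Im (1 / z) < 0"
proof -
  have "Im z / (cmod z)\<^sup>2 > 0" using assms by (intro divide_pos_pos) auto
  thus ?thesis using Im_neg_inverse[of z] by simp
qed

definition mat2 :: "int \<Rightarrow> int \<Rightarrow> int \<Rightarrow> int \<Rightarrow> int^2^2" where
  "mat2 a b c d = vector [vector [a, b], vector [c, d]]"

lemma mat2_nth [simp]:
  "mat2 a b c d $ 1 $ 1 = a" "mat2 a b c d $ 1 $ 2 = b"
  "mat2 a b c d $ 2 $ 1 = c" "mat2 a b c d $ 2 $ 2 = d"
  by (simp_all add: mat2_def)

lemma mat2_eq_iff: "(A :: int^2^2) = B \<longleftrightarrow>
    A $ 1 $ 1 = B $ 1 $ 1 \<and> A $ 1 $ 2 = B $ 1 $ 2 \<and> A $ 2 $ 1 = B $ 2 $ 1 \<and> A $ 2 $ 2 = B $ 2 $ 2"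
  by (simp only: vec_eq_iff forall_2 conj_assoc)

lemma mat2_collapse: "mat2 (A $ 1 $ 1) (A $ 1 $ 2) (A $ 2 $ 1) (A $ 2 $ 2) = A"
  by (simp add: mat2_eq_iff)

lemma SL2Z_iff: "A \<in> SL2Z \<longleftrightarrow> A $ 1 $ 1 * A $ 2 $ 2 - A $ 1 $ 2 * A $ 2 $ 1 = 1"
  by (simp add: SL2Z_def det_2)

lemma matrix_mult_2 [simp]:
  fixes A B :: "int^2^2"
  shows "(A ** B) $ i $ j = A $ i $ 1 * B $ 1 $ j + A $ i $ 2 * B $ 2 $ j"
  by (simp add: matrix_matrix_mult_def sum_2)

lemma mat_1_nth [simp]:
  "(mat 1 :: int^2^2) $ 1 $ 1 = 1" "(mat 1 :: int^2^2) $ 1 $ 2 = 0"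
  "(mat 1 :: int^2^2) $ 2 $ 1 = 0" "(mat 1 :: int^2^2) $ 2 $ 2 = 1"
  by (simp_all add: mat_def)

definition sl2_inv :: "int^2^2 \<Rightarrow> int^2^2" where
  "sl2_inv A = mat2 (A $ 2 $ 2) (- A $ 1 $ 2) (- A $ 2 $ 1) (A $ 1 $ 1)"

lemma SL2Z_one [simp]: "mat 1 \<in> SL2Z"
  by (simp add: SL2Z_iff)

lemma SL2Z_mult: "A \<in> SL2Z \<Longrightarrow> B \<in> SL2Z \<Longrightarrow> A ** B \<in> SL2Z"
  by (simp add: SL2Z_def det_mul)

lemma SL2Z_inv: "A \<in> SL2Z \<Longrightarrow> sl2_inv A \<in> SL2Z"
  by (simp add: SL2Z_iff sl2_inv_def algebra_simps)

lemma sl2_inv_mult: "A \<in> SL2Z \<Longrightarrow> sl2_inv A ** A = mat 1"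
  and mult_sl2_inv: "A \<in> SL2Z \<Longrightarrow> A ** sl2_inv A = mat 1"
  by (simp_all add: SL2Z_iff mat2_eq_iff sl2_inv_def algebra_simps)

lemma aut_factor_nonzero:
  assumes "A \<in> SL2Z" "Im z > 0"
  shows "aut_factor A z \<noteq> 0"
proof
  assume *: "aut_factor A z = 0"
  have "Im (aut_factor A z) = of_int (A $ 2 $ 1) * Im z"
    by (simp add: aut_factor_def)
  with * assms have c: "A $ 2 $ 1 = 0" by simp
  with * have "A $ 2 $ 2 = 0" by (simp add: aut_factor_def)
  with c assms show False by (simp add: SL2Z_iff)
qed

lemma Im_moebius:
  assumes "A \<in> SL2Z" "Im z > 0"
  shows "Im (moebius A z) = Im z / (cmod (aut_factor A z))\<^sup>2"
proof -
  have det: "A $ 1 $ 1 * A $ 2 $ 2 = 1 + A $ 1 $ 2 * A $ 2 $ 1"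
    using assms by (simp add: SL2Z_iff)
  have "real_of_int (A $ 1 $ 1 * A $ 2 $ 2) = 1 + of_int (A $ 1 $ 2 * A $ 2 $ 1)"
    unfolding det by simp
  hence d: "real_of_int (A $ 1 $ 1) * of_int (A $ 2 $ 2) = 1 + of_int (A $ 1 $ 2) * of_int (A $ 2 $
      1)"
    by simp
  have "Im (moebius A z) = ((real_of_int (A $ 1 $ 1) * of_int (A $ 2 $ 2)
      - of_int (A $ 1 $ 2) * of_int (A $ 2 $ 1)) * Im z) / (cmod (aut_factor A z))\<^sup>2"
    unfolding moebius_def Im_divide cmod_power2
    by (simp add: aut_factor_def algebra_simps)
  thus ?thesis by (simp add: d)
qed

lemma Im_moebius_pos [simp]: "A \<in> SL2Z \<Longrightarrow> Im z > 0 \<Longrightarrow> Im (moebius A z) > 0"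
  using aut_factor_nonzero[of A z] by (simp add: Im_moebius)

lemma aut_factor_mult:
  assumes "B \<in> SL2Z" "Im z > 0"
  shows "aut_factor (A ** B) z = aut_factor A (moebius B z) * aut_factor B z"
proof -
  have "moebius B z * aut_factor B z = of_int (B $ 1 $ 1) * z + of_int (B $ 1 $ 2)"
    using aut_factor_nonzero[OF assms] by (simp add: moebius_def)
  hence "aut_factor A (moebius B z) * aut_factor B z =
      of_int (A $ 2 $ 1) * (of_int (B $ 1 $ 1) * z + of_int (B $ 1 $ 2)) + of_int (A $ 2 $ 2) *
          aut_factor B z"
    by (simp add: aut_factor_def[of A] ring_distribs mult.assoc)
  also have "\<dots> = aut_factor (A ** B) z"
    by (simp add: aut_factor_def algebra_simps)
  finally show ?thesis ..
qed

text \<open>By the cocycle relation for \<open>aut_factor\<close>, numerator and denominator of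
  \<open>moebius A (moebius B z)\<close> become those of the product matrix after multiplication by
  \<open>aut_factor B z\<close>.\<close>

lemma moebius_mult:
  assumes "A \<in> SL2Z" "B \<in> SL2Z" "Im z > 0"
  shows "moebius (A ** B) z = moebius A (moebius B z)"
proof -
  let ?n = "of_int (A $ 1 $ 1) * moebius B z + of_int (A $ 1 $ 2)"
  have nz: "aut_factor B z \<noteq> 0" by (rule aut_factor_nonzero) (use assms in auto)
  have "moebius (A ** B) z = (?n * aut_factor B z) / (aut_factor A (moebius B z) * aut_factor B z)"
    unfolding moebius_def[of "A ** B"] aut_factor_mult[OF assms(2,3)]
    using nz by (intro arg_cong2[where f = "(/)"] refl) (simp add: moebius_def field_simps, simp
        add: aut_factor_def algebra_simps)
  thus ?thesis using nz by (simp add: moebius_def)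
qed

lemma moebius_one [simp]: "moebius (mat 1) z = z"
  by (simp add: moebius_def aut_factor_def)

lemma moebius_inv_cancel:
  assumes "A \<in> SL2Z" "Im z > 0"
  shows "moebius (sl2_inv A) (moebius A z) = z" "moebius A (moebius (sl2_inv A) z) = z"
  using moebius_mult[OF SL2Z_inv[OF assms(1)] assms] moebius_mult[OF assms(1) SL2Z_inv[OF assms(1)]
      assms(2)]
  by (simp_all add: sl2_inv_mult mult_sl2_inv assms)

lemma orbit_relI: "Im z > 0 \<Longrightarrow> A \<in> SL2Z \<Longrightarrow> (z, moebius A z) \<in> orbit_rel"
  by (auto simp: orbit_rel_def)

lemma equiv_orbit_rel: "equiv upper_half orbit_rel"
proof (rule equivI)
  show "orbit_rel \<subseteq> upper_half \<times> upper_half" by (auto simp: orbit_rel_def)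
  show "refl_on upper_half orbit_rel"
    unfolding refl_on_def by (auto simp: orbit_rel_def intro!: bexI[of _ "mat 1"])
  show "sym orbit_rel"
  proof (rule symI)
    fix z w assume "(z, w) \<in> orbit_rel"
    then obtain A where "A \<in> SL2Z" "w = moebius A z" "Im z > 0" by (auto simp: orbit_rel_def)
    thus "(w, z) \<in> orbit_rel"
      using orbit_relI[of w "sl2_inv A"] by (simp add: SL2Z_inv moebius_inv_cancel)
  qed
  show "trans orbit_rel"
  proof (rule transI)
    fix z w u assume "(z, w) \<in> orbit_rel" "(w, u) \<in> orbit_rel"
    then obtain A B where "A \<in> SL2Z" "w = moebius A z" "Im z > 0" "B \<in> SL2Z" "u = moebius B w"
      by (auto simp: orbit_rel_def)
    thus "(z, u) \<in> orbit_rel"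
      using orbit_relI[of z "B ** A"] by (simp add: SL2Z_mult moebius_mult)
  qed
qed

lemma orbit_rel_refl: "Im z > 0 \<Longrightarrow> (z, z) \<in> orbit_rel"
  using equiv_orbit_rel by (auto simp: equiv_def refl_on_def)

lemma orbit_rel_sym: "(z, w) \<in> orbit_rel \<Longrightarrow> (w, z) \<in> orbit_rel"
  using equiv_orbit_rel by (meson equiv_def symE)

lemma orbit_rel_trans: "(z, w) \<in> orbit_rel \<Longrightarrow> (w, u) \<in> orbit_rel \<Longrightarrow> (z, u) \<in> orbit_rel"
  using equiv_orbit_rel by (meson equiv_def transE)

lemma orbit_rel_shift:
  assumes "Im z > 0"
  shows "(z, z + of_int n) \<in> orbit_rel"
  using orbit_relI[OF assms, of "mat2 1 n 0 1"]
  by (simp add: SL2Z_iff moebius_def aut_factor_def)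

lemma orbit_rel_neg_inverse:
  assumes "Im z > 0"
  shows "(z, - 1 / z) \<in> orbit_rel"
  using orbit_relI[OF assms, of "mat2 0 (-1) 1 0"]
  by (simp add: SL2Z_iff moebius_def aut_factor_def)

text \<open>If \<open>\<bar>Re z\<bar> \<le> 1/2\<close> and \<open>Im z < 1/2\<close>, then \<open>z \<mapsto> -1/z\<close> at least doubles the imaginary part.\<close>

lemma upper_half_induct [consumes 1, case_names base shift inv]:
  assumes z: "Im z > 0"
    and base: "\<And>z. \<bar>Re z\<bar> \<le> 1/2 \<Longrightarrow> Im z \<ge> 1/2 \<Longrightarrow> P z"
    and shift: "\<And>z n. Im z > 0 \<Longrightarrow> P (z + of_int n) \<Longrightarrow> P z"
    and inv: "\<And>z. Im z > 0 \<Longrightarrow> P (- 1 / z) \<Longrightarrow> P z"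
  shows "P z"
proof -
  \<comment> \<open>Induction on the number of doublings: unless the height is already at least 1/2,
    a shift and an inversion raise it from \<open>1 / 2 ^ Suc n\<close> to at least
    \<open>1 / 2 ^ n\<close>; height at least 1 needs a shift only.\<close>
  have main: "\<And>z. Im z > 0 \<Longrightarrow> Im z \<ge> 1 / 2 ^ n \<Longrightarrow> P z" for n :: nat
  proof (induction n)
    case (Suc n)
    define w where "w = z + of_int (- round (Re z))"
    have w: "Im w = Im z" "\<bar>Re w\<bar> \<le> 1/2"
      using of_int_round_abs_le[of "Re z"] by (auto simp: w_def abs_minus_commute)
    have "P w"
    proof (cases "Im w \<ge> 1/2")
      case False
      have "Im w * Im w < 1/2 * (1/2)"
        using False Suc.prems w by (intro mult_strict_mono) auto
      moreover have "(Re w)\<^sup>2 \<le> 1/4"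
        using power_mono[of "\<bar>Re w\<bar>" "1/2" 2] w by (simp add: power2_eq_square)
      ultimately have "(cmod w)\<^sup>2 \<le> 1/2" unfolding cmod_power2 by (simp add: power2_eq_square)
      moreover have "(cmod w)\<^sup>2 > 0" using Suc.prems w by auto
      ultimately have "Im (-1/w) \<ge> 2 * Im w"
        unfolding Im_neg_inverse using Suc.prems w by (simp add: field_simps)
      moreover have "2 * Im w \<ge> 1 / 2 ^ n" using Suc.prems w by (simp add: field_simps)
      ultimately have "P (-1/w)" using Suc.prems w
        by (intro Suc.IH) simp_all
      thus ?thesis using Suc.prems w by (intro inv[of w]) auto
    qed (use w base in auto)
    thus ?case using shift[of z "- round (Re z)"] Suc.prems by (simp add: w_def)
  next
    case 0
    define w where "w = z + of_int (- round (Re z))"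
    have "P w" using of_int_round_abs_le[of "Re z"] 0
      by (intro base) (auto simp: w_def abs_minus_commute)
    thus ?case using shift[of z "- round (Re z)"] 0 by (simp add: w_def)
  qed
  obtain n :: nat where "(1/2) ^ n < Im z" using real_arch_pow_inv[of "Im z" "1/2"] z by auto
  thus ?thesis using main[of z n] z by (simp add: power_divide)
qed

section \<open>Functions of \<open>q\<close> and modular forms\<close>

lemma norm_qexp: "cmod (qexp z) = exp (- 2 * pi * Im z)"
  by (simp add: qexp_def)

lemma qexp_nonzero [simp]: "qexp z \<noteq> 0"
  by (simp add: qexp_def)

lemma norm_qexp_less [simp]: "Im z > 0 \<Longrightarrow> cmod (qexp z) < 1"
  by (simp add: norm_qexp)

lemma qexp_eq_iff: "qexp z = qexp w \<longleftrightarrow> (\<exists>n::int. z = w + of_int n)"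
proof -
  have "qexp z = qexp w \<longleftrightarrow> (\<exists>n::int. 2 * of_real pi * \<i> * z = 2 * of_real pi * \<i> * w + of_int (2 * n)
      * pi * \<i>)"
    unfolding qexp_def exp_eq by simp
  also have "\<dots> \<longleftrightarrow> (\<exists>n::int. z = w + of_int n)"
  proof (intro ex_cong1)
    fix n :: int
    have "2 * of_real pi * \<i> * w + of_int (2 * n) * pi * \<i> = 2 * of_real pi * \<i> * (w + of_int n)"
      by (simp add: algebra_simps)
    thus "(2 * of_real pi * \<i> * z = 2 * of_real pi * \<i> * w + of_int (2 * n) * pi * \<i>) = (z =
        w + of_int n)"
      by simp
  qed
  finally show ?thesis .
qed

lemma qexp_shift [simp]: "qexp (z + of_int n) = qexp z" "qexp (z + 1) = qexp z"
  using qexp_eq_iff[of "z + of_int n" z] qexp_eq_iff[of "z + 1" z] by (auto intro: exI[of _ 1])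

lemma qexp_Ln: "q \<noteq> 0 \<Longrightarrow> qexp (Ln q / (2 * of_real pi * \<i>)) = q"
  by (simp add: qexp_def)

lemma qexp_add: "qexp (z + w) = qexp z * qexp w"
  by (simp add: qexp_def exp_add ring_distribs)

lemma qexp_surj:
  assumes "q \<noteq> 0" "cmod q < 1"
  obtains z where "Im z > 0" "qexp z = q"
proof -
  define z where "z = Ln q / (2 * of_real pi * \<i>)"
  have "qexp z = q" using assms by (simp add: z_def qexp_Ln)
  moreover from this have "exp (- 2 * pi * Im z) < 1" using assms norm_qexp[of z] by simp
  hence "Im z > 0" by (simp add: zero_less_mult_iff)
  ultimately show ?thesis using that by blast
qed

lemma has_field_derivative_qexp [derivative_intros]:
  "(f has_field_derivative f') (at z within A) \<Longrightarrow>
   ((\<lambda>z. qexp (f z)) has_field_derivative (2 * of_real pi * \<i> * qexp (f z) * f')) (at z within A)"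
  unfolding qexp_def by (auto intro!: derivative_eq_intros)

lemma holomorphic_on_qexp [holomorphic_intros]:
  "f holomorphic_on A \<Longrightarrow> (\<lambda>z. qexp (f z)) holomorphic_on A"
  unfolding qexp_def by (intro holomorphic_intros)

lemma qexp_in_ball: "qexp ` upper_half \<subseteq> ball 0 1"
  by auto

lemma holomorphic_on_comp_qexp:
  assumes "g holomorphic_on ball 0 1"
  shows "(\<lambda>z. g (qexp z)) holomorphic_on upper_half"
  using holomorphic_on_compose_gen[OF holomorphic_on_qexp[OF holomorphic_on_ident] assms
      qexp_in_ball]
  by (simp add: o_def)

lemma qexp_at_i_inf: "(qexp \<longlongrightarrow> 0) at_i_inf"
proof (rule tendsto_norm_zero_cancel)
  have "((\<lambda>y. exp (- 2 * pi * y)) \<longlongrightarrow> 0) at_top"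
    by real_asymp
  hence "((\<lambda>z. exp (- 2 * pi * Im z)) \<longlongrightarrow> 0) at_i_inf"
    unfolding at_i_inf_def by (rule filterlim_compose) (rule filterlim_filtercomap)
  thus "((\<lambda>z. cmod (qexp z)) \<longlongrightarrow> 0) at_i_inf" by (simp add: norm_qexp)
qed

lemma periodic_of_int:
  assumes "\<And>z. Im z > 0 \<Longrightarrow> F (z + 1) = F z" "Im z > 0"
  shows "F (z + of_int n) = F z"
proof (induction n rule: int_induct[where k = 0])
  case (step1 i)
  thus ?case using assms(1)[of "z + of_int i"] assms(2) by (simp add: add_ac)
next
  case (step2 i)
  thus ?case using assms(1)[of "z + of_int (i - 1)"] assms(2) by (simp add: add_ac)
qed auto

text \<open>Periodicity makes \<open>F\<close> a function of \<open>q\<close>, local branches of the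
  logarithm make that function holomorphic on the punctured disc, and the bound near the cusp
  removes the singularity at 0.\<close>

lemma periodic_factor_qexp:
  assumes hol: "F holomorphic_on upper_half"
    and per: "\<And>z. Im z > 0 \<Longrightarrow> F (z + 1) = F z"
    and bd: "\<And>z. Im z > Y \<Longrightarrow> cmod (F z) \<le> B"
  obtains g where "g holomorphic_on ball 0 1" "\<And>z. Im z > 0 \<Longrightarrow> F z = g (qexp z)"
proof -
  define g where "g q = F (SOME z. Im z > 0 \<and> qexp z = q)" for q
  have g: "g (qexp z) = F z" if "Im z > 0" for z
  proof -
    define w where "w = (SOME w. Im w > 0 \<and> qexp w = qexp z)"
    have w: "Im w > 0 \<and> qexp w = qexp z"
      unfolding w_def by (rule someI[of _ z]) (use that in auto)
    then obtain n :: int where "w = z + of_int n" using qexp_eq_iff by blast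
    thus ?thesis using periodic_of_int[of F z n, OF per that] by (simp add: g_def w_def)
  qed
  have "g field_differentiable at q" if q: "q \<noteq> 0" "cmod q < 1" for q
  proof -
    obtain z where z: "Im z > 0" "qexp z = q" using qexp_surj[OF q] by blast
    \<comment> \<open>The local inverse of \<open>qexp\<close> that sends \<open>q\<close> to
      \<open>z\<close>; near \<open>q\<close> the argument \<open>p / q\<close> stays close to 1,
      away from the cut of \<open>Ln\<close>.\<close>
    define \<phi> where "\<phi> p = z + Ln (p / q) / (2 * of_real pi * \<i>)" for p
    have d\<phi>: "\<phi> field_differentiable at q"
      unfolding \<phi>_def using q by (auto intro!: derivative_intros
          analytic_on_imp_differentiable_at[of _ "{q}"] analytic_intros)
    have \<phi>q: "\<phi> q = z" using q by (simp add: \<phi>_def)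
    have "F field_differentiable at z"
      using hol z by (auto intro: holomorphic_on_imp_differentiable_at)
    hence "(F \<circ> \<phi>) field_differentiable at q"
      by (intro field_differentiable_compose d\<phi>) (simp add: \<phi>q)
    then obtain D where D: "(F \<circ> \<phi> has_field_derivative D) (at q)"
      by (auto simp: field_differentiable_def)
    have "isCont \<phi> q" using d\<phi> by (rule field_differentiable_imp_continuous_at)
    hence "((\<lambda>p. Im (\<phi> p)) \<longlongrightarrow> Im z) (nhds q)"
      by (intro tendsto_Im) (simp add: isCont_def tendsto_nhds_iff \<phi>q)
    hence "eventually (\<lambda>p. Im (\<phi> p) > 0) (nhds q)"
      by (rule order_tendstoD(1)) (use z in auto)
    moreover have "eventually (\<lambda>p. p \<noteq> 0) (nhds q)"
      using q by (intro t1_space_nhds) auto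
    ultimately have "eventually (\<lambda>p. (F \<circ> \<phi>) p = g p) (nhds q)"
    proof eventually_elim
      case (elim p)
      have "qexp (\<phi> p) = p" using elim q z by (simp add: \<phi>_def qexp_add qexp_Ln)
      thus ?case using g[of "\<phi> p"] elim by simp
    qed
    hence "(g has_field_derivative D) (at q)"
      using D by (subst (asm) has_field_derivative_cong_eventually[where g = g])
        (auto simp: eventually_at_filter elim: eventually_mono dest: eventually_nhds_x_imp_x)
    thus ?thesis by (auto simp: field_differentiable_def)
  qed
  hence "g holomorphic_on ball 0 1 - {0}"
    by (auto simp: holomorphic_on_def intro: field_differentiable_at_within)
  \<comment> \<open>Near 0 the condition \<open>cmod q < exp (- 2 * pi * Y)\<close> says
    \<open>Im z > Y\<close>, where \<open>F\<close> is bounded by \<open>B\<close>.\<close>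
  moreover have "eventually (\<lambda>q. cmod (g q) \<le> B) (at 0)"
  proof -
    have "eventually (\<lambda>q. cmod q < min 1 (exp (- 2 * pi * Y))) (nhds 0)"
      by (intro order_tendstoD(2)[OF tendsto_norm_zero]) (auto simp: tendsto_ident_at
          filterlim_ident)
    hence "eventually (\<lambda>q. cmod q < min 1 (exp (- 2 * pi * Y))) (at 0)"
      by (simp add: eventually_nhds_conv_at)
    moreover have "eventually (\<lambda>q. q \<noteq> 0) (at (0::complex))"
      by (simp add: eventually_at_filter)
    ultimately show ?thesis
    proof eventually_elim
      case (elim q)
      then obtain z where z: "Im z > 0" "qexp z = q" using qexp_surj[of q] by auto
      have "Im z > Y" using elim z norm_qexp[of z] by simp
      thus ?case using bd[of z] g[of z] z by simp
    qed
  qed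
  ultimately obtain h where h: "h holomorphic_on ball 0 1" "\<And>q. q \<in> ball 0 1 - {0} \<Longrightarrow> h q = g q"
    using holomorphic_on_extend_bounded[of g "ball 0 1" 0] by auto
  show ?thesis
  proof (rule that[OF h(1)])
    show "F z = h (qexp z)" if "Im z > 0" for z
      using h(2)[of "qexp z"] g[OF that] that by simp
  qed
qed

text \<open>\<open>g\<close> is \<open>f\<close> as a function of \<open>q\<close>, so that \<open>g 0\<close> is the value at the cusp. Invariance is
  required under \<open>z \<mapsto> z + 1\<close>, through \<open>g\<close>, and under \<open>z \<mapsto> -1/z\<close> only.\<close>

definition mform :: "nat \<Rightarrow> (complex \<Rightarrow> complex) \<Rightarrow> (complex \<Rightarrow> complex) \<Rightarrow> bool" where
  "mform k f g \<longleftrightarrow> g holomorphic_on ball 0 1 \<and> (\<forall>z. Im z > 0 \<longrightarrow> f z = g (qexp z)) \<and>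
     (\<forall>z. Im z > 0 \<longrightarrow> f (- 1 / z) = z ^ k * f z)"

lemma mform_holomorphic: "mform k f g \<Longrightarrow> f holomorphic_on upper_half"
  unfolding mform_def using holomorphic_on_comp_qexp[of g]
  by (subst holomorphic_cong[OF refl, where g = "\<lambda>z. g (qexp z)"]) auto

lemma mform_shift: "mform k f g \<Longrightarrow> Im z > 0 \<Longrightarrow> f (z + of_int n) = f z"
  by (simp add: mform_def)

lemma mform_neg_inverse: "mform k f g \<Longrightarrow> Im z > 0 \<Longrightarrow> f (- 1 / z) = z ^ k * f z"
  unfolding mform_def by blast

lemma mform_qexp: "mform k f g \<Longrightarrow> Im z > 0 \<Longrightarrow> f z = g (qexp z)"
  by (simp add: mform_def)

lemma mform_cmult: "mform k f g \<Longrightarrow> mform k (\<lambda>z. c * f z) (\<lambda>q. c * g q)"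
  by (auto simp: mform_def intro!: holomorphic_intros)

lemma mform_diff: "mform k f g \<Longrightarrow> mform k f' g' \<Longrightarrow> mform k (\<lambda>z. f z - f' z) (\<lambda>q. g q - g' q)"
  by (auto simp: mform_def ring_distribs intro!: holomorphic_intros)

lemma mform_power: "mform k f g \<Longrightarrow> mform (k * n) (\<lambda>z. f z ^ n) (\<lambda>q. g q ^ n)"
  by (auto simp: mform_def power_mult_distrib power_mult intro!: holomorphic_intros)

text \<open>Every point of the upper half plane is equivalent to one with \<open>Im z \<ge> 1/2\<close>, so on the
  unit disc \<open>\<bar>g\<bar>\<close> attains its supremum already on the compact disc \<open>\<bar>q\<bar> \<le> e\<^sup>-\<^sup>\<pi>\<close>.\<close>

lemma mform_0_const:
  assumes f: "mform 0 f g" and q: "q \<in> ball 0 1"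
  shows "g q = g 0"
proof -
  define r where "r = exp (- pi)"
  have r: "0 < r" "r < 1" by (auto simp: r_def)
  have hol: "g holomorphic_on ball 0 1" using f by (simp add: mform_def)
  have "continuous_on (cball 0 r) (\<lambda>q. cmod (g q))"
    using holomorphic_on_imp_continuous_on[OF hol] r
    by (intro continuous_on_norm) (auto elim!: continuous_on_subset)
  moreover have "compact (cball (0::complex) r)" "cball (0::complex) r \<noteq> {}" using r by auto
  ultimately obtain p where p: "p \<in> cball 0 r" "\<And>q. q \<in> cball 0 r \<Longrightarrow> cmod (g q) \<le> cmod (g p)"
    using continuous_attains_sup[of "cball 0 r" "\<lambda>q. cmod (g q)"] by blast
  have le: "cmod (f z) \<le> cmod (g p)" if "Im z > 0" for z
    using that
  proof (induction rule: upper_half_induct)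
    case (base z)
    have "qexp z \<in> cball 0 r" using base by (simp add: norm_qexp r_def)
    thus ?case using p(2)[of "qexp z"] base by (simp add: mform_qexp[OF f])
  qed (use mform_shift[OF f] mform_neg_inverse[OF f] in auto)
  have "cmod (g q) \<le> cmod (g p)" if "q \<in> ball 0 1" for q
  proof (cases "q = 0")
    case False
    then obtain z where z: "Im z > 0" "qexp z = q" using qexp_surj[of q] \<open>q \<in> ball 0 1\<close> by auto
    thus ?thesis using le[of z] mform_qexp[OF f, of z] by simp
  qed (use p r in auto)
  hence "g constant_on ball 0 1" using hol p r
    by (intro maximum_modulus_principle[where U = "ball 0 1" and \<xi> = p]) auto
  thus ?thesis using q by (metis constant_on_def centre_in_ball zero_less_one)
qed

lemma mform_0_const':
  assumes f: "mform 0 f g" and z: "Im z > 0"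
  shows "f z = g 0"
  using mform_0_const[OF f, of "qexp z"] mform_qexp[OF f] z by simp

text \<open>\<open>qexp\<close> maps the half plane onto the punctured disc, so only
  \<open>q = 0\<close> is left, and there continuity decides.\<close>

lemma mform_zero_cusp:
  assumes "mform k f g" "\<And>z. Im z > 0 \<Longrightarrow> f z = 0" "q \<in> ball 0 1"
  shows "g q = 0"
proof -
  have hol: "g holomorphic_on ball 0 1" using assms by (simp add: mform_def)
  have *: "g q = 0" if "q \<in> ball 0 1 - {0}" for q
    using that qexp_surj[of q] mform_qexp[OF assms(1)] assms(2) by (metis DiffE dist_0_norm mem_ball
        singletonI)
  have "g \<midarrow>0\<rightarrow> g 0"
    using holomorphic_on_imp_continuous_on[OF hol] by (simp add: continuous_on_eq_continuous_at
        isCont_def)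
  moreover have "g \<midarrow>0\<rightarrow> 0"
    by (rule tendsto_eventually, unfold eventually_at, rule exI[of _ 1]) (use * in auto)
  ultimately have "g 0 = 0" by (rule tendsto_unique[rotated]) auto
  thus ?thesis using *[of q] assms by (cases "q = 0") auto
qed

section \<open>Power series with coefficients of polynomial growth, lattice sums\<close>

definition conv1 :: "(nat \<Rightarrow> complex) \<Rightarrow> bool" where
  "conv1 a \<longleftrightarrow> (\<forall>q. cmod q < 1 \<longrightarrow> summable (\<lambda>n. a n * q ^ n))"

definition pser :: "(nat \<Rightarrow> complex) \<Rightarrow> complex \<Rightarrow> complex" where
  "pser a q = (\<Sum>n. a n * q ^ n)"

lemma conv1_norm_summable:
  assumes "conv1 a" "cmod q < 1"
  shows "summable (\<lambda>n. cmod (a n * q ^ n))"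
proof (rule powser_insidea)
  \<comment> \<open>The radius \<open>(1 + cmod q) / 2\<close> lies strictly between
    \<open>cmod q\<close> and 1.\<close>
  have "norm (of_real ((1 + cmod q) / 2) :: complex) = (1 + cmod q) / 2"
    by (subst norm_of_real) simp
  with assms show "summable (\<lambda>n. a n * of_real ((1 + cmod q) / 2) ^ n)"
    "cmod q < norm (of_real ((1 + cmod q) / 2) :: complex)"
    unfolding conv1_def by (simp_all del: of_real_divide of_real_add)
qed

lemma conv1_diffs: "conv1 a \<Longrightarrow> conv1 (diffs a)"
  unfolding conv1_def using termdiff_converges[of _ 1 a] by auto

text \<open>The new series is \<open>q\<close> times the termwise derivative, that is,
  \<open>q d/dq\<close> acting on coefficients.\<close>

lemma conv1_times_n:
  assumes "conv1 a"
  shows "conv1 (\<lambda>n. of_nat n * a n)"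
  unfolding conv1_def
proof (intro allI impI)
  fix q :: complex assume q: "cmod q < 1"
  have "summable (\<lambda>n. q * (diffs a n * q ^ n))"
    using conv1_diffs[OF assms] q by (auto simp: conv1_def intro: summable_mult)
  hence "summable (\<lambda>n. of_nat (Suc n) * a (Suc n) * q ^ Suc n)"
    by (simp add: diffs_def mult_ac)
  thus "summable (\<lambda>n. of_nat n * a n * q ^ n)" by (subst (asm) summable_Suc_iff)
qed

lemma conv1_powers: "conv1 (\<lambda>n. of_nat n ^ s)"
proof (induction s)
  case 0
  show ?case by (auto simp: conv1_def summable_geometric_iff)
next
  case (Suc s)
  thus ?case using conv1_times_n[OF Suc] by simp
qed

lemma conv1_poly_bound:
  assumes "\<And>n. cmod (a n) \<le> real n ^ s"
  shows "conv1 a"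
  unfolding conv1_def
proof (intro allI impI)
  fix q :: complex assume q: "cmod q < 1"
  show "summable (\<lambda>n. a n * q ^ n)"
  proof (rule summable_comparison_test)
    show "\<exists>N. \<forall>n\<ge>N. cmod (a n * q ^ n) \<le> cmod (of_nat n ^ s * q ^ n)"
      using assms by (auto simp: norm_mult norm_power intro!: mult_right_mono exI[of _ 0])
    show "summable (\<lambda>n. cmod (of_nat n ^ s * q ^ n))"
      using conv1_norm_summable[OF conv1_powers q] .
  qed
qed

lemma pser_sums: "conv1 a \<Longrightarrow> cmod q < 1 \<Longrightarrow> (\<lambda>n. a n * q ^ n) sums pser a q"
  unfolding pser_def conv1_def by (intro summable_sums) auto

lemma pser_has_field_derivative:
  "conv1 a \<Longrightarrow> cmod q < 1 \<Longrightarrow> (pser a has_field_derivative pser (diffs a) q) (at q)"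
  unfolding pser_def conv1_def by (rule termdiffs_strong'[where K = 1]) auto

lemma pser_times_n:
  assumes "conv1 a" "cmod q < 1"
  shows "pser (\<lambda>n. of_nat n * a n) q = q * pser (diffs a) q"
proof -
  have "(\<lambda>n. q * (diffs a n * q ^ n)) sums (q * pser (diffs a) q)"
    by (intro sums_mult pser_sums conv1_diffs assms)
  hence "(\<lambda>n. of_nat (Suc n) * a (Suc n) * q ^ Suc n) sums (q * pser (diffs a) q)"
    by (simp add: diffs_def mult_ac)
  hence "(\<lambda>n. of_nat n * a n * q ^ n) sums (q * pser (diffs a) q)"
    by (subst (asm) sums_Suc_iff) simp
  thus ?thesis unfolding pser_def by (rule sums_unique[symmetric])
qed

lemma pser_holomorphic: "conv1 a \<Longrightarrow> pser a holomorphic_on ball 0 1"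
  using pser_has_field_derivative by (subst holomorphic_on_open) (auto, blast)

lemma pser_0 [simp]: "pser a 0 = a 0"
  by (simp add: pser_def)

lemma pser_qexp_derivative:
  assumes "conv1 a" "Im z > 0"
  shows "((\<lambda>z. pser a (qexp z)) has_field_derivative
           2 * of_real pi * \<i> * pser (\<lambda>n. of_nat n * a n) (qexp z)) (at z)"
proof -
  have "cmod (qexp z) < 1" using assms by simp
  note DERIV_chain2[OF pser_has_field_derivative[OF assms(1) this] has_field_derivative_qexp[OF
      DERIV_ident]]
  thus ?thesis using assms by (simp add: pser_times_n mult_ac)
qed

text \<open>Links the unordered sums over \<open>{1..}\<close> in the definitions of the Eisenstein
  series with power series; the index sets agree because the coefficient at 0 vanishes.\<close>

lemma pser_has_sum:
  assumes "conv1 a" "cmod q < 1" "a 0 = 0"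
  shows "((\<lambda>n. a n * q ^ n) has_sum pser a q) {1..}"
proof -
  have "((\<lambda>n. a n * q ^ n) has_sum pser a q) UNIV"
    by (rule norm_summable_imp_has_sum[OF conv1_norm_summable pser_sums]) (use assms in auto)
  thus ?thesis
    by (rule has_sum_cong_neutral[THEN iffD1, rotated -1]) (use assms in \<open>auto simp: not_le\<close>)
qed

section \<open>Divisor sums and Lambert series\<close>

definition sigma_coeff :: "nat \<Rightarrow> nat \<Rightarrow> complex" where
  "sigma_coeff s n = of_nat (divisor_sum s n)"

text \<open>There are at most \<open>n\<close> divisors, each at most \<open>n\<close>; polynomial
  growth is all that convergence in the unit disc requires.\<close>

lemma divisor_sum_le: "divisor_sum s n \<le> n ^ Suc s"
proof (cases "n = 0")
  case False
  have "divisor_sum s n \<le> (\<Sum>d\<in>{1..n}. n ^ s)"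
    unfolding divisor_sum_def using False
    by (intro order_trans[OF sum_mono[of _ _ "\<lambda>_. n ^ s"] sum_mono2])
       (auto simp: Suc_le_eq dvd_pos_nat intro!: power_mono intro: dvd_imp_le)
  thus ?thesis by simp
qed (simp add: divisor_sum_def)

lemma conv1_sigma: "conv1 (sigma_coeff s)"
proof (rule conv1_poly_bound)
  show "cmod (sigma_coeff s n) \<le> real n ^ Suc s" for n
    unfolding sigma_coeff_def norm_of_nat using divisor_sum_le[of s n] by (metis of_nat_le_iff
        of_nat_power)
qed

text \<open>Every natural number divides 0, and a sum over an infinite set is 0 by convention; hence
  the constant term vanishes, as \<open>pser_has_sum\<close> requires.\<close>

lemma sigma_coeff_0 [simp]: "sigma_coeff s 0 = 0"
  by (simp add: sigma_coeff_def divisor_sum_def)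

lemma sigma_coeff_1 [simp]: "sigma_coeff s (Suc 0) = 1"
  by (simp add: sigma_coeff_def divisor_sum_def)

lemma infsum_sigma_coeff:
  assumes "Im z > 0"
  shows "(\<Sum>\<^sub>\<infinity>n\<in>{1..}. of_nat (divisor_sum s n) * qexp z ^ n) = pser (sigma_coeff s) (qexp z)"
  using infsumI[OF pser_has_sum[OF conv1_sigma norm_qexp_less[OF assms] sigma_coeff_0[of s]]]
  by (simp add: sigma_coeff_def[abs_def])

text \<open>Both sides regroup the double series of \<open>d^s q^(m d)\<close>: pairs
  \<open>(m, d)\<close> with product \<open>n\<close> correspond to the divisors \<open>d\<close> of
  \<open>n\<close>. With \<open>s > 0\<close> the term \<open>d = 0\<close> of the inner series
  vanishes.\<close>

lemma lambert_series:
  assumes q: "cmod q < 1" and s: "s > 0"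
  shows "((\<lambda>m. pser (\<lambda>d. of_nat d ^ s) (q ^ m)) has_sum pser (sigma_coeff s) q) {1..}"
proof -
  let ?B = "\<lambda>n::nat. {d. d dvd n}"
  have fin: "finite (?B n)" if "n \<in> {1..}" for n using that by auto
  \<comment> \<open>Absolute summability is tested with \<open>n\<close> outside: the inner sums are
    finite and equal the norms of the terms of the \<open>sigma_coeff\<close> series.\<close>
  have "(\<lambda>(n,d). real d ^ s * cmod q ^ n) summable_on Sigma {1..} ?B"
  proof (rule summable_on_SigmaI)
    show "((\<lambda>d. case (n, d) of (n, d) \<Rightarrow> real d ^ s * cmod q ^ n) has_sum cmod (sigma_coeff s n * q ^
        n)) (?B n)"
      if "n \<in> {1..}" for n
    proof (rule has_sum_finiteI[OF fin[OF that]])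
      have "cmod (sigma_coeff s n * q ^ n) = (\<Sum>d | d dvd n. real d ^ s) * cmod q ^ n"
        by (simp only: sigma_coeff_def norm_mult norm_power norm_of_nat) (simp add: divisor_sum_def)
      thus "cmod (sigma_coeff s n * q ^ n) = (\<Sum>d\<in>?B n. case (n, d) of (n, d) \<Rightarrow> real d ^ s * cmod q ^
          n)"
        by (simp add: sum_distrib_right)
    qed
    show "(\<lambda>n. cmod (sigma_coeff s n * q ^ n)) summable_on {1..}"
      by (rule summable_on_subset[OF summable_nonneg_imp_summable_on[OF conv1_norm_summable[OF
          conv1_sigma q]]]) simp_all
  qed auto
  also have "(\<lambda>(n,d). real d ^ s * cmod q ^ n) = (\<lambda>x. cmod ((\<lambda>(n,d). of_nat d ^ s * q ^ n) x))"
    by (simp add: fun_eq_iff norm_mult norm_power)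
  finally have "(\<lambda>(n,d). of_nat d ^ s * q ^ n) summable_on Sigma {1..} ?B"
    by (rule abs_summable_summable)
  then obtain S where S: "((\<lambda>(n,d). of_nat d ^ s * q ^ n) has_sum S) (Sigma {1..} ?B)"
    unfolding summable_on_def by blast
  have "((\<lambda>n. sigma_coeff s n * q ^ n) has_sum S) {1..}"
  proof (rule has_sum_SigmaD[OF S])
    fix n :: nat assume n: "n \<in> {1..}"
    show "((\<lambda>d. case (n, d) of (n, d) \<Rightarrow> of_nat d ^ s * q ^ n) has_sum sigma_coeff s n * q ^ n) (?B
        n)"
      by (rule has_sum_finiteI[OF fin[OF n]]) (simp add: sigma_coeff_def divisor_sum_def
          sum_distrib_right)
  qed
  with pser_has_sum[OF conv1_sigma q sigma_coeff_0] have S_eq: "S = pser (sigma_coeff s) q"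
    by (metis has_sum_unique)
  have "((\<lambda>(m,d). of_nat d ^ s * (q ^ m) ^ d) has_sum S) ({1..} \<times> {1..})"
  proof (subst has_sum_reindex_bij_witness[where j = "\<lambda>(m, d). (m * d, d)" and i =
      "\<lambda>(n, d). (n div d, d)"
      and T = "Sigma {1..} ?B" and h = "\<lambda>(n, d). of_nat d ^ s * q ^ n" and s' = S])
    fix x :: "nat \<times> nat" assume x: "x \<in> {1..} \<times> {1..}"
    obtain m d where md: "x = (m, d)" by (cases x)
    show "(case (case x of (m, d) \<Rightarrow> (m * d, d)) of (n, d) \<Rightarrow> (n div d, d)) = x"
      using x by (simp add: md)
    show "(case x of (m, d) \<Rightarrow> (m * d, d)) \<in> Sigma {1..} ?B"
      using x by (simp add: md)
    show "(case (case x of (m, d) \<Rightarrow> (m * d, d)) of (n, d) \<Rightarrow> of_nat d ^ s * q ^ n)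
        = (case x of (m, d) \<Rightarrow> of_nat d ^ s * (q ^ m) ^ d)"
      by (simp only: md prod.case power_mult)
  next
    fix y :: "nat \<times> nat" assume y: "y \<in> Sigma {1..} ?B"
    obtain n d where nd: "y = (n, d)" by (cases y)
    have "n > 0" "d dvd n" using y by (auto simp: nd)
    then obtain m where m: "n = d * m" unfolding dvd_def by blast
    with \<open>n > 0\<close> have "d > 0" "m > 0" by auto
    with m show "(case (case y of (n, d) \<Rightarrow> (n div d, d)) of (m, d) \<Rightarrow> (m * d, d)) = y"
      "(case y of (n, d) \<Rightarrow> (n div d, d)) \<in> {1..} \<times> {1..}"
      by (simp_all add: nd)
  qed (use S in \<open>simp_all only:\<close>)
  hence "((\<lambda>m. pser (\<lambda>d. of_nat d ^ s) (q ^ m)) has_sum S) {1..}"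
  proof (rule has_sum_SigmaD)
    fix m :: nat assume m: "m \<in> {1..}"
    have "cmod (q ^ m) < 1" using q m by (simp add: norm_power power_less_one_iff)
    thus "((\<lambda>d. case (m, d) of (m, d) \<Rightarrow> of_nat d ^ s * (q ^ m) ^ d) has_sum pser (\<lambda>d. of_nat d ^ s)
        (q ^ m)) {1..}"
      using pser_has_sum[OF conv1_powers, of "q ^ m" s] s by simp
  qed
  thus ?thesis by (simp add: S_eq)
qed

section \<open>Convergence of sums over the integers and over planar lattices\<close>

lemma linear_form_bound:
  assumes "Im z > 0"
  obtains \<epsilon> where "\<epsilon> > 0" "\<And>m n::real. cmod (of_real m * z + of_real n) \<ge> \<epsilon> * (\<bar>m\<bar> + \<bar>n\<bar>)"
proof -
  \<comment> \<open>The imaginary part gives \<open>\<bar>m\<bar> \<le> cmod w / Im z\<close> for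
    \<open>w = m z + n\<close>, and the triangle inequality then bounds \<open>\<bar>n\<bar>\<close>
    by \<open>cmod w + \<bar>m\<bar> * cmod z\<close>; \<open>K\<close> adds up both
    estimates.\<close>
  define K where "K = 1 + (1 + cmod z) / Im z"
  have K: "K > 0" using assms by (auto simp: K_def add_pos_nonneg)
  have "(\<bar>m\<bar> + \<bar>n\<bar>) \<le> K * cmod (of_real m * z + of_real n)" for m n :: real
  proof -
    let ?w = "of_real m * z + of_real n"
    have "\<bar>m\<bar> * Im z = \<bar>Im ?w\<bar>" using assms by (simp add: abs_mult)
    also have "\<dots> \<le> cmod ?w" by (rule abs_Im_le_cmod)
    finally have m: "\<bar>m\<bar> \<le> cmod ?w / Im z" using assms by (simp add: field_simps)
    have "\<bar>n\<bar> = cmod (?w - of_real m * z)" by simp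
    also have "\<dots> \<le> cmod ?w + cmod (of_real m * z)" by (rule norm_triangle_ineq4)
    also have "\<dots> = cmod ?w + \<bar>m\<bar> * cmod z" by (simp add: norm_mult)
    also have "\<dots> \<le> cmod ?w + cmod ?w / Im z * cmod z"
      by (intro add_mono mult_right_mono m) auto
    finally have n: "\<bar>n\<bar> \<le> cmod ?w + cmod ?w / Im z * cmod z" .
    have K_eq: "K * cmod ?w = cmod ?w + cmod ?w / Im z + cmod ?w / Im z * cmod z"
      unfolding K_def by (simp add: ring_distribs add_divide_distrib mult_ac)
    show ?thesis unfolding K_eq using m n by linarith
  qed
  hence "1 / K * (\<bar>m\<bar> + \<bar>n\<bar>) \<le> cmod (of_real m * z + of_real n)" for m n :: real
    using K by (simp add: divide_le_eq mult.commute)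
  thus ?thesis using K by (intro that[of "1 / K"]) auto
qed

lemma summable_on_int:
  fixes f :: "int \<Rightarrow> real"
  assumes "summable (\<lambda>n. f (int n))" "summable (\<lambda>n. f (- int n))" "\<And>n. f n \<ge> 0"
  shows "f summable_on UNIV"
proof -
  have "(f \<circ> int) summable_on UNIV" "(f \<circ> (\<lambda>n. - int n)) summable_on UNIV"
    unfolding o_def by (intro summable_nonneg_imp_summable_on assms)+
  moreover have "inj int" "inj (\<lambda>n. - int n)" by (simp_all add: inj_on_def)
  ultimately have "f summable_on range int" "f summable_on range (\<lambda>n. - int n)"
    using summable_on_reindex[of int UNIV f] summable_on_reindex[of "\<lambda>n. - int n" UNIV f] by blast+
  hence "f summable_on (range int \<union> range (\<lambda>n. - int n))" by (rule summable_on_union)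
  moreover have "x \<in> range int \<union> range (\<lambda>n. - int n)" for x
    by (cases x rule: int_cases2) auto
  hence "range int \<union> range (\<lambda>n. - int n) = UNIV" by blast
  ultimately show ?thesis by simp
qed

lemma summable_on_int_powr:
  assumes "s < -1"
  shows "(\<lambda>n::int. (1 + \<bar>real_of_int n\<bar>) powr s) summable_on UNIV"
proof -
  have "summable (\<lambda>n. real n powr s)" using assms by (simp add: summable_real_powr_iff)
  hence "summable (\<lambda>n. real (Suc n) powr s)" by (subst summable_Suc_iff)
  hence "summable (\<lambda>n. (1 + real n) powr s)" by simp
  thus ?thesis by (intro summable_on_int) auto
qed

lemma summable_on_int2_powr:
  assumes "s < -1"
  shows "(\<lambda>(m::int, n::int). (1 + \<bar>real_of_int m\<bar>) powr s * (1 + \<bar>real_of_int n\<bar>) powr s)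
      summable_on UNIV"
proof -
  let ?g = "\<lambda>n::int. (1 + \<bar>real_of_int n\<bar>) powr s"
  have "(\<lambda>(m, n). ?g m * ?g n) summable_on (UNIV \<times> UNIV)"
  proof (rule summable_on_SigmaI)
    show "((\<lambda>n. case (m, n) of (m, n) \<Rightarrow> ?g m * ?g n) has_sum ?g m * infsum ?g UNIV) UNIV" for m
      using has_sum_cmult_right[OF has_sum_infsum[OF summable_on_int_powr[OF assms]]] by simp
    show "(\<lambda>m. ?g m * infsum ?g UNIV) summable_on UNIV"
      by (intro summable_on_cmult_left summable_on_int_powr assms)
  qed auto
  thus ?thesis by simp
qed

text \<open>The exponent \<open>-3\<close> is split evenly between the two variables.\<close>

lemma lattice_power_bound:
  assumes "(m, n) \<noteq> (0, 0)" "k \<ge> 3"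
  shows "1 / (\<bar>real_of_int m\<bar> + \<bar>real_of_int n\<bar>) ^ k
           \<le> 9 * ((1 + \<bar>real_of_int m\<bar>) powr (-3/2) * (1 + \<bar>real_of_int n\<bar>) powr (-3/2))"
proof -
  define a where "a = \<bar>real_of_int m\<bar>" define b where "b = \<bar>real_of_int n\<bar>"
  have "a + b = real_of_int (\<bar>m\<bar> + \<bar>n\<bar>)" by (simp add: a_def b_def)
  also have "\<bar>m\<bar> + \<bar>n\<bar> \<ge> 1" using assms by auto
  hence "real_of_int (\<bar>m\<bar> + \<bar>n\<bar>) \<ge> 1" by linarith
  finally have ab: "a + b \<ge> 1" .
  have nn: "a \<ge> 0" "b \<ge> 0" by (simp_all add: a_def b_def)
  \<comment> \<open>Since \<open>a + b \<ge> 1\<close>, each of the factors \<open>1 + a\<close> and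
    \<open>1 + b\<close> is at most \<open>2 * (a + b)\<close>.\<close>
  have "(1 + a) * (1 + b) \<le> 4 * (a + b)\<^sup>2"
  proof -
    have "(1 + a) * (1 + b) \<le> (2 * (a + b)) * (2 * (a + b))"
      using nn ab by (intro mult_mono) auto
    thus ?thesis by (simp add: power2_eq_square algebra_simps)
  qed
  hence "((1 + a) * (1 + b)) powr (3/2) \<le> (4 * (a + b)\<^sup>2) powr (3/2)"
    using nn by (intro powr_mono2) auto
  also have "\<dots> = 8 * (a + b) ^ 3"
  proof -
    have "(4 * (a + b)\<^sup>2) = (2 * (a + b)) powr 2" using ab by (simp add: power2_eq_square
        powr_numeral algebra_simps)
    hence "(4 * (a + b)\<^sup>2) powr (3/2) = (2 * (a + b)) powr 3" by (simp add: powr_powr)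
    also have "\<dots> = 8 * (a + b) ^ 3" using ab by (simp add: powr_numeral power_mult_distrib del:
        distrib_left_numeral)
    finally show ?thesis .
  qed
  also have "\<dots> \<le> 9 * (a + b) ^ 3" using ab by simp
  finally have le: "((1 + a) * (1 + b)) powr (3/2) \<le> 9 * (a + b) ^ 3" .
  have pos: "((1 + a) * (1 + b)) powr (3/2) > 0" using nn by simp
  have "1 / (a + b) ^ 3 = 9 / (9 * (a + b) ^ 3)" by simp
  also have "\<dots> \<le> 9 / ((1 + a) * (1 + b)) powr (3/2)"
    using le pos ab by (intro divide_left_mono mult_pos_pos) auto
  also have "\<dots> = 9 * ((1 + a) powr (-3/2) * (1 + b) powr (-3/2))"
    using nn by (simp add: powr_mult powr_minus_divide)
  finally have "1 / (a + b) ^ 3 \<le> 9 * ((1 + a) powr (-3/2) * (1 + b) powr (-3/2))" .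
  moreover have "1 / (a + b) ^ k \<le> 1 / (a + b) ^ 3"
    using ab assms by (intro divide_left_mono power_increasing mult_pos_pos zero_less_power) auto
  ultimately show ?thesis by (simp add: a_def b_def)
qed

lemma lattice_summable:
  assumes "k \<ge> 3"
  shows "(\<lambda>(m::int, n::int). 1 / (\<bar>real_of_int m\<bar> + \<bar>real_of_int n\<bar>) ^ k) summable_on (- {(0, 0)})"
proof (rule summable_on_comparison_test)
  show "(\<lambda>(m, n). 9 * ((1 + \<bar>real_of_int m\<bar>) powr (-3/2) * (1 + \<bar>real_of_int n\<bar>) powr (-3/2)))
      summable_on (- {(0, 0)})"
    using summable_on_cmult_right[OF summable_on_subset[OF summable_on_int2_powr[of "-3/2"], of
        "- {(0,0)}"], of 9]
    by (simp add: case_prod_unfold)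
qed (use lattice_power_bound[OF _ assms] in auto)

lemma summable_int_power:
  assumes "Im z > 0" "k \<ge> 2"
  shows "(\<lambda>n::int. cmod (inverse ((z + of_int n) ^ k))) summable_on UNIV"
proof -
  obtain \<epsilon> where \<epsilon>: "\<epsilon> > 0" "\<And>m n::real. cmod (of_real m * z + of_real n) \<ge> \<epsilon> * (\<bar>m\<bar> + \<bar>n\<bar>)"
    using linear_form_bound[OF assms(1)] by metis
  show ?thesis
  proof (rule summable_on_comparison_test)
    show "(\<lambda>n::int. 1 / \<epsilon> ^ k * (1 + \<bar>real_of_int n\<bar>) powr (- real k)) summable_on UNIV"
      by (intro summable_on_cmult_right summable_on_int_powr) (use assms in auto)
    show "cmod (inverse ((z + of_int n) ^ k)) \<le> 1 / \<epsilon> ^ k * (1 + \<bar>real_of_int n\<bar>) powr (- real k)"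
        for n
    proof -
      have "cmod (z + of_int n) \<ge> \<epsilon> * (1 + \<bar>real_of_int n\<bar>)" using \<epsilon>(2)[of 1 "of_int n"] by simp
      hence "cmod (z + of_int n) ^ k \<ge> (\<epsilon> * (1 + \<bar>real_of_int n\<bar>)) ^ k"
        using \<epsilon>(1) by (intro power_mono) auto
      hence "inverse (cmod (z + of_int n) ^ k) \<le> inverse ((\<epsilon> * (1 + \<bar>real_of_int n\<bar>)) ^ k)"
        using \<epsilon>(1) by (intro le_imp_inverse_le) auto
      thus ?thesis
        by (simp add: norm_divide norm_power powr_minus powr_realpow power_mult_distrib
            inverse_eq_divide)
    qed
  qed auto
qed

section \<open>Partial fractions and the Lipschitz formula\<close>

text \<open>The intervals \<open>{-N..N}\<close> are cofinal among the finite sets of integers.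
  Symmetric partial sums are the common language in which unordered sums meet the series below that
  converge only conditionally.\<close>

lemma has_sum_int_symmetric:
  fixes f :: "int \<Rightarrow> complex"
  assumes "(f has_sum S) UNIV"
  shows "(\<lambda>N. \<Sum>n\<in>{- int N..int N}. f n) \<longlonglongrightarrow> S"
proof -
  have "filterlim (\<lambda>N. {- int N..int N}) (finite_subsets_at_top UNIV) sequentially"
    unfolding filterlim_finite_subsets_at_top
  proof (intro allI impI)
    fix X :: "int set" assume "finite X \<and> X \<subseteq> UNIV"
    hence X: "finite X" by simp
    show "\<forall>\<^sub>F N in sequentially. finite {- int N..int N} \<and> X \<subseteq> {- int N..int N} \<and> {- int N..int N} \<subseteq>
        UNIV"
    \<comment> \<open>The sum of the absolute values over \<open>X\<close> bounds each of them, so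
      it serves as threshold.\<close>
    proof (rule eventually_sequentiallyI[of "\<Sum>x\<in>X. nat \<bar>x\<bar>"])
      fix N assume N: "(\<Sum>x\<in>X. nat \<bar>x\<bar>) \<le> N"
      have "nat \<bar>x\<bar> \<le> N" if "x \<in> X" for x
        using member_le_sum[OF that, of "\<lambda>x. nat \<bar>x\<bar>"] X N by simp
      hence "X \<subseteq> {- int N..int N}" by force
      thus "finite {- int N..int N} \<and> X \<subseteq> {- int N..int N} \<and> {- int N..int N} \<subseteq> UNIV" by simp
    qed
  qed
  with assms show ?thesis unfolding has_sum_def by (rule filterlim_compose)
qed

lemma sum_int_symmetric:
  fixes f :: "int \<Rightarrow> complex"
  shows "(\<Sum>n\<in>{- int N..int N}. f n) = f 0 + (\<Sum>k<N. f (int (Suc k)) + f (- int (Suc k)))"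
proof (induction N)
  case (Suc N)
  have "{- int (Suc N)..int (Suc N)} = insert (int (Suc N)) (insert (- int (Suc N)) {- int N..int
      N})"
    by auto
  thus ?case using Suc by (simp add: add_ac)
qed simp

lemma has_sum_int_sums:
  fixes f :: "int \<Rightarrow> complex"
  assumes "(f has_sum S) UNIV"
  shows "(\<lambda>k. f (int (Suc k)) + f (- int (Suc k))) sums (S - f 0)"
  using tendsto_diff[OF has_sum_int_symmetric[OF assms] tendsto_const[of "f 0"]]
  unfolding sum_int_symmetric sums_def by simp

text \<open>The terms telescope with step 2, hence two boundary terms survive at each end.\<close>

lemma sum_int_telescope:
  fixes g :: "int \<Rightarrow> complex"
  shows "(\<Sum>n\<in>{- int N..int N}. g (n - 1) - g (n + 1))
     = g (- int N - 1) + g (- int N) - g (int N) - g (int N + 1)"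
  unfolding sum_int_symmetric
proof (induction N)
  case (Suc N)
  have e: "- int (Suc N) = - int N - 1" "int (Suc N) = int N + 1" by simp_all
  show ?case using Suc unfolding sum.lessThan_Suc e
    by (simp add: algebra_simps) (rule arg_cong[where f = g], simp)
qed simp

lemma has_sum_atLeast_1_sums:
  fixes f :: "nat \<Rightarrow> complex"
  assumes "(f has_sum S) {1..}"
  shows "(\<lambda>k. f (Suc k)) sums S"
proof (rule has_sum_imp_sums)
  have "bij_betw Suc UNIV {1..}" by (rule bij_betwI[of _ _ _ "\<lambda>n. n - 1"]) auto
  thus "((\<lambda>k. f (Suc k)) has_sum S) UNIV"
    using assms has_sum_reindex_bij_betw by blast
qed

lemma upper_half_not_nonpos_Ints: "Im z > 0 \<Longrightarrow> z \<notin> \<int>\<^sub>\<le>\<^sub>0" "Im z > 0 \<Longrightarrow> 1 - z \<notin> \<int>\<^sub>\<le>\<^sub>0"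
  by (auto elim!: nonpos_Ints_cases simp: complex_eq_iff)

text \<open>Differentiating the reflection formula for \<open>rGamma\<close> turns the difference
  into \<open>pi cot (pi z)\<close>, which is then written in terms of
  \<open>qexp z\<close>.\<close>

lemma Digamma_reflection_qexp:
  assumes z: "Im z > 0"
  shows "Digamma (1 - z) - Digamma z = of_real pi * \<i> * (qexp z + 1) / (qexp z - 1)"
proof -
  let ?s = "sin (of_real pi * z)" and ?c = "cos (of_real pi * z)"
  have "((\<lambda>z. rGamma z * rGamma (1 - z)) has_field_derivative
          (- rGamma z * Digamma z) * rGamma (1 - z) + (- rGamma (1 - z) * Digamma (1 - z) * (0 - 1))
              * rGamma z) (at z)"
    using z upper_half_not_nonpos_Ints[OF z]
    by (intro DERIV_mult DERIV_chain2[of rGamma, OF has_field_derivative_rGamma_no_nonpos_int]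
          has_field_derivative_rGamma_no_nonpos_int DERIV_diff DERIV_const DERIV_ident) auto
  moreover have "((\<lambda>z. sin (of_real pi * z) / of_real pi) has_field_derivative ?c) (at z)"
    by (auto intro!: derivative_eq_intros)
  ultimately have "(- rGamma z * Digamma z) * rGamma (1 - z) + (- rGamma (1 - z) * Digamma (1 - z) *
      (0 - 1)) * rGamma z = ?c"
    unfolding rGamma_reflection_complex by (rule DERIV_unique)
  hence "(rGamma z * rGamma (1 - z)) * (Digamma (1 - z) - Digamma z) = ?c"
    by (simp add: algebra_simps)
  hence eq: "?s * (Digamma (1 - z) - Digamma z) = of_real pi * ?c"
    unfolding rGamma_reflection_complex by (simp add: field_simps)
  \<comment> \<open>A square root of \<open>qexp z\<close>, in which sine and cosine of
    \<open>pi z\<close> are Laurent polynomials.\<close>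
  define e where "e = exp (\<i> * (of_real pi * z))"
  have e: "e \<noteq> 0" "qexp z = e\<^sup>2"
    by (auto simp: e_def qexp_def exp_double mult_ac simp flip: exp_of_nat_mult)
  have q1: "qexp z \<noteq> 1" using norm_qexp_less[OF z] by auto
  have s: "?s = (e - 1 / e) / (2 * \<i>)" and c: "?c = (e + 1 / e) / 2"
    by (simp_all add: sin_exp_eq cos_exp_eq e_def exp_minus inverse_eq_divide)
  have "(e\<^sup>2 - 1) * (Digamma (1 - z) - Digamma z) = of_real pi * \<i> * (e\<^sup>2 + 1)"
  proof -
    have "(e\<^sup>2 - 1) * X = (2 * \<i> * e) * ((e - 1 / e) / (2 * \<i>) * X)" for X
      using e(1) by (simp add: field_simps power2_eq_square)
    also have "(e - 1 / e) / (2 * \<i>) * (Digamma (1 - z) - Digamma z) = of_real pi * ((e + 1 / e) /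
        2)"
      using eq by (simp only: s c)
    also have "(2 * \<i> * e) * (of_real pi * ((e + 1 / e) / 2)) = of_real pi * \<i> * (e\<^sup>2 + 1)"
      using e(1) by (simp add: field_simps power2_eq_square)
    finally show ?thesis .
  qed
  thus ?thesis using q1 by (simp add: e field_simps)
qed

text \<open>The cotangent formula is differentiated \<open>j\<close> times; each derivative
  multiplies the coefficient of \<open>q^n\<close> by \<open>2 pi i n\<close>. For
  \<open>j = 0\<close> the identity holds only up to the constant \<open>- pi i\<close>, which the
  first derivative removes, so the induction starts at 1.\<close>

lemma Polygamma_reflection:
  assumes "Im z > 0" "j \<ge> 1"
  shows "Polygamma j z + (-1) ^ Suc j * Polygamma j (1 - z) =
           (2 * of_real pi * \<i>) ^ Suc j * pser (\<lambda>n. of_nat n ^ j) (qexp z)"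
proof -
  let ?R = "\<lambda>j z. Polygamma j z + (-1) ^ Suc j * Polygamma j (1 - z) :: complex"
  let ?T = "\<lambda>j z. (2 * of_real pi * \<i>) ^ Suc j * pser (\<lambda>n. of_nat n ^ j) (qexp z)"
  have dR: "(?R j has_field_derivative ?R (Suc j) z) (at z)" if "Im z > 0" for j z
  proof -
    have "(?R j has_field_derivative Polygamma (Suc j) z + (-1) ^ Suc j * (Polygamma (Suc j) (1 - z)
        * (0 - 1))) (at z)"
      using upper_half_not_nonpos_Ints[OF that]
      by (intro DERIV_add DERIV_cmult DERIV_chain2[of "Polygamma j" _ "\<lambda>z. 1 - z"]
            has_field_derivative_Polygamma DERIV_diff DERIV_const DERIV_ident) auto
    thus ?thesis by simp
  qed
  have dT: "(?T j has_field_derivative ?T (Suc j) z) (at z)" if "Im z > 0" for j z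
    using DERIV_cmult[OF pser_qexp_derivative[OF conv1_powers[of j] that], of
        "(2 * of_real pi * \<i>) ^ Suc j"]
    by (simp add: mult_ac)
  have "\<forall>z. Im z > 0 \<longrightarrow> ?R j z = ?T j z"
    using assms(2)
  proof (induction j rule: dec_induct)
    case base
    show ?case
    proof (intro allI impI)
      fix z :: complex assume z: "Im z > 0"
      have "eventually (\<lambda>w. Im w > 0) (nhds z)"
        using eventually_nhds_in_open[OF open_upper_half, of z] z by simp
      hence "eventually (\<lambda>w. ?R 0 w = ?T 0 w - of_real pi * \<i>) (nhds z)"
      proof eventually_elim
        case (elim w)
        have q: "cmod (qexp w) < 1" "qexp w \<noteq> 1" using norm_qexp_less[OF elim] by auto
        have "pser (\<lambda>n. of_nat n ^ 0) (qexp w) = 1 / (1 - qexp w)"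
          unfolding pser_def using suminf_geometric[OF q(1)] by simp
        moreover have "- (of_real pi * \<i> * (qexp w + 1) / (qexp w - 1)) =
            2 * of_real pi * \<i> * (1 / (1 - qexp w)) - of_real pi * \<i>"
          using q by (simp add: divide_simps) (simp add: algebra_simps)
        moreover have "Digamma w - Digamma (1 - w) = - (of_real pi * \<i> * (qexp w + 1) / (qexp w -
            1))"
          using Digamma_reflection_qexp[OF elim] by (metis minus_diff_eq)
        ultimately show ?case by simp
      qed
      moreover have "((\<lambda>z. ?T 0 z - of_real pi * \<i>) has_field_derivative ?T 1 z) (at z)"
        using DERIV_diff[OF dT[OF z, of 0] DERIV_const[of "of_real pi * \<i>"]] by simp
      ultimately have "(?R 0 has_field_derivative ?T 1 z) (at z)"
        using DERIV_cong_ev[OF refl _ refl, of "?R 0" "\<lambda>z. ?T 0 z - of_real pi * \<i>" z] by simp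
      with dR[OF z, of 0] show "?R 1 z = ?T 1 z" using DERIV_unique by fastforce
    qed
  next
    case (step j)
    show ?case
    proof (intro allI impI)
      fix z :: complex assume z: "Im z > 0"
      have "eventually (\<lambda>w. Im w > 0) (nhds z)"
        using eventually_nhds_in_open[OF open_upper_half, of z] z by simp
      hence "eventually (\<lambda>w. ?R j w = ?T j w) (nhds z)"
        by eventually_elim (use step in auto)
      hence "(?R j has_field_derivative ?T (Suc j) z) (at z)"
        using DERIV_cong_ev[OF refl _ refl, of "?R j" "?T j" z] dT[OF z, of j] by simp
      with dR[OF z, of j] show "?R (Suc j) z = ?T (Suc j) z" by (rule DERIV_unique)
    qed
  qed
  thus ?thesis using assms by blast
qed

text \<open>The integers \<open>n \<ge> 0\<close> and \<open>n < 0\<close> contribute the series of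
  \<open>Polygamma\<close> at \<open>z\<close> and at \<open>1 - z\<close>; evenness of
  \<open>k\<close> absorbs the sign in the second half.\<close>

lemma lipschitz_formula:
  assumes z: "Im z > 0" and k: "even k" "k \<ge> 2"
  shows "((\<lambda>n::int. inverse ((z + of_int n) ^ k)) has_sum
           (2 * of_real pi * \<i>) ^ k / fact (k - 1) * pser (\<lambda>n. of_nat n ^ (k - 1)) (qexp z)) UNIV"
proof -
  let ?f = "\<lambda>n::int. inverse ((z + of_int n) ^ k)"
  obtain j where j: "k = Suc j" "j \<ge> 1" using k by (cases k) auto
  have "?f summable_on UNIV" by (rule abs_summable_summable[OF summable_int_power[OF z k(2)]])
  then obtain S where S: "(?f has_sum S) UNIV" unfolding summable_on_def by blast
  have sm: "(\<lambda>m. inverse ((w + of_nat m) ^ k)) sums (Polygamma j w / fact j)" if "w \<noteq> 0" for w ::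
      complex
    using Polygamma_converges'[OF that k(2)] k j by (simp add: sums_iff Polygamma_def)
  have "z \<noteq> 0" "1 - z \<noteq> 0" using z by auto
  from sums_add[OF sm[OF this(1)] sm[OF this(2)]]
  have s1: "(\<lambda>m. inverse ((z + of_nat m) ^ k) + inverse ((1 - z + of_nat m) ^ k)) sums
     ((Polygamma j z + Polygamma j (1 - z)) / fact j)" by (simp add: add_divide_distrib)
  have "(\<lambda>m. ?f (int m) + ?f (- int (Suc m))) sums S"
  proof -
    \<comment> \<open>Dropping the end term \<open>N\<close>, which tends to 0, leaves the pairs
      \<open>m\<close> and \<open>- (m + 1)\<close>.\<close>
    have "(\<lambda>N. (\<Sum>n\<in>{- int N..int N}. ?f n) - ?f (int N)) \<longlonglongrightarrow> S - 0"
    proof (intro tendsto_diff has_sum_int_symmetric[OF S])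
      show "(\<lambda>N. ?f (int N)) \<longlonglongrightarrow> 0"
        using summable_LIMSEQ_zero[OF sums_summable[OF sm[OF \<open>z \<noteq> 0\<close>]]] by simp
    qed
    moreover have "(\<Sum>n\<in>{- int N..int N}. ?f n) - ?f (int N) = (\<Sum>m<N. ?f (int m) + ?f (- int (Suc
        m)))" for N
      unfolding sum_int_symmetric by (induction N) (auto simp: algebra_simps)
    ultimately show ?thesis by (simp add: sums_def)
  qed
  moreover have "?f (int m) + ?f (- int (Suc m)) = inverse ((z + of_nat m) ^ k) + inverse ((1 - z +
      of_nat m) ^ k)" for m
  proof -
    have "(z + of_int (- int (Suc m))) ^ k = (- (1 - z + of_nat m)) ^ k"
        by (simp add: algebra_simps)
    also have "\<dots> = (1 - z + of_nat m) ^ k" using k by (simp only: power_minus_even)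
    finally show ?thesis by simp
  qed
  ultimately have "S = (Polygamma j z + Polygamma j (1 - z)) / fact j"
    using s1 sums_unique2 by (metis (no_types, lifting) sums_cong)
  also have "Polygamma j z + Polygamma j (1 - z) = (2 * of_real pi * \<i>) ^ k * pser (\<lambda>n. of_nat n ^
      (k - 1)) (qexp z)"
    using Polygamma_reflection[OF z j(2)] k j by simp
  finally show ?thesis using S j by simp
qed

text \<open>The two \<open>Digamma\<close> series at \<open>1 - v\<close> and \<open>v\<close> pair
  \<open>v + k\<close> with \<open>1 - v + k\<close>. A telescoping series with sum
  \<open>- 1 / v\<close> shifts the index of the first by one and produces the symmetric
  pairing.\<close>

lemma cot_partial_fractions:
  assumes v: "Im v > 0"
  shows "(\<lambda>k. inverse (of_nat (Suc k) + v) - inverse (of_nat (Suc k) - v)) sums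
           (of_real pi * \<i> * (qexp v + 1) / (qexp v - 1) - 1 / v)"
proof -
  have nz: "v \<noteq> 0" "1 - v \<noteq> 0" using v by auto
  have "(\<lambda>k. (inverse (of_nat (Suc k)) - inverse (1 - v + of_nat k)) -
             (inverse (of_nat (Suc k)) - inverse (v + of_nat k))) sums (Digamma (1 - v) - Digamma
                 v)"
    using sums_diff[OF summable_sums[OF summable_Digamma[OF nz(2)]] summable_sums[OF
        summable_Digamma[OF nz(1)]]]
    by (simp add: Digamma_def)
  hence s1: "(\<lambda>k. inverse (v + of_nat k) - inverse (1 - v + of_nat k)) sums (Digamma (1 - v) -
      Digamma v)"
    by simp
  have "(\<lambda>k. inverse (v + of_nat (Suc k)) - inverse (v + of_nat k)) sums (0 - inverse (v + of_nat
      0))"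
    by (intro telescope_sums filterlim_compose[OF tendsto_inverse_0]
          tendsto_add_filterlim_at_infinity[OF tendsto_const] tendsto_of_nat)
  from sums_add[OF s1 this] show ?thesis
    by (simp add: Digamma_reflection_qexp[OF v] add_ac inverse_eq_divide diff_diff_eq2 add_diff_eq)
qed

section \<open>The quasimodularity of \<open>E\<^sub>2\<close>\<close>

text \<open>As in Serre's Course in Arithmetic, subtracting from \<open>(m z + n)\<^sup>-\<^sup>2\<close>
  the term \<open>((m z + n)\<^sup>2 - 1)\<^sup>-\<^sup>1\<close>, whose sum over \<open>n\<close> telescopes to \<open>0\<close>, makes the double series
  absolutely convergent; the sum of the correction over \<open>m\<close> first is a cotangent.\<close>

context
  fixes z :: complex
  assumes z: "Im z > 0"
begin

private definition a :: "nat \<Rightarrow> int \<Rightarrow> complex" where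
  "a m n = inverse ((of_nat m * z + of_int n) ^ 2)"

text \<open>The factor 1/2 makes \<open>g m (n - 1) - g m (n + 1)\<close> equal to the correction
  term \<open>1 / ((m z + n)^2 - 1)\<close>, so \<open>b\<close> telescopes by construction.\<close>

private definition g :: "nat \<Rightarrow> int \<Rightarrow> complex" where
  "g m n = inverse (of_nat m * z + of_int n) / 2"

private definition b :: "nat \<Rightarrow> int \<Rightarrow> complex" where
  "b m n = g m (n - 1) - g m (n + 1)"

private lemma mz_nonzero: "m > 0 \<Longrightarrow> of_nat m * z + of_int n \<noteq> 0"
  using z by (auto simp: complex_eq_iff)

text \<open>Quartic decay of the difference is what makes the double series absolutely
  convergent.\<close>

private lemma a_minus_b:
  assumes "m > 0"
  shows "a m n - b m n = - inverse ((of_nat m * z + of_int n) ^ 2 *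
           (of_nat m * z + of_int (n - 1)) * (of_nat m * z + of_int (n + 1)))"
proof -
  define w where "w = of_nat m * z + of_int n"
  have nz: "w \<noteq> 0" "w - 1 \<noteq> 0" "w + 1 \<noteq> 0"
    using mz_nonzero[OF assms, of n] mz_nonzero[OF assms, of "n - 1"] mz_nonzero[OF assms, of
        "n + 1"]
    by (auto simp: w_def algebra_simps)
  have "inverse (w - 1) - inverse (w + 1) = inverse (w - 1) * ((w + 1) - (w - 1)) * inverse (w + 1)"
    using nz by (intro division_ring_inverse_diff) auto
  hence 1: "inverse (w - 1) / 2 - inverse (w + 1) / 2 = inverse ((w - 1) * (w + 1))"
    by (simp add: inverse_mult_distrib flip: diff_divide_distrib)
  have "inverse (w ^ 2) - inverse ((w - 1) * (w + 1)) =
      inverse (w ^ 2) * ((w - 1) * (w + 1) - w ^ 2) * inverse ((w - 1) * (w + 1))"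
    using nz by (intro division_ring_inverse_diff) auto
  also have "(w - 1) * (w + 1) - w ^ 2 = - 1" by (simp add: algebra_simps power2_eq_square)
  finally have 2: "inverse (w ^ 2) - inverse ((w - 1) * (w + 1)) = - inverse (w ^ 2 * (w - 1) * (w +
      1))"
    by (simp add: inverse_mult_distrib mult.assoc)
  have "a m n - b m n = inverse (w ^ 2) - (inverse (w - 1) / 2 - inverse (w + 1) / 2)"
    by (simp add: a_def b_def g_def w_def algebra_simps)
  also have "\<dots> = - inverse (w ^ 2 * (w - 1) * (w + 1))" unfolding 1 2 ..
  finally show ?thesis by (simp add: w_def algebra_simps)
qed

private lemma summable_c: "(\<lambda>(m, n). a m n - b m n) summable_on ({1..} \<times> UNIV)"
proof -
  obtain \<epsilon> where \<epsilon>: "\<epsilon> > 0" "\<And>m n::real. cmod (of_real m * z + of_real n) \<ge> \<epsilon> * (\<bar>m\<bar> + \<bar>n\<bar>)"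
    using linear_form_bound[OF z] by metis
  have bd: "cmod (a m n - b m n) \<le> 4 / \<epsilon> ^ 4 * (1 / (\<bar>real m\<bar> + \<bar>real_of_int n\<bar>) ^ 4)"
      if m: "m \<ge> 1" for m n
  proof -
    define s where "s = real m + \<bar>real_of_int n\<bar>"
    have m': "real m \<ge> 1" using m by simp
    hence s: "s \<ge> 1" by (simp add: s_def)
    have absm: "\<bar>real m\<bar> = real m" by simp
    have 1: "cmod (of_nat m * z + of_int n) \<ge> \<epsilon> * s"
      using \<epsilon>(2)[of "real m" "of_int n"] by (simp add: s_def)
    \<comment> \<open>A shift of \<open>n\<close> by 1 at most halves \<open>s\<close>, because
      \<open>m \<ge> 1\<close>; the two shifted factors account for the constant 4.\<close>
    have 2: "cmod (of_nat m * z + of_int (n - 1)) \<ge> \<epsilon> * (s / 2)"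
    proof -
      have "\<bar>real_of_int n\<bar> \<le> \<bar>real_of_int n - 1\<bar> + 1" by linarith
      hence "s / 2 \<le> \<bar>real m\<bar> + \<bar>real_of_int (n - 1)\<bar>"
        unfolding s_def of_int_diff of_int_1 absm using m' abs_ge_zero[of "real_of_int n - 1"]
            by argo
      hence "\<epsilon> * (s / 2) \<le> \<epsilon> * (\<bar>real m\<bar> + \<bar>real_of_int (n - 1)\<bar>)" using \<epsilon>(1) by simp
      thus ?thesis using \<epsilon>(2)[of "real m" "of_int (n - 1)"] by simp
    qed
    have 3: "cmod (of_nat m * z + of_int (n + 1)) \<ge> \<epsilon> * (s / 2)"
    proof -
      have "\<bar>real_of_int n\<bar> \<le> \<bar>real_of_int n + 1\<bar> + 1" by linarith
      hence "s / 2 \<le> \<bar>real m\<bar> + \<bar>real_of_int (n + 1)\<bar>"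
        unfolding s_def of_int_add of_int_1 absm using m' abs_ge_zero[of "real_of_int n + 1"]
            by argo
      hence "\<epsilon> * (s / 2) \<le> \<epsilon> * (\<bar>real m\<bar> + \<bar>real_of_int (n + 1)\<bar>)" using \<epsilon>(1) by simp
      thus ?thesis using \<epsilon>(2)[of "real m" "of_int (n + 1)"] by simp
    qed
    have "(\<epsilon> * s) ^ 2 * (\<epsilon> * (s / 2)) * (\<epsilon> * (s / 2)) \<le> cmod (of_nat m * z + of_int n) ^ 2 *
        cmod (of_nat m * z + of_int (n - 1)) * cmod (of_nat m * z + of_int (n + 1))"
      using \<epsilon>(1) s by (intro mult_mono power_mono 1 2 3) auto
    hence "inverse (cmod (of_nat m * z + of_int n) ^ 2 *
        cmod (of_nat m * z + of_int (n - 1)) * cmod (of_nat m * z + of_int (n + 1)))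
        \<le> inverse ((\<epsilon> * s) ^ 2 * (\<epsilon> * (s / 2)) * (\<epsilon> * (s / 2)))"
      using \<epsilon>(1) s by (intro le_imp_inverse_le) auto
    also have "\<dots> = 4 / \<epsilon> ^ 4 * (1 / s ^ 4)"
      using \<epsilon>(1) s by (simp add: field_simps power2_eq_square power4_eq_xxxx)
    finally show ?thesis unfolding a_minus_b[OF m[unfolded One_nat_def Suc_le_eq]]
      by (simp add: norm_mult norm_power norm_inverse s_def)
  qed
  have "(\<lambda>(m::int, n::int). 1 / (\<bar>real_of_int m\<bar> + \<bar>real_of_int n\<bar>) ^ 4) summable_on (map_prod int
      id ` ({1..} \<times> UNIV))"
    by (rule summable_on_subset[OF lattice_summable]) auto
  hence "((\<lambda>(m::int, n::int). 1 / (\<bar>real_of_int m\<bar> + \<bar>real_of_int n\<bar>) ^ 4) \<circ> map_prod int id)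
      summable_on ({1..} \<times> UNIV)"
    by (subst (asm) summable_on_reindex) (auto simp: inj_on_def)
  from summable_on_cmult_right[OF this, of "4 / \<epsilon> ^ 4"]
  have "(\<lambda>(m, n). 4 / \<epsilon> ^ 4 * (1 / (\<bar>real m\<bar> + \<bar>real_of_int n\<bar>) ^ 4)) summable_on ({1..} \<times> UNIV)"
    by (simp add: o_def case_prod_unfold)
  hence "(\<lambda>x. cmod ((\<lambda>(m, n). a m n - b m n) x)) summable_on ({1..} \<times> UNIV)"
    by (rule summable_on_comparison_test) (use bd in auto)
  thus ?thesis by (rule abs_summable_summable)
qed

private lemma inverse_linear_tendsto_0:
  "(\<lambda>N. inverse (w + of_nat N)) \<longlonglongrightarrow> (0::complex)" "(\<lambda>N. inverse (w - of_nat N)) \<longlonglongrightarrow> (0::complex)"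
proof -
  have *: "(\<lambda>N. inverse (w + of_nat N)) \<longlonglongrightarrow> (0::complex)" for w
    by (intro filterlim_compose[OF tendsto_inverse_0] tendsto_add_filterlim_at_infinity[OF
        tendsto_const] tendsto_of_nat)
  show "(\<lambda>N. inverse (w + of_nat N)) \<longlonglongrightarrow> (0::complex)" by (rule *)
  have "inverse (w - of_nat N) = - inverse (- w + of_nat N)" for N
    by (metis inverse_minus_eq minus_diff_eq uminus_add_conv_diff)
  thus "(\<lambda>N. inverse (w - of_nat N)) \<longlonglongrightarrow> (0::complex)"
    using tendsto_minus[OF *[of "- w"]] by simp
qed

text \<open>The Lipschitz formula evaluates the row of \<open>a\<close>. The row of \<open>b\<close>
  is summable as a difference of summable rows, and its symmetric partial sums reduce to four terms
  that tend to 0.\<close>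

private lemma row_sum:
  assumes m: "m \<ge> 1"
  shows "((\<lambda>n. a m n - b m n) has_sum (2 * of_real pi * \<i>)\<^sup>2 * pser (\<lambda>n. of_nat n ^ 1) (qexp z ^ m))
      UNIV"
proof -
  let ?w = "of_nat m * z"
  have w: "Im ?w > 0" using z m by simp
  have qw: "qexp ?w = qexp z ^ m" by (simp add: qexp_def exp_of_nat_mult[symmetric] mult_ac)
  have A: "(a m has_sum (2 * of_real pi * \<i>)\<^sup>2 * pser (\<lambda>n. of_nat n ^ 1) (qexp z ^ m)) UNIV"
    using lipschitz_formula[OF w, of 2] unfolding a_def[abs_def] by (simp add: qw)
  have "(\<lambda>n. a m n - b m n) summable_on UNIV"
    using summable_on_SigmaD1[OF summable_c, of m] m by simp
  then obtain S where S: "((\<lambda>n. a m n - b m n) has_sum S) UNIV" unfolding summable_on_def by blast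
  have "(b m has_sum ((2 * of_real pi * \<i>)\<^sup>2 * pser (\<lambda>n. of_nat n ^ 1) (qexp z ^ m) - S)) UNIV"
    using has_sum_add[OF A has_sum_uminusI[OF S]] by simp
  from has_sum_int_symmetric[OF this]
  have "(\<lambda>N. g m (- int N - 1) + g m (- int N) - g m (int N) - g m (int N + 1)) \<longlonglongrightarrow>
     (2 * of_real pi * \<i>)\<^sup>2 * pser (\<lambda>n. of_nat n ^ 1) (qexp z ^ m) - S"
    unfolding b_def sum_int_telescope .
  moreover have "(\<lambda>N. g m (- int N - 1) + g m (- int N) - g m (int N) - g m (int N + 1)) \<longlonglongrightarrow> 0 / 2 + 0
      / 2 - 0 / 2 - 0 / 2"
  proof (unfold g_def, intro tendsto_intros)
    show "(\<lambda>N. inverse (of_nat m * z + of_int (- int N - 1))) \<longlonglongrightarrow> 0"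
      using inverse_linear_tendsto_0(2)[of "?w - 1"] by (simp add: algebra_simps)
    show "(\<lambda>N. inverse (of_nat m * z + of_int (- int N))) \<longlonglongrightarrow> 0"
      using inverse_linear_tendsto_0(2)[of "?w"] by simp
    show "(\<lambda>N. inverse (of_nat m * z + of_int (int N))) \<longlonglongrightarrow> 0"
      using inverse_linear_tendsto_0(1)[of "?w"] by simp
    show "(\<lambda>N. inverse (of_nat m * z + of_int (int N + 1))) \<longlonglongrightarrow> 0"
      using inverse_linear_tendsto_0(1)[of "?w + 1"] by (simp add: algebra_simps)
  qed simp_all
  ultimately have "(2 * of_real pi * \<i>)\<^sup>2 * pser (\<lambda>n. of_nat n ^ 1) (qexp z ^ m) - S = 0"
    using LIMSEQ_unique by fastforce
  thus ?thesis using S by simp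
qed

text \<open>The value with the rows summed first: the Lambert series turns it into
  \<open>(2 pi i)^2 / 24\<close> times \<open>1 - E2 z\<close>.\<close>

private definition total :: complex where
  "total = (2 * of_real pi * \<i>)\<^sup>2 * pser (sigma_coeff 1) (qexp z)"

private lemma c_has_sum: "((\<lambda>(m, n). a m n - b m n) has_sum total) ({1..} \<times> UNIV)"
proof -
  obtain S where S: "((\<lambda>(m, n). a m n - b m n) has_sum S) ({1..} \<times> UNIV)"
    using summable_c unfolding summable_on_def by blast
  have "((\<lambda>m. (2 * of_real pi * \<i>)\<^sup>2 * pser (\<lambda>n. of_nat n ^ 1) (qexp z ^ m)) has_sum S) {1..}"
    by (rule has_sum_SigmaD[OF S]) (use row_sum in simp)
  moreover have "((\<lambda>m. (2 * of_real pi * \<i>)\<^sup>2 * pser (\<lambda>n. of_nat n ^ 1) (qexp z ^ m)) has_sum total)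
      {1..}"
    unfolding total_def by (intro has_sum_cmult_right lambert_series) (use z in auto)
  ultimately show ?thesis using S has_sum_unique by blast
qed

private definition G :: "int \<Rightarrow> complex" where
  "G n = (\<Sum>\<^sub>\<infinity>m\<in>{1..}. a m n - b m n)"

text \<open>Absolute convergence permits the other order of summation without changing the total;
  the columns will be evaluated by separating \<open>a\<close> from \<open>b\<close>.\<close>

private lemma col_has_sum: "((\<lambda>m. a m n - b m n) has_sum G n) {1..}"
  and G_has_sum: "(G has_sum total) UNIV"
proof -
  have sw: "((\<lambda>(n, m). a m n - b m n) has_sum total) (UNIV \<times> {1..})"
    using has_sum_swap[THEN iffD1, OF c_has_sum] by simp
  show *: "((\<lambda>m. a m n - b m n) has_sum G n) {1..}" for n
    unfolding G_def using summable_on_SigmaD1[OF has_sum_imp_summable[OF sw], of n]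
    by (intro has_sum_infsum) simp
  show "(G has_sum total) UNIV" by (rule has_sum_SigmaD[OF sw]) (use * in simp)
qed

private definition A :: "int \<Rightarrow> complex" where
  "A n = (\<Sum>k. a (Suc k) n)"

private lemma A_sums: "(\<lambda>k. a (Suc k) n) sums A n"
proof -
  obtain \<epsilon> where \<epsilon>: "\<epsilon> > 0" "\<And>m n::real. cmod (of_real m * z + of_real n) \<ge> \<epsilon> * (\<bar>m\<bar> + \<bar>n\<bar>)"
    using linear_form_bound[OF z] by metis
  have "summable (\<lambda>k. a (Suc k) n)"
  proof (rule summable_comparison_test)
    show "summable (\<lambda>k. 1 / \<epsilon> ^ 2 * (1 / (real (Suc k))\<^sup>2))"
      using sums_summable[OF inverse_squares_sums] by (intro summable_mult) (simp add: add_ac)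
    show "\<exists>N. \<forall>k\<ge>N. cmod (a (Suc k) n) \<le> 1 / \<epsilon> ^ 2 * (1 / (real (Suc k))\<^sup>2)"
    proof (intro exI allI impI)
      fix k :: nat
      have "\<epsilon> * real (Suc k) \<le> \<epsilon> * (\<bar>real (Suc k)\<bar> + \<bar>real_of_int n\<bar>)" using \<epsilon>(1) by simp
      also have "\<dots> \<le> cmod (of_nat (Suc k) * z + of_int n)" using \<epsilon>(2)[of "real (Suc k)" "of_int n"]
          by simp
      finally have "(\<epsilon> * real (Suc k)) ^ 2 \<le> cmod (of_nat (Suc k) * z + of_int n) ^ 2"
        using \<epsilon>(1) by (intro power_mono) auto
      hence "inverse (cmod (of_nat (Suc k) * z + of_int n) ^ 2) \<le> inverse ((\<epsilon> * real (Suc k)) ^ 2)"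
        using \<epsilon>(1) by (intro le_imp_inverse_le) auto
      thus "cmod (a (Suc k) n) \<le> 1 / \<epsilon> ^ 2 * (1 / (real (Suc k))\<^sup>2)"
        by (simp only: a_def norm_inverse norm_power power_mult_distrib inverse_mult_distrib) (simp
            add: inverse_eq_divide)
    qed
  qed
  thus ?thesis unfolding A_def by (rule summable_sums)
qed

private lemma b_sums: "(\<lambda>k. b (Suc k) n) sums (A n - G n)"
  using sums_diff[OF A_sums[of n] has_sum_atLeast_1_sums[OF col_has_sum[of n]]] by simp

text \<open>Since \<open>m z + n = z (m - n w)\<close>, the columns of the lattice over
  \<open>z\<close> are rows of the lattice over \<open>w\<close>, up to the factor
  \<open>z\<close>.\<close>

private definition w :: complex where "w = - 1 / z"

private lemma Im_w: "Im w > 0"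
  using z Im_neg_inverse[of z] by (auto simp: w_def simp del: minus_complex.sel uminus_complex.sel
      intro!: divide_pos_pos)

private lemma w_mult_z [simp]: "w * z = - 1" "w * (z * u) = - u" "z \<noteq> 0" "w \<noteq> 0"
  using z by (auto simp: w_def)

private lemma A_0: "A 0 = of_real (pi\<^sup>2 / 6) / z\<^sup>2"
proof -
  have "(\<lambda>k. of_real (1 / (real (k + 1))\<^sup>2) / z\<^sup>2) sums (of_real (pi\<^sup>2 / 6) / z\<^sup>2)"
    by (intro sums_divide sums_of_real) (use inverse_squares_sums in \<open>simp add: add_ac\<close>)
  moreover have "of_real (1 / (real (k + 1))\<^sup>2) / z\<^sup>2 = a (Suc k) 0" for k
    by (simp add: a_def power_mult_distrib inverse_eq_divide)
  ultimately show ?thesis using A_sums[of 0] by (simp add: sums_unique2)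
qed

text \<open>Columns \<open>n\<close> and \<open>- n\<close> together form the full row
  \<open>n w + m\<close> over all integers \<open>m\<close> except \<open>m = 0\<close>, divided by
  \<open>z^2\<close>. The Lipschitz formula evaluates the full row, and the missing term is
  \<open>1 / n^2\<close>.\<close>

private lemma A_pair:
  assumes n: "n > 0"
  shows "A (int n) + A (- int n) = (2 * of_real pi * \<i>)\<^sup>2 * pser (\<lambda>n. of_nat n ^ 1) (qexp w ^ n) /
      z\<^sup>2 - 1 / of_nat n ^ 2"
proof -
  let ?w = "of_nat n * w"
  have w: "Im ?w > 0" using Im_w n by simp
  have qw: "qexp ?w = qexp w ^ n" by (simp add: qexp_def exp_of_nat_mult[symmetric] mult_ac)
  have nz: "z \<noteq> 0" using z by auto
  have "(\<lambda>k. inverse ((?w + of_int (int (Suc k)))\<^sup>2) + inverse ((?w + of_int (- int (Suc k)))\<^sup>2))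
      sums
     ((2 * of_real pi * \<i>)\<^sup>2 * pser (\<lambda>n. of_nat n ^ 1) (qexp w ^ n) - inverse ((?w + of_int 0)\<^sup>2))"
    using has_sum_int_sums[OF lipschitz_formula[OF w, of 2]] by (simp add: qw)
  from sums_divide[OF this, of "z\<^sup>2"]
  have "(\<lambda>k. (inverse ((?w + of_int (int (Suc k)))\<^sup>2) + inverse ((?w + of_int (- int (Suc k)))\<^sup>2)) /
      z\<^sup>2) sums
     (((2 * of_real pi * \<i>)\<^sup>2 * pser (\<lambda>n. of_nat n ^ 1) (qexp w ^ n) - inverse ((?w + of_int 0)\<^sup>2))
         / z\<^sup>2)" .
  moreover have "(inverse ((?w + of_int (int (Suc k)))\<^sup>2) + inverse ((?w + of_int (- int (Suc
      k)))\<^sup>2)) / z\<^sup>2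
       = a (Suc k) (int n) + a (Suc k) (- int n)" for k
  proof -
    have "(?w + of_int (int (Suc k))) * z = of_nat (Suc k) * z + of_int (- int n)"
      "(?w + of_int (- int (Suc k))) * z = - (of_nat (Suc k) * z + of_int (int n))"
      by (simp_all add: ring_distribs mult.assoc)
    hence "((?w + of_int (int (Suc k))) * z)\<^sup>2 = (of_nat (Suc k) * z + of_int (- int n))\<^sup>2"
      "((?w + of_int (- int (Suc k))) * z)\<^sup>2 = (of_nat (Suc k) * z + of_int (int n))\<^sup>2"
      by (simp_all only: power2_minus)
    moreover have "inverse (X\<^sup>2) / z\<^sup>2 = inverse ((X * z)\<^sup>2)" for X
      by (simp add: power_mult_distrib divide_inverse)
    ultimately show ?thesis unfolding a_def by (simp only: add_divide_distrib add.commute)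
  qed
  ultimately have "A (int n) + A (- int n) = ((2 * of_real pi * \<i>)\<^sup>2 * pser (\<lambda>n. of_nat n ^ 1) (qexp
      w ^ n) - inverse ((?w + of_int 0)\<^sup>2)) / z\<^sup>2"
    using sums_unique2[OF sums_add[OF A_sums[of "int n"] A_sums[of "- int n"]]] by simp
  also have "inverse ((?w + of_int 0)\<^sup>2) / z\<^sup>2 = 1 / of_nat n ^ 2"
    using n by (simp add: inverse_eq_divide mult.assoc flip: power_mult_distrib)
  hence "((2 * of_real pi * \<i>)\<^sup>2 * pser (\<lambda>n. of_nat n ^ 1) (qexp w ^ n) - inverse ((?w + of_int
      0)\<^sup>2)) / z\<^sup>2
     = (2 * of_real pi * \<i>)\<^sup>2 * pser (\<lambda>n. of_nat n ^ 1) (qexp w ^ n) / z\<^sup>2 - 1 / of_nat n ^ 2"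
    by (simp only: diff_divide_distrib)
  finally show ?thesis .
qed

text \<open>Column 0 gives \<open>zeta(2) / z^2\<close>, and the terms missing from the other
  columns give \<open>- zeta(2)\<close>; these become the constant terms of \<open>E2\<close> at
  \<open>w\<close> and at \<open>z\<close>.\<close>

private lemma A_limit:
  "(\<lambda>N. \<Sum>n\<in>{- int N..int N}. A n) \<longlonglongrightarrow>
     of_real (pi\<^sup>2 / 6) / z\<^sup>2 + ((2 * of_real pi * \<i>)\<^sup>2 * pser (sigma_coeff 1) (qexp w) / z\<^sup>2 -
         of_real (pi\<^sup>2 / 6))"
proof -
  have l: "(\<lambda>k. pser (\<lambda>n. of_nat n ^ 1) (qexp w ^ Suc k)) sums pser (sigma_coeff 1) (qexp w)"
    by (rule has_sum_atLeast_1_sums[OF lambert_series]) (use Im_w norm_qexp_less in auto)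
  have i: "(\<lambda>k. of_real (1 / (real (k + 1))\<^sup>2) :: complex) sums of_real (pi\<^sup>2 / 6)"
    by (intro sums_of_real) (use inverse_squares_sums in \<open>simp add: add_ac\<close>)
  have "(\<lambda>k. A (int (Suc k)) + A (- int (Suc k))) sums
     ((2 * of_real pi * \<i>)\<^sup>2 * pser (sigma_coeff 1) (qexp w) / z\<^sup>2 - of_real (pi\<^sup>2 / 6))"
    using sums_diff[OF sums_divide[OF sums_mult[OF l, of "(2 * of_real pi * \<i>)\<^sup>2"], of "z\<^sup>2"] i]
    unfolding A_pair[OF zero_less_Suc] by simp
  thus ?thesis unfolding sum_int_symmetric sums_def A_0 by (intro tendsto_add tendsto_const)
qed

text \<open>This is \<open>(pi cot (pi v) - 1 / v) / z\<close> at \<open>v = N w\<close>, the closed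
  form of a boundary term after summation over \<open>m\<close>.\<close>

private definition V :: "nat \<Rightarrow> complex" where
  "V N = (of_real pi * \<i> * (qexp (of_nat N * w) + 1) / (qexp (of_nat N * w) - 1) - 1 / (of_nat N *
      w)) / z"

private lemma V_sums:
  assumes "N > 0"
  shows "(\<lambda>k. inverse (of_nat (Suc k) * z - of_nat N) - inverse (of_nat (Suc k) * z + of_nat N))
      sums V N"
proof -
  let ?v = "of_nat N * w"
  have nz: "z \<noteq> 0" using z by auto
  have "Im ?v > 0" using Im_w assms by simp
  from sums_divide[OF cot_partial_fractions[OF this], of z]
  have "(\<lambda>k. (inverse (of_nat (Suc k) + ?v) - inverse (of_nat (Suc k) - ?v)) / z) sums V N"
    by (simp add: V_def)
  moreover have "(inverse (of_nat (Suc k) + ?v) - inverse (of_nat (Suc k) - ?v)) / z =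
      inverse (of_nat (Suc k) * z - of_nat N) - inverse (of_nat (Suc k) * z + of_nat N)" for k
  proof -
    have "(of_nat (Suc k) + ?v) * z = of_nat (Suc k) * z - of_nat N"
      "(of_nat (Suc k) - ?v) * z = of_nat (Suc k) * z + of_nat N"
      by (simp_all add: ring_distribs mult.assoc)
    thus ?thesis by (metis (no_types, lifting) diff_divide_distrib divide_inverse
        inverse_mult_distrib)
  qed
  ultimately show ?thesis by simp
qed

text \<open>As \<open>Im w > 0\<close>, \<open>qexp (N w)\<close> tends to 0 and the cotangent to
  \<open>- i\<close>.\<close>

private lemma V_limit: "V \<longlonglongrightarrow> - of_real pi * \<i> / z"
proof -
  have "filterlim (\<lambda>N. Im w * real N) at_top sequentially"
    by (rule filterlim_tendsto_pos_mult_at_top[OF tendsto_const Im_w filterlim_real_sequentially])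
  hence "filterlim (\<lambda>N. of_nat N * w) at_i_inf sequentially"
    unfolding at_i_inf_def by (simp add: filterlim_filtercomap_iff o_def mult.commute)
  hence q: "(\<lambda>N. qexp (of_nat N * w)) \<longlonglongrightarrow> 0" by (rule filterlim_compose[OF qexp_at_i_inf])
  have "(\<lambda>N. inverse (of_nat N) / w) \<longlonglongrightarrow> 0 / w"
    using z by (intro tendsto_divide tendsto_const lim_inverse_n) auto
  hence r: "(\<lambda>N. 1 / (of_nat N * w)) \<longlonglongrightarrow> 0" by (simp add: divide_inverse mult_ac)
  have "V \<longlonglongrightarrow> (of_real pi * \<i> * (0 + 1) / (0 - 1) - 0) / z"
    unfolding V_def[abs_def] using z by (intro tendsto_intros q r) auto
  thus ?thesis by simp
qed

text \<open>Summed over \<open>m\<close> first, the boundary terms of the telescoping sum are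
  cotangents that do not disappear in the limit, although every row of \<open>b\<close> sums to 0.
  This failure of interchange is the entire deviation of \<open>E2\<close> from modularity.\<close>

private lemma B_limit: "(\<lambda>N. \<Sum>n\<in>{- int N..int N}. A n - G n) \<longlonglongrightarrow> - of_real pi * \<i> / z"
proof -
  have "(\<Sum>n\<in>{- int N..int N}. A n - G n) = (V N + V (Suc N)) / 2" if N: "N > 0" for N
  proof -
    have s1: "(\<lambda>k. \<Sum>n\<in>{- int N..int N}. b (Suc k) n) sums (\<Sum>n\<in>{- int N..int N}. A n - G n)"
      by (intro sums_sum b_sums)
    have s2: "(\<Sum>n\<in>{- int N..int N}. b (Suc k) n) =
       ((inverse (of_nat (Suc k) * z - of_nat N) - inverse (of_nat (Suc k) * z + of_nat N)) +
        (inverse (of_nat (Suc k) * z - of_nat (Suc N)) - inverse (of_nat (Suc k) * z + of_nat (Suc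
            N)))) / 2" for k
    proof -
      have e: "g (Suc k) (- int N - 1) = inverse (of_nat (Suc k) * z - of_nat (Suc N)) / 2"
        "g (Suc k) (- int N) = inverse (of_nat (Suc k) * z - of_nat N) / 2"
        "g (Suc k) (int N) = inverse (of_nat (Suc k) * z + of_nat N) / 2"
        "g (Suc k) (int N + 1) = inverse (of_nat (Suc k) * z + of_nat (Suc N)) / 2"
        by (simp_all add: g_def algebra_simps)
      show ?thesis unfolding b_def sum_int_telescope e by (simp add: add_divide_distrib
          diff_divide_distrib)
    qed
    have s3: "(\<lambda>k. ((inverse (of_nat (Suc k) * z - of_nat N) - inverse (of_nat (Suc k) * z + of_nat
        N)) +
        (inverse (of_nat (Suc k) * z - of_nat (Suc N)) - inverse (of_nat (Suc k) * z + of_nat (Suc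
            N)))) / 2)
        sums ((V N + V (Suc N)) / 2)"
      using N by (intro sums_divide sums_add V_sums) auto
    show ?thesis by (rule sums_unique2[OF s1[unfolded s2] s3])
  qed
  hence ev: "eventually (\<lambda>N. (V N + V (Suc N)) / 2 = (\<Sum>n\<in>{- int N..int N}. A n - G n)) sequentially"
    by (intro eventually_sequentiallyI[of 1]) (metis One_nat_def Suc_le_eq)
  have lim: "(\<lambda>N. (V N + V (Suc N)) / 2) \<longlonglongrightarrow> (- of_real pi * \<i> / z + - of_real pi * \<i> / z) / 2"
    by (intro tendsto_intros V_limit LIMSEQ_Suc) auto
  from Lim_transform_eventually[OF lim ev] show ?thesis by (simp add: mult.commute)
qed

text \<open>The total is the limit of the symmetric sums of \<open>G\<close>, and
  \<open>G = A - (A - G)\<close> separates the two limits just computed; the rest is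
  algebra.\<close>

lemma E2_neg_inverse: "E2 (- 1 / z) = z\<^sup>2 * E2 z + 6 * z / (of_real pi * \<i>)"
proof -
  have nz: "z \<noteq> 0" using z by auto
  have "(\<lambda>N. (\<Sum>n\<in>{- int N..int N}. A n) - (\<Sum>n\<in>{- int N..int N}. A n - G n)) \<longlonglongrightarrow>
     of_real (pi\<^sup>2 / 6) / z\<^sup>2 + ((2 * of_real pi * \<i>)\<^sup>2 * pser (sigma_coeff 1) (qexp w) / z\<^sup>2 -
         of_real (pi\<^sup>2 / 6))
      - - of_real pi * \<i> / z"
    by (intro tendsto_diff A_limit B_limit)
  hence "(\<lambda>N. \<Sum>n\<in>{- int N..int N}. G n) \<longlonglongrightarrow>
     of_real (pi\<^sup>2 / 6) / z\<^sup>2 + ((2 * of_real pi * \<i>)\<^sup>2 * pser (sigma_coeff 1) (qexp w) / z\<^sup>2 -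
         of_real (pi\<^sup>2 / 6))
      - - of_real pi * \<i> / z" by (simp add: sum_subtractf)
  hence eq: "total = of_real (pi\<^sup>2 / 6) / z\<^sup>2 + ((2 * of_real pi * \<i>)\<^sup>2 * pser (sigma_coeff 1) (qexp
      w) / z\<^sup>2 - of_real (pi\<^sup>2 / 6))
      - - of_real pi * \<i> / z"
    using has_sum_int_symmetric[OF G_has_sum] LIMSEQ_unique by blast
  define s where "s = pser (sigma_coeff 1) (qexp z)"
  define t where "t = pser (sigma_coeff 1) (qexp w)"
  define p where "p = complex_of_real pi"
  have p: "p \<noteq> 0" by (simp add: p_def)
  have E: "E2 z = 1 - 24 * s" "E2 w = 1 - 24 * t"
    using infsum_sigma_coeff[OF z, of 1] infsum_sigma_coeff[OF Im_w, of 1] by (simp_all add: E2_def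
        s_def t_def)
  have "(2 * p * \<i>)\<^sup>2 * s = p\<^sup>2 / 6 / z\<^sup>2 + ((2 * p * \<i>)\<^sup>2 * t / z\<^sup>2 - p\<^sup>2 / 6) - - p * \<i> / z"
    using eq unfolding total_def s_def t_def p_def by simp
  hence "- 4 * p\<^sup>2 * s * z\<^sup>2 = (p\<^sup>2 / 6 / z\<^sup>2 + ((2 * p * \<i>)\<^sup>2 * t / z\<^sup>2 - p\<^sup>2 / 6) - - p * \<i> / z) *
      z\<^sup>2"
    by (simp add: power_mult_distrib)
  also have "\<dots> = p\<^sup>2 / 6 - 4 * p\<^sup>2 * t - p\<^sup>2 / 6 * z\<^sup>2 + p * \<i> * z"
    using nz by (simp add: field_simps power_mult_distrib power2_eq_square)
  finally have "- 4 * p\<^sup>2 * s * z\<^sup>2 = p\<^sup>2 / 6 - 4 * p\<^sup>2 * t - p\<^sup>2 / 6 * z\<^sup>2 + p * \<i> * z" .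
  from arg_cong[OF this, of "\<lambda>x. 6 * x"]
  have "p * (p * (1 - 24 * t)) = p * (p * (z\<^sup>2 * (1 - 24 * s)) - 6 * \<i> * z)"
    by (simp add: algebra_simps power2_eq_square)
  hence "p * (1 - 24 * t) = p * (z\<^sup>2 * (1 - 24 * s)) - 6 * \<i> * z"
    using p mult_left_cancel by blast
  hence "1 - 24 * t = z\<^sup>2 * (1 - 24 * s) - 6 * \<i> * z / p"
    using p by (simp add: field_simps)
  moreover have "6 * z / (p * \<i>) = - 6 * \<i> * z / p" using p by (simp add: field_simps)
  ultimately show ?thesis unfolding w_def[symmetric] E p_def by simp
qed

end

section \<open>Eisenstein series as lattice sums\<close>

definition lattice_sum :: "nat \<Rightarrow> complex \<Rightarrow> complex" where
  "lattice_sum k z = (\<Sum>\<^sub>\<infinity>(m, n)\<in>- {(0, 0)}. inverse ((of_int m * z + of_int n) ^ k))"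

lemma lattice_sum_summable:
  assumes z: "Im z > 0" and k: "k \<ge> 3"
  shows "(\<lambda>(m, n). inverse ((of_int m * z + of_int n) ^ k)) summable_on (- {(0, 0)})"
proof -
  obtain \<epsilon> where \<epsilon>: "\<epsilon> > 0" "\<And>m n::real. cmod (of_real m * z + of_real n) \<ge> \<epsilon> * (\<bar>m\<bar> + \<bar>n\<bar>)"
    using linear_form_bound[OF z] by metis
  have bd: "cmod (inverse ((of_int m * z + of_int n) ^ k)) \<le>
      1 / \<epsilon> ^ k * (1 / (\<bar>real_of_int m\<bar> + \<bar>real_of_int n\<bar>) ^ k)" if "(m, n) \<noteq> (0, 0)" for m n :: int
  proof -
    have pos: "\<bar>real_of_int m\<bar> + \<bar>real_of_int n\<bar> > 0" using that by auto
    have "cmod (of_int m * z + of_int n) \<ge> \<epsilon> * (\<bar>real_of_int m\<bar> + \<bar>real_of_int n\<bar>)"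
      using \<epsilon>(2)[of "of_int m" "of_int n"] by simp
    hence "(\<epsilon> * (\<bar>real_of_int m\<bar> + \<bar>real_of_int n\<bar>)) ^ k \<le> cmod (of_int m * z + of_int n) ^ k"
      using \<epsilon>(1) by (intro power_mono) auto
    hence "inverse (cmod (of_int m * z + of_int n) ^ k) \<le> inverse ((\<epsilon> * (\<bar>real_of_int m\<bar> +
        \<bar>real_of_int n\<bar>)) ^ k)"
      using \<epsilon>(1) pos by (intro le_imp_inverse_le) auto
    thus ?thesis
      by (simp only: norm_inverse norm_power power_mult_distrib inverse_mult_distrib) (simp add:
          inverse_eq_divide)
  qed
  have "(\<lambda>x. 1 / \<epsilon> ^ k * (case x of (m, n) \<Rightarrow> 1 / (\<bar>real_of_int m\<bar> + \<bar>real_of_int n\<bar>) ^ k))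
      summable_on (- {(0, 0)})"
    by (intro summable_on_cmult_right lattice_summable k)
  hence "(\<lambda>x. cmod ((\<lambda>(m, n). inverse ((of_int m * z + of_int n) ^ k)) x)) summable_on (- {(0, 0)})"
  proof (rule summable_on_comparison_test)
    fix x :: "int \<times> int" assume "x \<in> - {(0, 0)}"
    thus "cmod (case x of (m, n) \<Rightarrow> inverse ((of_int m * z + of_int n) ^ k)) \<le>
        1 / \<epsilon> ^ k * (case x of (m, n) \<Rightarrow> 1 / (\<bar>real_of_int m\<bar> + \<bar>real_of_int n\<bar>) ^ k)"
      using bd[of "fst x" "snd x"] by (simp only: case_prod_unfold) (simp add: prod_eq_iff)
  qed simp
  thus ?thesis by (rule abs_summable_summable)
qed

text \<open>Multiplication of row vectors \<open>(m, n)\<close> by \<open>A\<close> permutes the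
  nonzero lattice points, and the adjugate matrix inverts it.\<close>

lemma lattice_sum_moebius:
  assumes A: "A \<in> SL2Z" and z: "Im z > 0"
  shows "lattice_sum k (moebius A z) = aut_factor A z ^ k * lattice_sum k z"
proof -
  define a b c d where "a = A $ 1 $ 1" "b = A $ 1 $ 2" "c = A $ 2 $ 1" "d = A $ 2 $ 2"
  note abcd = this
  have det: "a * d - b * c = 1" using A by (simp add: SL2Z_iff abcd)
  define j where "j = aut_factor A z"
  have j: "j \<noteq> 0" using aut_factor_nonzero[OF A z] by (simp add: j_def)
  have mz: "moebius A z = (of_int a * z + of_int b) / j"
    by (simp add: moebius_def j_def abcd)
  have jj: "j = of_int c * z + of_int d" by (simp add: j_def aut_factor_def abcd)
  have bij: "bij_betw (\<lambda>(m, n). (m * a + n * c, m * b + n * d)) (- {(0, 0)}) (- {(0::int, 0::int)})"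
  proof (rule bij_betwI[of _ _ _ "\<lambda>(m, n). (m * d - n * c, n * a - m * b)"])
    have i1: "(m * a + n * c) * d - (m * b + n * d) * c = m" "(m * b + n * d) * a - (m * a + n * c)
        * b = n" for m n
    proof -
      have "(m * a + n * c) * d - (m * b + n * d) * c = m * (a * d - b * c)"
          by (simp add: algebra_simps)
      thus "(m * a + n * c) * d - (m * b + n * d) * c = m" by (simp add: det)
      have "(m * b + n * d) * a - (m * a + n * c) * b = n * (a * d - b * c)"
          by (simp add: algebra_simps)
      thus "(m * b + n * d) * a - (m * a + n * c) * b = n" by (simp add: det)
    qed
    have i2: "(m * d - n * c) * a + (n * a - m * b) * c = m" "(m * d - n * c) * b + (n * a - m * b)
        * d = n" for m n
    proof -
      have "(m * d - n * c) * a + (n * a - m * b) * c = m * (a * d - b * c)"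
          by (simp add: algebra_simps)
      thus "(m * d - n * c) * a + (n * a - m * b) * c = m" by (simp add: det)
      have "(m * d - n * c) * b + (n * a - m * b) * d = n * (a * d - b * c)"
          by (simp add: algebra_simps)
      thus "(m * d - n * c) * b + (n * a - m * b) * d = n" by (simp add: det)
    qed
    have n1: "m = 0 \<and> n = 0" if "m * a + n * c = 0" "m * b + n * d = 0" for m n
      using i1[of m n] unfolding that by simp
    have n2: "m = 0 \<and> n = 0" if "m * d - n * c = 0" "n * a - m * b = 0" for m n
      using i2[of m n] unfolding that by simp
    show "(\<lambda>(m, n). (m * a + n * c, m * b + n * d)) \<in> - {(0, 0)} \<rightarrow> - {(0, 0)}"
      using n1 by (auto simp only: Pi_iff Compl_iff singleton_iff split_paired_all prod.case
          prod.inject)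
    show "(\<lambda>(m, n). (m * d - n * c, n * a - m * b)) \<in> - {(0, 0)} \<rightarrow> - {(0, 0)}"
      using n2 by (auto simp only: Pi_iff Compl_iff singleton_iff split_paired_all prod.case
          prod.inject)
    show "(case (case x of (m, n) \<Rightarrow> (m * a + n * c, m * b + n * d)) of (m, n) \<Rightarrow> (m * d - n * c, n *
        a - m * b)) = x" for x
      using i1 by (cases x) simp
    show "(case (case x of (m, n) \<Rightarrow> (m * d - n * c, n * a - m * b)) of (m, n) \<Rightarrow> (m * a + n * c, m *
        b + n * d)) = x" for x
      using i2 by (cases x) simp
  qed
  have "aut_factor A z ^ k * lattice_sum k z =
      (\<Sum>\<^sub>\<infinity>x\<in>- {(0, 0)}. j ^ k * (case x of (m, n) \<Rightarrow> inverse ((of_int m * z + of_int n) ^ k)))"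
    unfolding lattice_sum_def j_def[symmetric] by (rule infsum_cmult_right'[symmetric])
  also have "\<dots> = (\<Sum>\<^sub>\<infinity>x\<in>- {(0, 0)}. j ^ k * (case (case x of (m, n) \<Rightarrow> (m * a + n * c, m * b + n * d))
      of (m, n) \<Rightarrow> inverse ((of_int m * z + of_int n) ^ k)))"
    by (rule infsum_reindex_bij_betw[OF bij, symmetric])
  also have "\<dots> = lattice_sum k (moebius A z)"
    unfolding lattice_sum_def
  proof (rule infsum_cong)
    fix x :: "int \<times> int"
    obtain m n where x: "x = (m, n)" by (cases x)
    have "of_int m * moebius A z + of_int n = (of_int (m * a + n * c) * z + of_int (m * b + n * d))
        / j"
      unfolding mz using j by (simp add: field_simps) (simp add: jj algebra_simps)
    thus "j ^ k * (case (case x of (m, n) \<Rightarrow> (m * a + n * c, m * b + n * d))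
      of (m, n) \<Rightarrow> inverse ((of_int m * z + of_int n) ^ k)) =
      (case x of (m, n) \<Rightarrow> inverse ((of_int m * moebius A z + of_int n) ^ k))"
      using j by (simp add: x power_divide inverse_eq_divide)
  qed
  finally show ?thesis ..
qed

text \<open>Row 0 is the constant term. For even \<open>k\<close> the rows \<open>m\<close> and
  \<open>- m\<close> agree, whence the factor 2; the Lipschitz formula evaluates each row and the
  Lambert series collects them.\<close>

lemma lattice_sum_qexp:
  assumes z: "Im z > 0" and k: "even k" "k \<ge> 4"
  shows "lattice_sum k z = (\<Sum>\<^sub>\<infinity>n\<in>- {0::int}. inverse (of_int n ^ k)) +
     2 * (2 * of_real pi * \<i>) ^ k / fact (k - 1) * pser (sigma_coeff (k - 1)) (qexp z)"
proof -
  define C where "C = (2 * of_real pi * \<i>) ^ k / fact (k - 1)"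
  define c0 where "c0 = (\<Sum>\<^sub>\<infinity>n\<in>- {0::int}. inverse (of_int n ^ k) :: complex)"
  \<comment> \<open>Row 0 alone has to omit the origin.\<close>
  define B where "B m = (if m = 0 then - {0::int} else UNIV)" for m :: int
  define r where "r m = (if m = 0 then c0 else C * pser (\<lambda>n. of_nat n ^ (k - 1)) (qexp z ^ nat
      \<bar>m\<bar>))" for m :: int
  have B: "Sigma UNIV B = - {(0, 0)}" by (auto simp: B_def split: if_splits)
  have sm: "((\<lambda>(m, n). inverse ((of_int m * z + of_int n) ^ k)) has_sum lattice_sum k z) (Sigma UNIV
      B)"
    unfolding B lattice_sum_def using lattice_sum_summable[OF z, of k] k by (intro has_sum_infsum)
        auto
  have row: "((\<lambda>n. inverse ((of_int (int m) * z + of_int n) ^ k)) has_sum r (int m)) UNIV"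
      if m: "m > 0" for m :: nat
  proof -
    have "Im (of_nat m * z) > 0" using m z by simp
    moreover have "qexp (of_nat m * z) = qexp z ^ m"
      by (simp add: qexp_def exp_of_nat_mult[symmetric] mult_ac)
    ultimately show ?thesis using lipschitz_formula[of "of_nat m * z" k] k m
      by (simp add: r_def C_def)
  qed
  have "(r has_sum lattice_sum k z) UNIV"
  proof (rule has_sum_SigmaD[OF sm])
    fix m :: int
    consider "m = 0" | m' where "m = int m'" "m' > 0" | m' where "m = - int m'" "m' > 0"
      by (cases m rule: int_cases3) auto
    thus "((\<lambda>n. case (m, n) of (m, n) \<Rightarrow> inverse ((of_int m * z + of_int n) ^ k)) has_sum r m) (B m)"
    proof cases
      case 1
      have "(\<lambda>n. inverse (of_int n ^ k) :: complex) summable_on - {0::int}"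
        using summable_on_SigmaD1[OF has_sum_imp_summable[OF sm], of 0] by (simp add: B_def)
      thus ?thesis using 1 by (simp add: B_def r_def c0_def has_sum_infsum)
    next
      case 2
      thus ?thesis using row[of m'] by (simp add: B_def)
    next
      case (3 m')
      have "bij_betw uminus (UNIV :: int set) UNIV" by (rule bij_betwI[of _ _ _ uminus]) auto
      hence "((\<lambda>n. inverse ((of_int (int m') * z + of_int (- n)) ^ k)) has_sum r (int m')) UNIV"
        using row[OF 3(2)] has_sum_reindex_bij_betw[of uminus UNIV UNIV "\<lambda>n. inverse ((of_int (int
            m') * z + of_int n) ^ k)"]
        by blast
      moreover have "(of_int (int m') * z + of_int (- n)) ^ k = (of_int m * z + of_int n) ^ k" for n
      proof -
        have "(of_int (int m') * z + of_int (- n)) ^ k = (- (of_int m * z + of_int n)) ^ k" using 3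
            by simp
        thus ?thesis using k by (simp only: power_minus_even)
      qed
      moreover have "r (int m') = r m" using 3 by (simp add: r_def)
      ultimately show ?thesis using 3 by (simp add: B_def)
    qed
  qed
  from has_sum_int_sums[OF this]
  have "(\<lambda>j. r (int (Suc j)) + r (- int (Suc j))) sums (lattice_sum k z - c0)" by (simp add: r_def)
  moreover have "r (int (Suc j)) + r (- int (Suc j)) = 2 * C * pser (\<lambda>n. of_nat n ^ (k - 1)) (qexp z
      ^ Suc j)" for j
    by (simp add: r_def nat_add_distrib)
  moreover have "(\<lambda>j. 2 * C * pser (\<lambda>n. of_nat n ^ (k - 1)) (qexp z ^ Suc j)) sums (2 * C * pser
      (sigma_coeff (k - 1)) (qexp z))"
    using has_sum_atLeast_1_sums[OF lambert_series[of "qexp z" "k - 1"]] z k by (intro sums_mult)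
        auto
  ultimately have "lattice_sum k z - c0 = 2 * C * pser (sigma_coeff (k - 1)) (qexp z)"
    by (simp add: sums_unique2)
  thus ?thesis by (simp add: c0_def C_def algebra_simps)
qed

text \<open>The lattice sum is divided by the factor in front of its q-series. Its constant term may
  stay unknown here, since \<open>eisenstein_determined\<close> recovers it from the coefficient of
  \<open>q\<close>.\<close>

lemma eisenstein_modular:
  assumes k: "even k" "k \<ge> 4"
  obtains c where "\<And>A z. A \<in> SL2Z \<Longrightarrow> Im z > 0 \<Longrightarrow>
    c + pser (sigma_coeff (k - 1)) (qexp (moebius A z)) = aut_factor A z ^ k * (c + pser
        (sigma_coeff (k - 1)) (qexp z))"
proof -
  define C where "C = 2 * (2 * of_real pi * \<i>) ^ k / fact (k - 1)"
  define c0 where "c0 = (\<Sum>\<^sub>\<infinity>n\<in>- {0::int}. inverse (of_int n ^ k) :: complex)"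
  have C: "C \<noteq> 0" by (simp add: C_def)
  have eq: "c0 / C + pser (sigma_coeff (k - 1)) (qexp z) = lattice_sum k z / C" if "Im z > 0" for z
  proof -
    have "lattice_sum k z = c0 + C * pser (sigma_coeff (k - 1)) (qexp z)"
      using lattice_sum_qexp[OF that k] by (simp only: C_def c0_def)
    thus ?thesis using C by (simp add: add_divide_distrib)
  qed
  show ?thesis
    by (rule that[of "c0 / C"]) (simp add: eq lattice_sum_moebius del: One_nat_def)
qed

section \<open>Ramanujan's identities and the discriminant\<close>

definition e2 :: "complex \<Rightarrow> complex" where "e2 q = 1 - 24 * pser (sigma_coeff 1) q"
definition e4 :: "complex \<Rightarrow> complex" where "e4 q = 1 + 240 * pser (sigma_coeff 3) q"
definition e6 :: "complex \<Rightarrow> complex" where "e6 q = 1 - 504 * pser (sigma_coeff 5) q"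

lemma E2_eq: "Im z > 0 \<Longrightarrow> E2 z = e2 (qexp z)"
  unfolding E2_def e2_def by (simp only: infsum_sigma_coeff)

lemma E4_eq: "Im z > 0 \<Longrightarrow> E4 z = e4 (qexp z)"
  unfolding E4_def e4_def by (simp only: infsum_sigma_coeff)

lemma E6_eq: "Im z > 0 \<Longrightarrow> E6 z = e6 (qexp z)"
  unfolding E6_def e6_def by (simp only: infsum_sigma_coeff)

lemma holomorphic_e: "e2 holomorphic_on ball 0 1" "e4 holomorphic_on ball 0 1"
    "e6 holomorphic_on ball 0 1"
  unfolding e2_def[abs_def] e4_def[abs_def] e6_def[abs_def]
  by (intro holomorphic_intros pser_holomorphic conv1_sigma)+

lemma e_0 [simp]: "e2 0 = 1" "e4 0 = 1" "e6 0 = 1"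
  by (simp_all add: e2_def e4_def e6_def)

lemma e_deriv_0:
  "(e2 has_field_derivative - 24) (at 0)" "(e4 has_field_derivative 240) (at 0)"
  "(e6 has_field_derivative - 504) (at 0)"
  unfolding e2_def[abs_def] e4_def[abs_def] e6_def[abs_def]
  by (rule derivative_eq_intros pser_has_field_derivative conv1_sigma refl | simp add: diffs_def)+

text \<open>The operator \<open>q d/dq\<close>, which becomes \<open>(2 pi i)^-1 d/dz\<close> after
  composition with \<open>qexp\<close>.\<close>

definition theta_disc :: "(complex \<Rightarrow> complex) \<Rightarrow> complex \<Rightarrow> complex" where
  "theta_disc g q = q * deriv g q"

lemma holomorphic_theta_disc: "g holomorphic_on ball 0 1 \<Longrightarrow> theta_disc g holomorphic_on ball 0 1"
  unfolding theta_disc_def[abs_def] by (intro holomorphic_intros) auto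

lemma theta_disc_0 [simp]: "theta_disc g 0 = 0"
  by (simp add: theta_disc_def)

text \<open>\<open>q d/dq\<close> multiplies the coefficient of \<open>q^n\<close> by
  \<open>n\<close> and so preserves that of \<open>q\<close>.\<close>

lemma theta_disc_deriv_0:
  assumes "g holomorphic_on ball 0 1" "(g has_field_derivative D) (at 0)"
  shows "(theta_disc g has_field_derivative D) (at 0)"
proof -
  have "deriv g holomorphic_on ball 0 1" using assms(1) by (intro holomorphic_deriv) auto
  hence "(deriv g has_field_derivative deriv (deriv g) 0) (at 0)"
    by (rule holomorphic_derivI) auto
  from DERIV_mult[OF DERIV_ident this] show ?thesis
    using DERIV_imp_deriv[OF assms(2)] unfolding theta_disc_def[abs_def] by simp
qed

lemma comp_qexp_derivative:
  assumes "g holomorphic_on ball 0 1" "\<And>z. Im z > 0 \<Longrightarrow> f z = g (qexp z)" "Im z > 0"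
  shows "(f has_field_derivative 2 * of_real pi * \<i> * theta_disc g (qexp z)) (at z)"
proof -
  have "(g has_field_derivative deriv g (qexp z)) (at (qexp z))"
    by (rule holomorphic_derivI[OF assms(1)]) (use assms in auto)
  from DERIV_chain2[OF this has_field_derivative_qexp[OF DERIV_ident]]
  have "((\<lambda>z. g (qexp z)) has_field_derivative 2 * of_real pi * \<i> * theta_disc g (qexp z)) (at z)"
    by (simp add: theta_disc_def mult_ac)
  moreover have "eventually (\<lambda>z. f z = g (qexp z)) (nhds z)"
    using eventually_nhds_in_open[OF open_upper_half, of z] assms(2,3) by (auto elim!:
        eventually_mono)
  ultimately show ?thesis by (subst DERIV_cong_ev[OF refl _ refl]) auto
qed

lemma mform_derivative:
  "mform k f g \<Longrightarrow> Im z > 0 \<Longrightarrow> (f has_field_derivative 2 * of_real pi * \<i> * theta_disc g (qexp z)) (at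
      z)"
  by (rule comp_qexp_derivative) (auto simp: mform_def)

lemma E2_derivative: "Im z > 0 \<Longrightarrow> (E2 has_field_derivative 2 * of_real pi * \<i> * theta_disc e2 (qexp
    z)) (at z)"
  by (rule comp_qexp_derivative[OF holomorphic_e(1) E2_eq])

lemma derivative_neg_inverse_comp:
  assumes "(f has_field_derivative D) (at (- 1 / z))" "z \<noteq> 0"
  shows "((\<lambda>w. f (- 1 / w)) has_field_derivative D / z\<^sup>2) (at z)"
proof -
  have "((\<lambda>w. - 1 / w) has_field_derivative 1 / z\<^sup>2) (at z)"
    using assms(2) by (auto intro!: derivative_eq_intros simp: power2_eq_square)
  from DERIV_chain2[OF assms(1) this] show ?thesis by simp
qed

text \<open>Differentiate \<open>f (-1/z) = z^k f z\<close>. The term with \<open>z^(k + 1)\<close>,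
  from the derivative of \<open>z^k\<close>, is the obstruction to modularity.\<close>

lemma mform_theta_neg_inverse:
  assumes f: "mform k f g" and z: "Im z > 0"
  shows "2 * of_real pi * \<i> * theta_disc g (qexp (- 1 / z)) =
           of_nat k * z ^ (k + 1) * f z + z ^ (k + 2) * (2 * of_real pi * \<i> * theta_disc g (qexp
               z))"
proof -
  have nz: "z \<noteq> 0" using z by auto
  have w: "Im (- 1 / z) > 0" using z by simp
  let ?D = "\<lambda>z. 2 * of_real pi * \<i> * theta_disc g (qexp z)"
  have "((\<lambda>w. f (- 1 / w)) has_field_derivative ?D (- 1 / z) / z\<^sup>2) (at z)"
    by (rule derivative_neg_inverse_comp[OF mform_derivative[OF f w] nz])
  moreover have "eventually (\<lambda>w. f (- 1 / w) = w ^ k * f w) (nhds z)"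
    using eventually_nhds_in_open[OF open_upper_half, of z] z mform_neg_inverse[OF f]
    by (auto elim!: eventually_mono)
  ultimately have "((\<lambda>w. w ^ k * f w) has_field_derivative ?D (- 1 / z) / z\<^sup>2) (at z)"
    by (subst (asm) DERIV_cong_ev[OF refl _ refl]) auto
  moreover have "((\<lambda>w. w ^ k * f w) has_field_derivative (of_nat k * z ^ (k - 1) * 1) * f z + ?D z *
      z ^ k) (at z)"
    using DERIV_mult[OF DERIV_power[OF DERIV_ident, where n = k] mform_derivative[OF f z]] by simp
  ultimately have "?D (- 1 / z) / z\<^sup>2 = of_nat k * z ^ (k - 1) * 1 * f z + ?D z * z ^ k"
    by (rule DERIV_unique)
  hence "?D (- 1 / z) = z\<^sup>2 * (of_nat k * z ^ (k - 1) * f z + ?D z * z ^ k)"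
    using nz by (simp add: field_simps)
  also have "\<dots> = of_nat k * z ^ (k + 1) * f z + z ^ (k + 2) * ?D z"
    by (cases k) (simp_all add: algebra_simps power2_eq_square)
  finally show ?thesis .
qed

text \<open>Twelve times the Serre derivative. The obstruction in the derivative of \<open>f\<close>
  contributes \<open>6 k z^(k + 1) f z / (pi i)\<close>, exactly what the term
  \<open>6 z / (pi i)\<close> in the law of \<open>E2\<close> takes away.\<close>

lemma mform_serre_derivative:
  assumes f: "mform k f g"
  shows "mform (k + 2) (\<lambda>z. 12 * theta_disc g (qexp z) - of_nat k * E2 z * f z)
           (\<lambda>q. 12 * theta_disc g q - of_nat k * e2 q * g q)"
  unfolding mform_def
proof (intro conjI allI impI)
  have g: "g holomorphic_on ball 0 1" using f by (simp add: mform_def)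
  show "(\<lambda>q. 12 * theta_disc g q - of_nat k * e2 q * g q) holomorphic_on ball 0 1"
    by (intro holomorphic_intros holomorphic_theta_disc holomorphic_e g)
  fix z :: complex assume z: "Im z > 0"
  show "12 * theta_disc g (qexp z) - of_nat k * E2 z * f z =
    12 * theta_disc g (qexp z) - of_nat k * e2 (qexp z) * g (qexp z)"
    using z f by (simp add: E2_eq mform_qexp)
  define c where "c = 1 / (of_real pi * \<i>)"
  have c: "c * (of_real pi * \<i>) = 1" by (simp add: c_def)
  have "theta_disc g (qexp (- 1 / z)) = c / 2 * (2 * of_real pi * \<i> * theta_disc g (qexp (- 1 /
      z)))"
    using c by (simp add: mult_ac)
  also have "\<dots> = c / 2 * (of_nat k * z ^ (k + 1) * f z + z ^ (k + 2) * (2 * of_real pi * \<i> *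
      theta_disc g (qexp z)))"
    unfolding mform_theta_neg_inverse[OF f z] ..
  also have "\<dots> = c / 2 * (of_nat k * z ^ (k + 1) * f z) + z ^ (k + 2) * (c * (of_real pi * \<i>)) *
      theta_disc g (qexp z)"
    by (simp add: algebra_simps)
  finally have t: "theta_disc g (qexp (- 1 / z)) = c / 2 * (of_nat k * z ^ (k + 1) * f z) + z ^ (k +
      2) * theta_disc g (qexp z)"
    by (simp add: c)
  have e: "E2 (- 1 / z) = z\<^sup>2 * E2 z + 6 * z * c"
    using E2_neg_inverse[OF z] by (simp add: c_def)
  show "12 * theta_disc g (qexp (- 1 / z)) - of_nat k * E2 (- 1 / z) * f (- 1 / z) =
    z ^ (k + 2) * (12 * theta_disc g (qexp z) - of_nat k * E2 z * f z)"
    unfolding t e mform_neg_inverse[OF f z] by (simp add: algebra_simps power2_eq_square)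
qed

text \<open>With \<open>c = 1 / (pi i)\<close>, both \<open>(E2 z)^2\<close> and 12 times the
  derivative of \<open>E2\<close> acquire the extra terms \<open>12 c z^3 E2 z + 36 c^2 z^2\<close>,
  which cancel; this fixes the coefficient 12.\<close>

lemma mform_E2_derivative:
  "mform 4 (\<lambda>z. (E2 z)\<^sup>2 - 12 * theta_disc e2 (qexp z)) (\<lambda>q. (e2 q)\<^sup>2 - 12 * theta_disc e2 q)"
  unfolding mform_def
proof (intro conjI allI impI)
  show "(\<lambda>q. (e2 q)\<^sup>2 - 12 * theta_disc e2 q) holomorphic_on ball 0 1"
    by (intro holomorphic_intros holomorphic_theta_disc holomorphic_e)
  fix z :: complex assume z: "Im z > 0"
  show "(E2 z)\<^sup>2 - 12 * theta_disc e2 (qexp z) = (e2 (qexp z))\<^sup>2 - 12 * theta_disc e2 (qexp z)"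
    using z by (simp add: E2_eq)
  have nz: "z \<noteq> 0" using z by auto
  have w: "Im (- 1 / z) > 0" using z by simp
  define c where "c = 1 / (of_real pi * \<i>)"
  have c: "c * (of_real pi * \<i>) = 1" by (simp add: c_def)
  let ?D = "\<lambda>z. 2 * of_real pi * \<i> * theta_disc e2 (qexp z)"
  have e: "E2 (- 1 / z) = z\<^sup>2 * E2 z + 6 * z * c" if "Im z > 0" for z
    using E2_neg_inverse[OF that] by (simp add: c_def)
  have "((\<lambda>w. E2 (- 1 / w)) has_field_derivative ?D (- 1 / z) / z\<^sup>2) (at z)"
    by (rule derivative_neg_inverse_comp[OF E2_derivative[OF w] nz])
  moreover have "eventually (\<lambda>w. E2 (- 1 / w) = w\<^sup>2 * E2 w + 6 * w * c) (nhds z)"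
    using eventually_nhds_in_open[OF open_upper_half, of z] z e
    by (auto elim!: eventually_mono)
  ultimately have "((\<lambda>w. w\<^sup>2 * E2 w + 6 * w * c) has_field_derivative ?D (- 1 / z) / z\<^sup>2) (at z)"
    by (subst (asm) DERIV_cong_ev[OF refl _ refl]) auto
  moreover have "((\<lambda>w. w\<^sup>2 * E2 w + 6 * w * c) has_field_derivative 2 * z * E2 z + ?D z * z\<^sup>2 + 6 *
      c) (at z)"
    by (auto intro!: derivative_eq_intros E2_derivative[OF z])
  ultimately have "?D (- 1 / z) / z\<^sup>2 = 2 * z * E2 z + ?D z * z\<^sup>2 + 6 * c"
    by (rule DERIV_unique)
  hence D: "?D (- 1 / z) = z\<^sup>2 * (2 * z * E2 z + ?D z * z\<^sup>2 + 6 * c)"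
    using nz by (simp add: field_simps)
  have "theta_disc e2 (qexp (- 1 / z)) = c / 2 * ?D (- 1 / z)" using c by (simp add: mult_ac)
  also have "\<dots> = z ^ 4 * (c * (of_real pi * \<i>)) * theta_disc e2 (qexp z) + c * z ^ 3 * E2 z + 3 *
      c\<^sup>2 * z\<^sup>2"
    unfolding D by (simp add: algebra_simps power2_eq_square power4_eq_xxxx power3_eq_cube)
  finally have t: "theta_disc e2 (qexp (- 1 / z)) = z ^ 4 * theta_disc e2 (qexp z) + c * z ^ 3 * E2
      z + 3 * c\<^sup>2 * z\<^sup>2"
    by (simp add: c)
  show "(E2 (- 1 / z))\<^sup>2 - 12 * theta_disc e2 (qexp (- 1 / z)) = z ^ 4 * ((E2 z)\<^sup>2 - 12 * theta_disc
      e2 (qexp z))"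
    unfolding t e[OF z] by (simp add: algebra_simps power2_eq_square power4_eq_xxxx power3_eq_cube)
qed

section \<open>The discriminant and Eisenstein series in low weight\<close>

definition log_series :: "complex \<Rightarrow> complex" where
  "log_series = pser (\<lambda>n. sigma_coeff 1 n / of_nat n)"

text \<open>As \<open>log_series\<close> equals minus the sum of \<open>log (1 - q^n)\<close>, this
  is the product \<open>q (1 - q)^24 (1 - q^2)^24 ...\<close>.\<close>

definition dl :: "complex \<Rightarrow> complex" where
  "dl q = q * exp (- 24 * log_series q)"

text \<open>This is \<open>\<eta>\<^sup>2\<^sup>4\<close>, written as the exponential of a primitive of \<open>2 \<pi> i E\<^sub>2\<close>.\<close>

definition Dl :: "complex \<Rightarrow> complex" where
  "Dl z = dl (qexp z)"

lemma conv1_log_series: "conv1 (\<lambda>n. sigma_coeff 1 n / of_nat n)"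
proof (rule conv1_poly_bound)
  fix n
  have "real (divisor_sum 1 n) \<le> real n * real n"
    using divisor_sum_le[of 1 n] by (simp flip: of_nat_mult)
  thus "cmod (sigma_coeff 1 n / of_nat n) \<le> real n ^ 1"
    by (cases "n = 0") (auto simp: sigma_coeff_def norm_divide divide_simps)
qed

lemma holomorphic_log_series: "log_series holomorphic_on ball 0 1"
  unfolding log_series_def by (rule pser_holomorphic[OF conv1_log_series])

lemma log_series_0 [simp]: "log_series 0 = 0"
  by (simp add: log_series_def)

lemma Dl_nonzero [simp]: "Dl z \<noteq> 0"
  by (simp add: Dl_def dl_def)

lemma holomorphic_dl: "dl holomorphic_on ball 0 1"
  unfolding dl_def[abs_def] by (intro holomorphic_intros holomorphic_log_series)

lemma Dl_derivative:
  assumes z: "Im z > 0"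
  shows "(Dl has_field_derivative 2 * of_real pi * \<i> * E2 z * Dl z) (at z)"
proof -
  have "(\<lambda>n. of_nat n * (sigma_coeff 1 n / of_nat n)) = sigma_coeff 1"
  proof
    show "of_nat n * (sigma_coeff 1 n / of_nat n) = sigma_coeff 1 n" for n
      by (cases "n = 0") auto
  qed
  with pser_qexp_derivative[OF conv1_log_series z]
  have 1: "((\<lambda>z. log_series (qexp z)) has_field_derivative 2 * of_real pi * \<i> * pser (sigma_coeff 1)
      (qexp z)) (at z)"
    by (simp add: log_series_def)
  have "((\<lambda>z. qexp z * exp (- 24 * log_series (qexp z))) has_field_derivative 2 * of_real pi * \<i> *
      E2 z * Dl z) (at z)"
    by (rule derivative_eq_intros 1 refl)+ (use z in \<open>simp add: E2_eq e2_def Dl_def dl_def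
        algebra_simps\<close>)
  thus ?thesis unfolding Dl_def[abs_def] dl_def .
qed

text \<open>Both sides have logarithmic derivative \<open>2 pi i E2 z + 12 / z\<close>, by the law
  of \<open>E2\<close>. Their quotient is thus constant, and at the fixed point \<open>\<i>\<close>
  it is 1 because \<open>\<i> ^ 12 = 1\<close>.\<close>

lemma Dl_neg_inverse:
  assumes z: "Im z > 0"
  shows "Dl (- 1 / z) = z ^ 12 * Dl z"
proof -
  define h where "h z = Dl (- 1 / z) / (z ^ 12 * Dl z)" for z
  have "(h has_field_derivative 0) (at z within upper_half)" if "z \<in> upper_half" for z
  proof -
    have z: "Im z > 0" "z \<noteq> 0" using that by auto
    have w: "Im (- 1 / z) > 0" using z by simp
    let ?u = "Dl (- 1 / z)" and ?v = "z ^ 12 * Dl z"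
    let ?l = "2 * of_real pi * \<i> * E2 z + 12 / z"
    have "((\<lambda>z. Dl (- 1 / z)) has_field_derivative 2 * of_real pi * \<i> * E2 (- 1 / z) * Dl (- 1 / z)
        / z\<^sup>2) (at z)"
      by (rule derivative_neg_inverse_comp[OF Dl_derivative[OF w] z(2)])
    also have "2 * of_real pi * \<i> * E2 (- 1 / z) * Dl (- 1 / z) / z\<^sup>2 = ?l * ?u"
      unfolding E2_neg_inverse[OF z(1)] using z(2) by (simp add: field_simps power2_eq_square)
    finally have u: "((\<lambda>z. Dl (- 1 / z)) has_field_derivative ?l * ?u) (at z)" .
    have "((\<lambda>z. z ^ 12 * Dl z) has_field_derivative 12 * z ^ 11 * Dl z + 2 * of_real pi * \<i> * E2 z *
        Dl z * z ^ 12) (at z)"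
      by (auto intro!: derivative_eq_intros Dl_derivative[OF z(1)])
    also have "12 * z ^ 11 * Dl z + 2 * of_real pi * \<i> * E2 z * Dl z * z ^ 12 = ?l * ?v"
    proof -
      have "z ^ 12 = z * z ^ 11" by (simp add: power_Suc[symmetric])
      thus ?thesis using z(2) by (simp add: algebra_simps)
    qed
    finally have v: "((\<lambda>z. z ^ 12 * Dl z) has_field_derivative ?l * ?v) (at z)" .
    have "(h has_field_derivative (?l * ?u * ?v - ?u * (?l * ?v)) / (?v * ?v)) (at z)"
      unfolding h_def by (rule DERIV_divide[OF u v]) (use z in simp)
    moreover have "(?l * ?u * ?v - ?u * (?l * ?v)) / (?v * ?v) = 0" by (simp add: mult_ac)
    ultimately show ?thesis by (simp add: has_field_derivative_at_within)
  qed
  then obtain c where c: "\<And>z. z \<in> upper_half \<Longrightarrow> h z = c"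
    using has_field_derivative_zero_constant[OF convex_upper_half] by metis
  have "- 1 / \<i> = \<i>" by simp
  moreover have "\<i> ^ 12 = (1::complex)"
    using power_mult[of \<i> 4 3] by simp
  ultimately have "h \<i> = 1" by (simp add: h_def)
  hence "h z = 1" using c[of \<i>] c[of z] z by simp
  thus ?thesis using z by (auto simp: h_def)
qed

lemma mform_Dl: "mform 12 Dl dl"
  unfolding mform_def using Dl_neg_inverse holomorphic_dl by (auto simp: Dl_def)

text \<open>\<open>Dl\<close> has no zeros in the half plane and a simple zero at the cusp, so the
  factor \<open>q^n\<close> of \<open>g\<close> pays for the division. The exponential inverts the
  unit part of \<open>dl^n\<close>.\<close>

lemma mform_divide_Dl_power:
  assumes f: "mform (k + 12 * n) f g" and h: "h holomorphic_on ball 0 1"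
    and g: "\<And>q. q \<in> ball 0 1 \<Longrightarrow> g q = q ^ n * h q"
  shows "mform k (\<lambda>z. f z / Dl z ^ n) (\<lambda>q. h q * exp (24 * of_nat n * log_series q))"
  unfolding mform_def
proof (intro conjI allI impI)
  show "(\<lambda>q. h q * exp (24 * of_nat n * log_series q)) holomorphic_on ball 0 1"
    by (intro holomorphic_intros h holomorphic_log_series)
  fix z :: complex assume z: "Im z > 0"
  show "f z / Dl z ^ n = h (qexp z) * exp (24 * of_nat n * log_series (qexp z))"
  proof -
    have "Dl z ^ n = qexp z ^ n * exp (of_nat n * (- 24 * log_series (qexp z)))"
      by (simp only: Dl_def dl_def power_mult_distrib exp_of_nat_mult)
    also have "exp (of_nat n * (- 24 * log_series (qexp z))) = inverse (exp (24 * of_nat n *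
        log_series (qexp z)))"
      by (simp only: exp_minus[symmetric]) (simp add: mult_ac)
    finally show ?thesis using z by (simp add: mform_qexp[OF f] g field_simps)
  qed
  show "f (- 1 / z) / Dl (- 1 / z) ^ n = z ^ k * (f z / Dl z ^ n)"
    using z unfolding mform_neg_inverse[OF f z] Dl_neg_inverse[OF z]
    by (auto simp: power_mult_distrib power_add power_mult)
qed

lemma holomorphic_divide_ident:
  assumes "g holomorphic_on ball 0 1" "g 0 = 0"
  shows "(\<lambda>q. if q = 0 then deriv g 0 else g q / q) holomorphic_on ball 0 1"
  using pole_lemma[OF assms(1), of 0] unfolding assms(2) diff_zero by simp

lemma mform_divide_Dl:
  assumes f: "mform (k + 12) f g" and g: "g 0 = 0"
  shows "mform k (\<lambda>z. f z / Dl z) (\<lambda>q. (if q = 0 then deriv g 0 else g q / q) * exp (24 * log_series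
      q))"
proof -
  have h: "(\<lambda>q. if q = 0 then deriv g 0 else g q / q) holomorphic_on ball 0 1"
    using f g by (intro holomorphic_divide_ident) (auto simp: mform_def)
  have "mform k (\<lambda>z. f z / Dl z ^ 1)
      (\<lambda>q. (if q = 0 then deriv g 0 else g q / q) * exp (24 * of_nat 1 * log_series q))"
    by (rule mform_divide_Dl_power[of k 1 f g, OF _ h]) (use f g in simp_all)
  thus ?thesis by simp
qed

text \<open>\<open>f^12 / Dl^k\<close> has weight 0, hence is constant; at the cusp it vanishes to
  order at least \<open>12 - k > 0\<close>, so the constant is 0.\<close>

lemma mform_cusp_zero:
  assumes f: "mform k f g" and k: "k < 12" and g: "g 0 = 0" and z: "Im z > 0"
  shows "f z = 0"
proof -
  define g1 where "g1 q = (if q = 0 then deriv g 0 else g q / q)" for q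
  have hol: "g1 holomorphic_on ball 0 1"
    unfolding g1_def using f g by (intro holomorphic_divide_ident) (auto simp: mform_def)
  have g_eq: "g q = q * g1 q" for q using g by (simp add: g1_def)
  define h where "h q = q ^ (12 - k) * g1 q ^ 12" for q
  have "mform 0 (\<lambda>z. f z ^ 12 / Dl z ^ k) (\<lambda>q. h q * exp (24 * of_nat k * log_series q))"
  proof (rule mform_divide_Dl_power)
    show "mform (0 + 12 * k) (\<lambda>z. f z ^ 12) (\<lambda>q. g q ^ 12)"
      using mform_power[OF f, of 12] by (simp add: mult.commute)
    show "h holomorphic_on ball 0 1" unfolding h_def[abs_def] by (intro holomorphic_intros hol)
    have "q ^ k * q ^ (12 - k) = q ^ 12" for q :: complex using k by (simp flip: power_add)
    thus "g q ^ 12 = q ^ k * h q" for q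
      by (simp add: g_eq h_def power_mult_distrib flip: mult.assoc)
  qed
  from mform_0_const'[OF this z] have "f z ^ 12 / Dl z ^ k = 0" using k by (simp add: h_def)
  thus ?thesis by simp
qed

lemma mform_unique:
  assumes f: "mform k f g" and f': "mform k f' g'" and k: "k < 12" and g: "g 0 = g' 0"
  shows "Im z > 0 \<Longrightarrow> f z = f' z" "q \<in> ball 0 1 \<Longrightarrow> g q = g' q"
proof -
  note d = mform_diff[OF f f']
  show *: "f z = f' z" if "Im z > 0" for z using mform_cusp_zero[OF d k _ that] g by simp
  show "g q = g' q" if "q \<in> ball 0 1"
    using mform_zero_cusp[OF d _ that] * by simp
qed

text \<open>The constant term of the Eisenstein series is read off from the coefficient of \<open>q\<close>, because
  the space of forms of this weight is one-dimensional; no value of the zeta function is needed.\<close>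

lemma eisenstein_determined:
  assumes F: "mform k F G" and k: "even k" "k \<ge> 4" "k < 12" and G0: "G 0 = 1"
    and G1: "(G has_field_derivative D) (at 0)" and D: "D \<noteq> 0"
  shows "\<And>z. Im z > 0 \<Longrightarrow> F z = 1 + D * pser (sigma_coeff (k - 1)) (qexp z)"
    and "\<And>A z. A \<in> SL2Z \<Longrightarrow> Im z > 0 \<Longrightarrow> F (moebius A z) = aut_factor A z ^ k * F z"
proof -
  obtain c where c: "\<And>A z. A \<in> SL2Z \<Longrightarrow> Im z > 0 \<Longrightarrow>
    c + pser (sigma_coeff (k - 1)) (qexp (moebius A z)) = aut_factor A z ^ k * (c + pser
        (sigma_coeff (k - 1)) (qexp z))"
    using eisenstein_modular[OF k(1,2)] by metis
  define L where "L z = c + pser (sigma_coeff (k - 1)) (qexp z)" for z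
  define l where "l q = c + pser (sigma_coeff (k - 1)) q" for q
  have L: "mform k L l"
    unfolding mform_def
  proof (intro conjI allI impI)
    show "l holomorphic_on ball 0 1"
      unfolding l_def[abs_def] by (intro holomorphic_intros pser_holomorphic conv1_sigma)
    fix z :: complex assume z: "Im z > 0"
    show "L z = l (qexp z)" by (simp add: L_def l_def)
    show "L (- 1 / z) = z ^ k * L z"
      using c[of "mat2 0 (-1) 1 0" z] z by (simp add: L_def SL2Z_iff moebius_def aut_factor_def)
  qed
  have l0: "l 0 = c" by (simp add: l_def)
  have cF: "mform k (\<lambda>z. c * F z) (\<lambda>q. c * G q)" by (rule mform_cmult[OF F])
  \<comment> \<open>The two forms share the constant term \<open>c\<close>, hence coincide.
    Comparing coefficients of \<open>q\<close> then gives \<open>c * D = 1\<close>, so that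
    \<open>D * L\<close> has constant term 1.\<close>
  have eq: "c * G q = l q" if "q \<in> ball 0 1" for q
    using mform_unique(2)[OF cF L k(3)] that by (simp add: G0 l0)
  have "(l has_field_derivative 1) (at 0)"
    unfolding l_def[abs_def] using DERIV_add[OF DERIV_const pser_has_field_derivative[OF
        conv1_sigma, of 0]]
    by (simp add: diffs_def)
  moreover have "eventually (\<lambda>q. c * G q = l q) (nhds 0)"
    using eventually_nhds_in_open[of "ball 0 1" "0::complex"] eq by (auto elim!: eventually_mono)
  hence "(l has_field_derivative c * D) (at 0)"
    using DERIV_cmult[OF G1, of c] by (subst (asm) DERIV_cong_ev[OF refl _ refl]) auto
  ultimately have cD: "c * D = 1" by (rule DERIV_unique[symmetric])
  have FL: "F z = D * L z" if "Im z > 0" for z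
  proof -
    have "D * L z = D * (c * F z)" using mform_unique(1)[OF cF L k(3) _ that] by (simp add: G0 l0)
    also have "\<dots> = F z" using cD by (simp add: mult_ac flip: mult.assoc)
    finally show ?thesis ..
  qed
  show "F z = 1 + D * pser (sigma_coeff (k - 1)) (qexp z)" if "Im z > 0" for z
    using FL[OF that] cD by (simp add: L_def ring_distribs mult.commute)
  show "F (moebius A z) = aut_factor A z ^ k * F z" if "A \<in> SL2Z" "Im z > 0" for A z
    using that c[OF that] by (simp add: FL L_def)
qed

text \<open>The weight 4 form built from \<open>E2\<close> has constant term 1 and
  \<open>q\<close>-coefficient \<open>2 * (-24) - 12 * (-24) = 240\<close>, which identifies it with
  \<open>E4\<close>; the full modular group acts correctly because of the lattice sum.\<close>

lemma E4_unfold: "Im z > 0 \<Longrightarrow> E4 z = (E2 z)\<^sup>2 - 12 * theta_disc e2 (qexp z)"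
  and E4_moebius: "A \<in> SL2Z \<Longrightarrow> Im z > 0 \<Longrightarrow> E4 (moebius A z) = aut_factor A z ^ 4 * E4 z"
proof -
  have "((\<lambda>q. (e2 q)\<^sup>2 - 12 * theta_disc e2 q) has_field_derivative 2 * (- 24) - 12 * (- 24)) (at
      0)"
    by (rule derivative_eq_intros e_deriv_0 theta_disc_deriv_0 holomorphic_e refl)+ simp
  hence "((\<lambda>q. (e2 q)\<^sup>2 - 12 * theta_disc e2 q) has_field_derivative 240) (at 0)" by simp
  note d = eisenstein_determined[OF mform_E2_derivative _ _ _ _ this]
  show *: "E4 z = (E2 z)\<^sup>2 - 12 * theta_disc e2 (qexp z)" if "Im z > 0" for z
    using d(1)[of z] that by (simp add: E4_eq e4_def)
  show "E4 (moebius A z) = aut_factor A z ^ 4 * E4 z" if "A \<in> SL2Z" "Im z > 0" for A z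
    using d(2)[of A z] that by (simp add: *)
qed

lemma moebius_S: "mat2 0 (-1) 1 0 \<in> SL2Z" "moebius (mat2 0 (-1) 1 0) z = - 1 / z"
    "aut_factor (mat2 0 (-1) 1 0) z = z"
  by (simp_all add: SL2Z_iff moebius_def aut_factor_def)

lemma mform_E4: "mform 4 E4 e4"
  unfolding mform_def using E4_moebius[OF moebius_S(1)] E4_eq holomorphic_e
      by (simp only: moebius_S) simp

text \<open>The Serre derivative of \<open>E4\<close>, scaled by -1/4 to have constant term 1, has
  \<open>q\<close>-coefficient -504, and this identifies it with \<open>E6\<close>.\<close>

lemma E6_unfold: "Im z > 0 \<Longrightarrow> E6 z = E2 z * E4 z - 3 * theta_disc e4 (qexp z)"
  and E6_moebius: "A \<in> SL2Z \<Longrightarrow> Im z > 0 \<Longrightarrow> E6 (moebius A z) = aut_factor A z ^ 6 * E6 z"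
proof -
  have m: "mform 6 (\<lambda>z. - (1/4) * (12 * theta_disc e4 (qexp z) - of_nat 4 * E2 z * E4 z))
     (\<lambda>q. - (1/4) * (12 * theta_disc e4 q - of_nat 4 * e2 q * e4 q))"
    using mform_cmult[OF mform_serre_derivative[OF mform_E4], of "- (1/4)"] by simp
  have "((\<lambda>q. - (1/4) * (12 * theta_disc e4 q - of_nat 4 * e2 q * e4 q)) has_field_derivative
      - (1/4) * (12 * 240 - 4 * (- 24 + 240))) (at 0)"
    by (rule derivative_eq_intros e_deriv_0 theta_disc_deriv_0 holomorphic_e refl)+ simp
  hence "((\<lambda>q. - (1/4) * (12 * theta_disc e4 q - of_nat 4 * e2 q * e4 q)) has_field_derivative -
      504) (at 0)"
    by simp
  note d = eisenstein_determined[OF m _ _ _ _ this]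
  show *: "E6 z = E2 z * E4 z - 3 * theta_disc e4 (qexp z)" if "Im z > 0" for z
  proof -
    have "E2 z * E4 z - 3 * theta_disc e4 (qexp z) =
        - (1/4) * (12 * theta_disc e4 (qexp z) - of_nat 4 * E2 z * E4
            z)" by (simp add: algebra_simps)
    also have "\<dots> = E6 z" using d(1)[of z] that by (simp add: E6_eq e6_def)
    finally show ?thesis ..
  qed
  show "E6 (moebius A z) = aut_factor A z ^ 6 * E6 z" if "A \<in> SL2Z" "Im z > 0" for A z
    using d(2)[of A z] that by (simp add: * algebra_simps)
qed

lemma mform_E6: "mform 6 E6 e6"
  unfolding mform_def using E6_moebius[OF moebius_S(1)] E6_eq holomorphic_e
      by (simp only: moebius_S) simp

lemma theta_e4: "Im z > 0 \<Longrightarrow> 3 * theta_disc e4 (qexp z) = E2 z * E4 z - E6 z"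
  by (simp add: E6_unfold)

text \<open>The scaled Serre derivative of \<open>E6\<close> and \<open>E4^2\<close> are forms of
  weight 8 with constant term 1, hence equal.\<close>

lemma theta_e6:
  assumes "Im z > 0"
  shows "2 * theta_disc e6 (qexp z) = E2 z * E6 z - (E4 z)\<^sup>2"
proof -
  have m: "mform 8 (\<lambda>z. - (1/6) * (12 * theta_disc e6 (qexp z) - of_nat 6 * E2 z * E6 z))
     (\<lambda>q. - (1/6) * (12 * theta_disc e6 q - of_nat 6 * e2 q * e6 q))"
    using mform_cmult[OF mform_serre_derivative[OF mform_E6], of "- (1/6)"] by simp
  have "mform 8 (\<lambda>z. E4 z ^ 2) (\<lambda>q. e4 q ^ 2)" using mform_power[OF mform_E4, of 2] by simp
  from mform_unique(1)[OF m this _ _ assms] show ?thesis by (simp add: algebra_simps)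
qed

text \<open>The difference vanishes at the cusp, so its quotient by \<open>Dl\<close> is a constant,
  namely the \<open>q\<close>-coefficient \<open>3 * 240 + 2 * 504\<close>.\<close>

lemma E4_cubed_minus_E6_squared:
  assumes z: "Im z > 0"
  shows "E4 z ^ 3 - E6 z ^ 2 = 1728 * Dl z"
proof -
  have m: "mform (0 + 12) (\<lambda>z. E4 z ^ 3 - E6 z ^ 2) (\<lambda>q. e4 q ^ 3 - e6 q ^ 2)"
    using mform_diff[OF mform_power[OF mform_E4, of 3]] mform_power[OF mform_E6, of 2] by simp
  have "((\<lambda>q. e4 q ^ 3 - e6 q ^ 2) has_field_derivative 3 * 240 - 2 * (- 504)) (at 0)"
    by (rule derivative_eq_intros e_deriv_0 refl)+ simp
  hence d: "deriv (\<lambda>q. e4 q ^ 3 - e6 q ^ 2) 0 = 1728"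
    by (intro DERIV_imp_deriv) simp
  have "(E4 z ^ 3 - E6 z ^ 2) / Dl z = 1728"
    using mform_0_const'[OF mform_divide_Dl[OF m] z] by (simp add: d)
  thus ?thesis by (simp add: field_simps)
qed

section \<open>Klein's invariant: modularity and derivative\<close>

lemma klein_j_eq: "Im z > 0 \<Longrightarrow> klein_j z = E4 z ^ 3 / Dl z"
  by (simp add: klein_j_def E4_cubed_minus_E6_squared)

lemma klein_j_1728: "Im z > 0 \<Longrightarrow> klein_j z - 1728 = E6 z ^ 2 / Dl z"
  using E4_cubed_minus_E6_squared[of z] by (simp add: klein_j_eq field_simps)

lemma klein_j_moebius:
  assumes "A \<in> SL2Z" "Im z > 0"
  shows "klein_j (moebius A z) = klein_j z"
proof -
  define u where "u = aut_factor A z"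
  have u: "u \<noteq> 0" using aut_factor_nonzero[OF assms] by (simp add: u_def)
  have "E4 (moebius A z) ^ 3 = u ^ 12 * E4 z ^ 3" "E6 (moebius A z) ^ 2 = u ^ 12 * E6 z ^ 2"
    using assms by (simp_all add: E4_moebius E6_moebius u_def power_mult_distrib flip: power_mult)
  hence "klein_j (moebius A z) = (u ^ 12 * (1728 * E4 z ^ 3)) / (u ^ 12 * (E4 z ^ 3 - E6 z ^ 2))"
    by (simp add: klein_j_def algebra_simps)
  thus ?thesis using u by (simp add: klein_j_def)
qed

text \<open>In the quotient rule for \<open>E4^3 / Dl\<close> the two terms with \<open>E2\<close>
  cancel and Ramanujan's formula for \<open>E4\<close> leaves \<open>E6\<close>. Thus the derivative
  vanishes only where \<open>j\<close> is 0 or 1728.\<close>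

lemma klein_j_derivative:
  assumes z: "Im z > 0"
  shows "(klein_j has_field_derivative - (2 * of_real pi * \<i>) * E4 z ^ 2 * E6 z / Dl z) (at z)"
proof -
  let ?T = "theta_disc e4 (qexp z)"
  have "((\<lambda>z. E4 z ^ 3 / Dl z) has_field_derivative
      ((3 * E4 z ^ 2 * (2 * of_real pi * \<i> * ?T)) * Dl z - E4 z ^ 3 * (2 * of_real pi * \<i> * E2 z *
          Dl z)) / (Dl z * Dl z)) (at z)"
    by (rule DERIV_divide[OF _ Dl_derivative[OF z]]) (auto intro!: derivative_eq_intros
        mform_derivative[OF mform_E4 z])
  also have "((3 * E4 z ^ 2 * (2 * of_real pi * \<i> * ?T)) * Dl z - E4 z ^ 3 * (2 * of_real pi * \<i> *
      E2 z * Dl z)) / (Dl z * Dl z)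
      = 2 * of_real pi * \<i> * E4 z ^ 2 * (3 * ?T - E2 z * E4 z) / Dl z"
    by (simp add: field_simps power2_eq_square power3_eq_cube)
  also have "3 * ?T - E2 z * E4 z = - E6 z" using theta_e4[OF z] by simp
  finally have "((\<lambda>z. E4 z ^ 3 / Dl z) has_field_derivative - (2 * of_real pi * \<i>) * E4 z ^ 2 * E6 z
      / Dl z) (at z)"
    by simp
  moreover have "eventually (\<lambda>z. klein_j z = E4 z ^ 3 / Dl z) (nhds z)"
    using eventually_nhds_in_open[OF open_upper_half, of z] z klein_j_eq by (auto elim!:
        eventually_mono)
  ultimately show ?thesis by (subst DERIV_cong_ev[OF refl _ refl]) auto
qed

section \<open>The \<open>j\<close>-invariant\<close>

lemma klein_j_holomorphic: "klein_j holomorphic_on upper_half"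
  unfolding holomorphic_on_open[OF open_upper_half] using klein_j_derivative by (auto, blast)

lemma klein_j_continuous: "Im z > 0 \<Longrightarrow> isCont klein_j z"
  using klein_j_derivative DERIV_isCont by blast

lemma klein_j_orbit: "(z, w) \<in> orbit_rel \<Longrightarrow> klein_j w = klein_j z"
  by (auto simp: orbit_rel_def klein_j_moebius)

text \<open>If \<open>w\<close> were omitted, \<open>1 / (j - w)\<close>, written as
  \<open>Dl / (E4^3 - w Dl)\<close>, would be a form of weight 0 that vanishes at the cusp, hence
  identically, although \<open>Dl\<close> has no zeros.\<close>

lemma klein_j_surj: "\<exists>z. Im z > 0 \<and> klein_j z = w"
proof (rule ccontr)
  assume "\<not> ?thesis"
  hence no: "klein_j z \<noteq> w" if "Im z > 0" for z using that by auto
  have nz: "E4 z ^ 3 - w * Dl z \<noteq> 0" if "Im z > 0" for z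
    using no[OF that] that by (simp add: klein_j_eq field_simps)
  define g where "g q = dl q / (e4 q ^ 3 - w * dl q)" for q
  have nz': "e4 q ^ 3 - w * dl q \<noteq> 0" if "q \<in> ball 0 1" for q
  proof (cases "q = 0")
    case False
    with that obtain z where "Im z > 0" "qexp z = q" using qexp_surj[of q] by auto
    thus ?thesis using nz[of z] by (auto simp: E4_eq Dl_def)
  qed (simp add: dl_def)
  have "mform 0 (\<lambda>z. Dl z / (E4 z ^ 3 - w * Dl z)) g"
    unfolding mform_def
  proof (intro conjI allI impI)
    show "g holomorphic_on ball 0 1"
      unfolding g_def[abs_def] by (intro holomorphic_intros holomorphic_dl holomorphic_e nz')
    fix z :: complex assume z: "Im z > 0"
    show "Dl z / (E4 z ^ 3 - w * Dl z) = g (qexp z)"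
      using z by (simp add: g_def E4_eq Dl_def)
    have "E4 (- 1 / z) ^ 3 - w * Dl (- 1 / z) = z ^ 12 * (E4 z ^ 3 - w * Dl z)"
      unfolding mform_neg_inverse[OF mform_E4 z] Dl_neg_inverse[OF z]
      by (simp add: algebra_simps power_mult_distrib flip: power_mult)
    moreover have "z \<noteq> 0" using z by auto
    ultimately show "Dl (- 1 / z) / (E4 (- 1 / z) ^ 3 - w * Dl (- 1 / z)) = z ^ 0 * (Dl z / (E4 z ^
        3 - w * Dl z))"
      unfolding Dl_neg_inverse[OF z] by simp
  qed
  from mform_0_const'[OF this, of \<i>] show False using nz[of \<i>] by (simp add: g_def dl_def)
qed

lemma klein_j_not_constant: "\<not> klein_j constant_on upper_half"
  using klein_j_surj[of 0] klein_j_surj[of 1] unfolding constant_on_def by (metis upper_half_iff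
      zero_neq_one)

lemma at_i_inf_D:
  assumes "eventually P at_i_inf"
  obtains Y where "Y > 0" "\<And>z. Im z > Y \<Longrightarrow> P z"
proof -
  obtain Q where Q: "eventually Q at_top" "\<And>z. Q (Im z) \<Longrightarrow> P z"
    using assms unfolding at_i_inf_def eventually_filtercomap by auto
  obtain N where N: "\<And>y. y \<ge> N \<Longrightarrow> Q y" using Q(1) unfolding eventually_at_top_linorder by auto
  show ?thesis by (rule that[of "max N 1"]) (auto intro!: Q(2) N)
qed

lemma eventually_at_i_inf_qexp:
  assumes "eventually P (nhds 0)"
  shows "eventually (\<lambda>z. P (qexp z)) at_i_inf"
  using assms qexp_at_i_inf by (rule eventually_compose_filterlim)

text \<open>As a function \<open>u\<close> of \<open>q\<close>, \<open>1 / j\<close> is holomorphic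
  near 0 with a simple zero there. The zero gives the limit of \<open>j\<close>; local injectivity
  of \<open>u\<close> makes points of large height with equal \<open>j\<close> differ by an
  integer.\<close>

lemma klein_j_at_i_inf: "filterlim klein_j at_infinity at_i_inf"
  and klein_j_inj_cusp: "\<exists>Y>0. \<forall>z w. Im z > Y \<longrightarrow> Im w > Y \<longrightarrow> klein_j z = klein_j w \<longrightarrow>
      (z, w) \<in> orbit_rel"
proof -
  define S where "S = {q \<in> ball 0 1. e4 q \<noteq> 0}"
  define u where "u q = dl q / e4 q ^ 3" for q
  have "open S"
  proof -
    have "open (ball 0 1 \<inter> e4 -` (- {0}))"
      by (intro continuous_open_preimage holomorphic_on_imp_continuous_on holomorphic_e) auto
    thus ?thesis by (simp add: S_def Int_def vimage_def)
  qed
  have S0: "0 \<in> S" by (simp add: S_def)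
  have hol: "u holomorphic_on S"
    unfolding u_def[abs_def]
    by (intro holomorphic_intros holomorphic_on_subset[OF holomorphic_dl] holomorphic_on_subset[OF
        holomorphic_e(2)])
       (auto simp: S_def)
  have ju: "klein_j z = 1 / u (qexp z)" if "Im z > 0" for z
    using that by (simp add: klein_j_eq u_def E4_eq Dl_def)
  have evS: "eventually (\<lambda>z. qexp z \<in> S \<and> Im z > 0) at_i_inf"
  proof (intro eventually_conj eventually_at_i_inf_qexp)
    show "eventually (\<lambda>q. q \<in> S) (nhds 0)" using \<open>open S\<close> S0 by (rule eventually_nhds_in_open)
    show "eventually (\<lambda>z. Im z > 0) at_i_inf"
      unfolding at_i_inf_def by (intro eventually_filtercomapI eventually_gt_at_top)
  qed
  have "continuous_on S u" by (rule holomorphic_on_imp_continuous_on[OF hol])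
  hence "isCont u 0" using \<open>open S\<close> S0 continuous_on_eq_continuous_at by blast
  hence "(u \<longlongrightarrow> u 0) (nhds 0)" by (simp add: isCont_def tendsto_nhds_iff)
  hence "((\<lambda>z. u (qexp z)) \<longlongrightarrow> 0) at_i_inf"
    using filterlim_compose[OF _ qexp_at_i_inf, of u "nhds (u 0)"] by (simp add: u_def dl_def)
  moreover have "eventually (\<lambda>z. u (qexp z) \<noteq> 0) at_i_inf"
    using evS by eventually_elim (auto simp: u_def dl_def S_def)
  ultimately have "filterlim (\<lambda>z. u (qexp z)) (at 0) at_i_inf" by (simp add: filterlim_at)
  hence "filterlim (\<lambda>z. inverse (u (qexp z))) at_infinity at_i_inf"
    by (rule filterlim_compose[OF filterlim_inverse_at_infinity])
  moreover have "eventually (\<lambda>z. inverse (u (qexp z)) = klein_j z) at_i_inf"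
    using evS by eventually_elim (auto simp: ju inverse_eq_divide)
  ultimately show "filterlim klein_j at_infinity at_i_inf"
    using filterlim_cong[OF refl refl] by fast
  have "(u has_field_derivative 1) (at 0)"
  proof -
    have ddl: "(dl has_field_derivative 1) (at 0)"
    proof -
      have "(log_series has_field_derivative deriv log_series 0) (at 0)"
        by (rule holomorphic_derivI[OF holomorphic_log_series]) auto
      show ?thesis unfolding dl_def[abs_def]
        by (rule derivative_eq_intros refl \<open>(log_series has_field_derivative deriv log_series 0) (at
            0)\<close>)+ simp
    qed
    moreover have "dl 0 = 0" by (simp add: dl_def)
    ultimately show ?thesis unfolding u_def[abs_def]
      using DERIV_divide[OF ddl DERIV_power[OF e_deriv_0(2), where n = 3]] by simp
  qed
  hence "deriv u 0 \<noteq> 0" by (simp add: DERIV_imp_deriv)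
  then obtain r where r: "r > 0" "ball 0 r \<subseteq> S" "inj_on u (ball 0 r)"
    using has_complex_derivative_locally_injective[OF hol S0 \<open>open S\<close>] by blast
  have "eventually (\<lambda>q. q \<in> ball 0 r) (nhds (0::complex))"
    using r by (intro eventually_nhds_in_open) auto
  from at_i_inf_D[OF eventually_at_i_inf_qexp[OF this]]
  obtain Y where Y: "Y > 0" "\<And>z. Im z > Y \<Longrightarrow> qexp z \<in> ball 0 r" by blast
  show "\<exists>Y>0. \<forall>z w. Im z > Y \<longrightarrow> Im w > Y \<longrightarrow> klein_j z = klein_j w \<longrightarrow> (z, w) \<in> orbit_rel"
  proof (intro exI[of _ Y] conjI allI impI Y(1))
    fix z w assume zw: "Im z > Y" "Im w > Y" "klein_j z = klein_j w"
    have pos: "Im z > 0" "Im w > 0" using zw Y(1) by auto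
    have "u (qexp z) = u (qexp w)" using zw(3) pos by (simp add: ju)
    hence "qexp w = qexp z" using r(3) Y(2)[OF zw(1)] Y(2)[OF zw(2)] by (auto dest: inj_onD)
    then obtain n :: int where "w = z + of_int n" using qexp_eq_iff by blast
    thus "(z, w) \<in> orbit_rel" using orbit_rel_shift[OF pos(1)] by simp
  qed
qed

section \<open>Closedness of the orbit relation and injectivity of \<open>j\<close> on
  orbits\<close>

lemma orbit_representative:
  assumes "Im z > 0"
  obtains w where "(z, w) \<in> orbit_rel" "\<bar>Re w\<bar> \<le> 1/2" "Im w \<ge> 1/2"
proof -
  have "\<exists>w. (z, w) \<in> orbit_rel \<and> \<bar>Re w\<bar> \<le> 1/2 \<and> Im w \<ge> 1/2"
    using assms
  proof (induction rule: upper_half_induct)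
    case (base z)
    thus ?case by (intro exI[of _ z]) (auto intro: orbit_rel_refl)
  next
    case (shift z n)
    thus ?case using orbit_rel_trans[OF orbit_rel_shift[of z n]] by blast
  next
    case (inv z)
    thus ?case using orbit_rel_trans[OF orbit_rel_neg_inverse[of z]] by blast
  qed
  thus ?thesis using that by blast
qed

lemma finite_bounded_matrices: "finite {A :: int^2^2. \<forall>i j. \<bar>A $ i $ j\<bar> \<le> B}"
proof (rule finite_subset)
  show "{A :: int^2^2. \<forall>i j. \<bar>A $ i $ j\<bar> \<le> B} \<subseteq>
      (\<lambda>(a, b, c, d). mat2 a b c d) ` ({- B..B} \<times> {- B..B} \<times> {- B..B} \<times> {- B..B})"
  proof
    fix A :: "int^2^2" assume A: "A \<in> {A. \<forall>i j. \<bar>A $ i $ j\<bar> \<le> B}"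
    show "A \<in> (\<lambda>(a, b, c, d). mat2 a b c d) ` ({- B..B} \<times> {- B..B} \<times> {- B..B} \<times> {- B..B})"
      by (rule image_eqI[of _ _ "(A $ 1 $ 1, A $ 1 $ 2, A $ 2 $ 1, A $ 2 $ 2)"])
         (use A in \<open>auto simp: mat2_collapse abs_le_iff minus_le_iff\<close>)
  qed
qed simp

text \<open>A uniform form of \<open>linear_form_bound\<close>: only a lower bound for the height
  and an upper bound for the modulus enter, so it applies along a whole sequence.\<close>

lemma row_bound:
  assumes "cmod (of_int c * z + of_int d) \<le> K" "Im z \<ge> \<eta>" "\<eta> > 0" "cmod z \<le> R"
  shows "\<bar>real_of_int c\<bar> \<le> K / \<eta>" "\<bar>real_of_int d\<bar> \<le> K + K / \<eta> * R"
proof -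
  let ?w = "of_int c * z + of_int d"
  have "\<bar>real_of_int c\<bar> * \<eta> \<le> \<bar>real_of_int c\<bar> * Im z" using assms by (intro mult_left_mono) auto
  also have "\<dots> = \<bar>Im ?w\<bar>" using assms by (simp add: abs_mult)
  also have "\<dots> \<le> K" using abs_Im_le_cmod[of ?w] assms by linarith
  finally show c: "\<bar>real_of_int c\<bar> \<le> K / \<eta>" using assms by (simp add: field_simps)
  have "\<bar>real_of_int d\<bar> = cmod (?w - of_int c * z)" by simp
  also have "\<dots> \<le> cmod ?w + cmod (of_int c * z)" by (rule norm_triangle_ineq4)
  also have "cmod (of_int c * z) \<le> K / \<eta> * R"
    unfolding norm_mult using c assms by (intro mult_mono) auto
  finally show "\<bar>real_of_int d\<bar> \<le> K + K / \<eta> * R" using assms by linarith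
qed

text \<open>Proper discontinuity: both sequences stay in a compact part of the half plane, which
  bounds the entries of the connecting matrices. One matrix therefore occurs infinitely often, and
  it connects the limits.\<close>

lemma orbit_rel_closed:
  assumes x: "x \<longlonglongrightarrow> z" "Im z > 0" and y: "y \<longlonglongrightarrow> w" "Im w > 0"
    and rel: "\<And>n. (x n, y n) \<in> orbit_rel"
  shows "(z, w) \<in> orbit_rel"
proof -
  have "\<exists>A\<in>SL2Z. y n = moebius A (x n)" for n using rel[of n] by (auto simp: orbit_rel_def)
  then obtain A where A: "\<And>n. A n \<in> SL2Z" "\<And>n. y n = moebius (A n) (x n)" by metis
  have pos: "Im (x n) > 0" "Im (y n) > 0" for n using rel[of n] by (auto simp: orbit_rel_def)
  define \<eta> where "\<eta> = min (Im z) (Im w) / 2"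
  define R where "R = max (cmod z) (cmod w) + 1"
  have \<eta>: "\<eta> > 0" "\<eta> < Im z" "\<eta> < Im w" using x y by (auto simp: \<eta>_def min_def)
  have "eventually (\<lambda>n. Im (x n) > \<eta> \<and> Im (y n) > \<eta> \<and> cmod (x n) < R \<and> cmod (y n) < R) sequentially"
  proof (intro eventually_conj)
    show "eventually (\<lambda>n. Im (x n) > \<eta>) sequentially" "eventually (\<lambda>n. Im (y n) > \<eta>) sequentially"
      using order_tendstoD(1)[OF tendsto_Im[OF x(1)]] order_tendstoD(1)[OF tendsto_Im[OF y(1)]] \<eta>
          by auto
    show "eventually (\<lambda>n. cmod (x n) < R) sequentially" "eventually (\<lambda>n. cmod (y n) < R)
        sequentially"
      using order_tendstoD(2)[OF tendsto_norm[OF x(1)], of R] order_tendstoD(2)[OF tendsto_norm[OF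
          y(1)], of R]
      by (auto simp: R_def)
  qed
  then obtain N where N: "\<And>n. n \<ge> N \<Longrightarrow> Im (x n) > \<eta> \<and> Im (y n) > \<eta> \<and> cmod (x n) < R \<and> cmod (y n) < R"
    unfolding eventually_sequentially by blast
  have R0: "R \<ge> 0" by (auto simp: R_def le_max_iff_disj intro!: add_nonneg_nonneg)
  \<comment> \<open>\<open>K\<close> bounds the automorphy factor, since \<open>Im (y n)\<close> is
    \<open>Im (x n)\<close> divided by the square of its modulus, with
    \<open>Im (y n) > \<eta>\<close> and \<open>Im (x n) \<le> R\<close>.\<close>
  define K where "K = sqrt (R / \<eta>)"
  define K' where "K' = max K (R * K)"
  define B where "B = \<lceil>max (K' / \<eta>) (K' + K' / \<eta> * R)\<rceil>"
  have bd: "A n \<in> {A. \<forall>i j. \<bar>A $ i $ j\<bar> \<le> B}" if n: "n \<ge> N" for n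
  proof -
    let ?j = "aut_factor (A n) (x n)"
    have j: "?j \<noteq> 0" by (rule aut_factor_nonzero[OF A(1) pos(1)])
    have "\<eta> < Im (x n) / (cmod ?j)\<^sup>2"
      using N[OF n] Im_moebius[OF A(1)[of n] pos(1)[of n]] A(2)[of n] by simp
    hence "\<eta> * (cmod ?j)\<^sup>2 < Im (x n)" using j by (simp add: field_simps)
    also have "Im (x n) \<le> R" using N[OF n] abs_Im_le_cmod[of "x n"] by linarith
    finally have "(cmod ?j)\<^sup>2 \<le> R / \<eta>" using \<eta> by (simp add: field_simps)
    hence jK: "cmod ?j \<le> K" unfolding K_def by (rule real_le_rsqrt)
    hence K0: "K \<ge> 0" using norm_ge_zero order_trans by blast
    \<comment> \<open>The upper row is the numerator of the Moebius map, that is \<open>y n\<close>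
      times the automorphy factor.\<close>
    have nK: "cmod (of_int (A n $ 1 $ 1) * x n + of_int (A n $ 1 $ 2)) \<le> R * K"
    proof -
      have "of_int (A n $ 1 $ 1) * x n + of_int (A n $ 1 $ 2) = y n * ?j"
        using j by (simp add: A(2) moebius_def)
      thus ?thesis using N[OF n] jK K0 R0 by (auto simp: norm_mult intro!: mult_mono)
    qed
    have "cmod (of_int (A n $ 2 $ 1) * x n + of_int (A n $ 2 $ 2)) \<le> K'"
      "cmod (of_int (A n $ 1 $ 1) * x n + of_int (A n $ 1 $ 2)) \<le> K'"
      using jK nK by (auto simp: K'_def aut_factor_def)
    note rb = row_bound[OF this(1)] row_bound[OF this(2)]
    have "\<bar>real_of_int (A n $ i $ j)\<bar> \<le> max (K' / \<eta>) (K' + K' / \<eta> * R)" for i j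
      using rb[of \<eta> R] N[OF n] \<eta> exhaust_2[of i] exhaust_2[of j] by (auto simp: le_max_iff_disj)
    hence "real_of_int \<bar>A n $ i $ j\<bar> \<le> max (K' / \<eta>) (K' + K' / \<eta> * R)" for i j by simp
    hence "\<bar>A n $ i $ j\<bar> \<le> B" for i j unfolding B_def by (meson le_of_int_ceiling of_int_le_iff
        order_trans)
    thus ?thesis by simp
  qed
  have "\<not> finite {N..}" by (rule infinite_Ici)
  moreover have "finite (A ` {N..})"
    by (rule finite_subset[OF _ finite_bounded_matrices[of B]]) (use bd in auto)
  ultimately obtain n0 where "\<not> finite {n \<in> {N..}. A n = A n0}"
    using pigeonhole_infinite[of "{N..}" A] by blast
  hence inf: "infinite {n. A n = A n0}" by (rule contrapos_nn) (rule finite_subset[rotated], auto)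
  have "w = moebius (A n0) z"
  proof (rule ccontr)
    assume ne: "w \<noteq> moebius (A n0) z"
    have "(\<lambda>n. moebius (A n0) (x n)) \<longlonglongrightarrow> moebius (A n0) z"
      unfolding moebius_def aut_factor_def
      using aut_factor_nonzero[OF A(1) x(2), of n0] by (intro tendsto_intros x) (simp add:
          aut_factor_def)
    hence "(\<lambda>n. y n - moebius (A n0) (x n)) \<longlonglongrightarrow> w - moebius (A n0) z" by (intro tendsto_diff y)
    hence "eventually (\<lambda>n. y n - moebius (A n0) (x n) \<noteq> 0) sequentially"
      by (rule tendsto_imp_eventually_ne) (use ne in simp)
    then obtain M where "\<And>n. n \<ge> M \<Longrightarrow> A n \<noteq> A n0" unfolding eventually_sequentially using A(2)
        by fastforce
    hence "{n. A n = A n0} \<subseteq> {..<M}" by (auto simp: not_le[symmetric])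
    thus False using inf finite_subset by blast
  qed
  thus ?thesis using orbit_relI[OF x(2) A(1)] by simp
qed

lemma klein_j_deriv_nonzero:
  assumes "Im z > 0" "klein_j z \<noteq> 0" "klein_j z \<noteq> 1728"
  shows "deriv klein_j z \<noteq> 0"
proof -
  have "E4 z \<noteq> 0" using assms by (auto simp: klein_j_eq)
  moreover have "E6 z \<noteq> 0" using assms klein_j_1728[of z] by auto
  ultimately show ?thesis using DERIV_imp_deriv[OF klein_j_derivative[OF assms(1)]] by simp
qed

definition bad_values :: "complex set" where
  "bad_values = {w. \<exists>z0 z1. Im z0 > 0 \<and> Im z1 > 0 \<and> klein_j z0 = w \<and> klein_j z1 = w \<and>
      (z0, z1) \<notin> orbit_rel}"

text \<open>By the open mapping theorem all values near \<open>w\<close> are attained both near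
  \<open>z0\<close> and near \<open>z1\<close>. Were some of them good in arbitrarily small
  neighbourhoods, equivalent pairs would converge to \<open>(z0, z1)\<close> and
  \<open>orbit_rel_closed\<close> would give a contradiction.\<close>

lemma open_bad_values: "open bad_values"
proof (subst open_subopen, intro ballI)
  fix w assume "w \<in> bad_values"
  then obtain z0 z1 where z: "Im z0 > 0" "Im z1 > 0" "klein_j z0 = w" "klein_j z1 = w"
      "(z0, z1) \<notin> orbit_rel"
    unfolding bad_values_def by blast
  define U where "U z n = ball z (1 / real (Suc n)) \<inter> upper_half" for z :: complex and n :: nat
  define V where "V n = klein_j ` U z0 n \<inter> klein_j ` U z1 n" for n
  have "open (klein_j ` U z n)" for z n
    by (rule open_mapping_thm[OF klein_j_holomorphic open_upper_half])
       (auto simp: U_def klein_j_not_constant intro!: open_Int convex_connected)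
  hence op: "open (V n)" for n by (simp add: V_def open_Int)
  have wV: "w \<in> V n" for n
    using z by (auto simp: V_def U_def intro: rev_image_eqI[of z0] rev_image_eqI[of z1])
  have "\<exists>n. V n \<subseteq> bad_values"
  proof (rule ccontr)
    assume "\<not> ?thesis"
    hence "\<exists>v. v \<in> V n \<and> v \<notin> bad_values" for n by blast
    then obtain v where v: "\<And>n. v n \<in> V n" "\<And>n. v n \<notin> bad_values" by metis
    have "\<exists>x y. x \<in> U z0 n \<and> y \<in> U z1 n \<and> (x, y) \<in> orbit_rel" for n
      using v[of n] unfolding V_def U_def bad_values_def by fastforce
    then obtain x y where xy: "\<And>n. x n \<in> U z0 n" "\<And>n. y n \<in> U z1 n" "\<And>n. (x n, y n) \<in> orbit_rel"
        by metis
    have lim: "f \<longlonglongrightarrow> l" if "\<And>n. f n \<in> U l n" for f and l :: complex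
    proof (rule metric_LIMSEQ_I)
      fix e :: real assume "e > 0"
      then obtain N where N: "1 / real (Suc N) < e" using nat_approx_posE by blast
      show "\<exists>no. \<forall>n\<ge>no. dist (f n) l < e"
      proof (intro exI allI impI)
        fix n assume n: "n \<ge> N"
        have "dist (f n) l < 1 / real (Suc n)" using that[of n] by (simp add: U_def dist_commute)
        also have "\<dots> \<le> 1 / real (Suc N)" using n by (simp add: field_simps)
        finally show "dist (f n) l < e" using N by simp
      qed
    qed
    have "(z0, z1) \<in> orbit_rel"
      by (rule orbit_rel_closed[OF lim[OF xy(1)] z(1) lim[OF xy(2)] z(2) xy(3)])
    thus False using z by simp
  qed
  thus "\<exists>T. open T \<and> w \<in> T \<and> T \<subseteq> bad_values" using op wV by blast
qed

text \<open>Boundedness of the values keeps the reduced preimages in a compact box, so they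
  subconverge to points \<open>z0\<close>, \<open>z1\<close> over \<open>l\<close>. If these were
  equivalent, a matrix would move the second sequence to \<open>z0\<close>, where the derivative of
  \<open>j\<close> is nonzero, and local injectivity would make inequivalent points
  equivalent.\<close>

lemma bad_values_limit:
  assumes w: "\<And>n. w n \<in> bad_values" "w \<longlonglongrightarrow> l" and l: "l \<noteq> 0" "l \<noteq> 1728"
  shows "l \<in> bad_values"
proof -
  have "\<exists>x y. Im x \<ge> 1/2 \<and> \<bar>Re x\<bar> \<le> 1/2 \<and> Im y \<ge> 1/2 \<and> \<bar>Re y\<bar> \<le> 1/2 \<and>
      klein_j x = w n \<and> klein_j y = w n \<and> (x, y) \<notin> orbit_rel" for n
  proof -
    obtain x y where xy: "Im x > 0" "Im y > 0" "klein_j x = w n" "klein_j y = w n"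
        "(x, y) \<notin> orbit_rel"
      using w(1)[of n] unfolding bad_values_def by blast
    obtain x' where x': "(x, x') \<in> orbit_rel" "\<bar>Re x'\<bar> \<le> 1/2" "Im x' \<ge> 1/2"
      using orbit_representative[OF xy(1)] by blast
    obtain y' where y': "(y, y') \<in> orbit_rel" "\<bar>Re y'\<bar> \<le> 1/2" "Im y' \<ge> 1/2"
      using orbit_representative[OF xy(2)] by blast
    have "(x', y') \<notin> orbit_rel"
      using xy(5) x'(1) y'(1) orbit_rel_sym orbit_rel_trans by blast
    moreover have "klein_j x' = w n" "klein_j y' = w n"
      using klein_j_orbit[OF x'(1)] klein_j_orbit[OF y'(1)] xy by simp_all
    ultimately show ?thesis using x'(2,3) y'(2,3) by blast
  qed
  then obtain x y where xy: "\<And>n. Im (x n) \<ge> 1/2" "\<And>n. \<bar>Re (x n)\<bar> \<le> 1/2" "\<And>n. Im (y n) \<ge> 1/2"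
      "\<And>n. \<bar>Re (y n)\<bar> \<le> 1/2"
      "\<And>n. klein_j (x n) = w n" "\<And>n. klein_j (y n) = w n" "\<And>n. (x n, y n) \<notin> orbit_rel"
    by metis
  have "Bseq w" by (rule convergent_imp_Bseq[OF convergentI[OF w(2)]])
  then obtain M where M: "\<And>n. cmod (w n) \<le> M" unfolding Bseq_def by blast
  have "eventually (\<lambda>z. cmod (klein_j z) > M) at_i_inf"
    using klein_j_at_i_inf unfolding filterlim_at_infinity_conv_norm_at_top filterlim_at_top_dense
        by blast
  from at_i_inf_D[OF this] obtain Y where Y: "\<And>z. Im z > Y \<Longrightarrow> cmod (klein_j z) > M" by blast
  define K where "K = cbox (Complex (-1/2) (1/2)) (Complex (1/2) Y)"
  have K: "x n \<in> K" "y n \<in> K" for n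
  proof -
    have "Im (x n) \<le> Y" "Im (y n) \<le> Y" using Y[of "x n"] Y[of "y n"] M[of n] xy(5,6)[of n] by force+
    thus "x n \<in> K" "y n \<in> K" using xy[of n] by (auto simp: K_def in_cbox_complex_iff)
  qed
  have "seq_compact (K \<times> K)" unfolding K_def by (intro compact_imp_seq_compact compact_Times
      compact_cbox)
  then obtain p r where pr: "p \<in> K \<times> K" "strict_mono r" "((\<lambda>n. (x n, y n)) \<circ> r) \<longlonglongrightarrow> p"
    using seq_compactE[of "K \<times> K" "\<lambda>n. (x n, y n)"] K by auto
  obtain z0 z1 where p: "p = (z0, z1)" by (cases p)
  have lim: "(\<lambda>n. x (r n)) \<longlonglongrightarrow> z0" "(\<lambda>n. y (r n)) \<longlonglongrightarrow> z1"
    using tendsto_fst[OF pr(3)] tendsto_snd[OF pr(3)] by (simp_all add: p o_def)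
  have pos: "Im z0 > 0" "Im z1 > 0" using pr(1) by (auto simp: p K_def in_cbox_complex_iff)
  have wr: "(\<lambda>n. w (r n)) \<longlonglongrightarrow> l" using LIMSEQ_subseq_LIMSEQ[OF w(2) pr(2)] by (simp add: o_def)
  have jl: "klein_j z0 = l" "klein_j z1 = l"
    using isCont_tendsto_compose[OF klein_j_continuous[OF pos(1)] lim(1)]
      isCont_tendsto_compose[OF klein_j_continuous[OF pos(2)] lim(2)] wr LIMSEQ_unique
    by (auto simp: xy)
  show ?thesis
  proof (cases "(z0, z1) \<in> orbit_rel")
    case False
    thus ?thesis using pos jl by (auto simp: bad_values_def)
  next
    case True
    hence "(z1, z0) \<in> orbit_rel" by (rule orbit_rel_sym)
    then obtain A where A: "A \<in> SL2Z" "z0 = moebius A z1" by (auto simp: orbit_rel_def)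
    have Y: "(\<lambda>n. moebius A (y (r n))) \<longlonglongrightarrow> z0"
      unfolding A(2) moebius_def aut_factor_def
      using aut_factor_nonzero[OF A(1) pos(2)] by (intro tendsto_intros lim) (simp add:
          aut_factor_def)
    have "deriv klein_j z0 \<noteq> 0" using klein_j_deriv_nonzero[OF pos(1)] jl l by simp
    then obtain \<rho> where \<rho>: "\<rho> > 0" "ball z0 \<rho> \<subseteq> upper_half" "inj_on klein_j (ball z0 \<rho>)"
      using has_complex_derivative_locally_injective[OF klein_j_holomorphic _ open_upper_half] pos
          by auto
    have "eventually (\<lambda>n. x (r n) \<in> ball z0 \<rho>) sequentially" "eventually (\<lambda>n. moebius A (y (r n)) \<in>
        ball z0 \<rho>) sequentially"
      using topological_tendstoD[OF lim(1), of "ball z0 \<rho>"] topological_tendstoD[OF Y, of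
          "ball z0 \<rho>"] \<rho>(1) by auto
    hence "eventually (\<lambda>n. x (r n) \<in> ball z0 \<rho> \<and> moebius A (y (r n)) \<in> ball z0 \<rho>) sequentially"
      by (rule eventually_conj)
    then obtain n where n: "x (r n) \<in> ball z0 \<rho>" "moebius A (y (r n)) \<in> ball z0 \<rho>"
      unfolding eventually_sequentially by blast
    have "Im (y (r n)) > 0" using xy(3)[of "r n"] by simp
    hence rel: "(y (r n), moebius A (y (r n))) \<in> orbit_rel" by (intro orbit_relI A)
    have "klein_j (moebius A (y (r n))) = klein_j (x (r n))"
      using klein_j_orbit[OF rel] xy by simp
    hence "x (r n) = moebius A (y (r n))" using inj_onD[OF \<rho>(3)] n by metis
    hence "(x (r n), y (r n)) \<in> orbit_rel" using rel orbit_rel_sym by metis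
    thus ?thesis using xy(7) by blast
  qed
qed

text \<open>A value larger than \<open>j\<close> on the box has all its reduced preimages above
  height \<open>Y\<close>, and there \<open>j\<close> determines the orbit.\<close>

lemma bounded_bad_values: "bounded bad_values"
proof -
  obtain Y where Y: "Y > 0" "\<And>z w. Im z > Y \<Longrightarrow> Im w > Y \<Longrightarrow> klein_j z = klein_j w \<Longrightarrow> (z, w) \<in> orbit_rel"
    using klein_j_inj_cusp by blast
  define K where "K = cbox (Complex (-1/2) (1/2)) (Complex (1/2) Y)"
  have "K \<subseteq> upper_half" by (auto simp: K_def in_cbox_complex_iff)
  hence "continuous_on K klein_j"
    by (rule continuous_on_subset[OF holomorphic_on_imp_continuous_on[OF klein_j_holomorphic]])
  hence "compact (klein_j ` K)" unfolding K_def by (intro compact_continuous_image compact_cbox)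
  then obtain M where M: "\<And>z. z \<in> K \<Longrightarrow> cmod (klein_j z) \<le> M"
    using compact_imp_bounded[of "klein_j ` K"] unfolding bounded_iff by auto
  have "cmod w \<le> M" if wb: "w \<in> bad_values" for w
  proof (rule ccontr)
    assume w: "\<not> cmod w \<le> M"
    obtain x y where xy: "Im x > 0" "Im y > 0" "klein_j x = w" "klein_j y = w" "(x, y) \<notin> orbit_rel"
      using wb unfolding bad_values_def by blast
    obtain x' where x': "(x, x') \<in> orbit_rel" "\<bar>Re x'\<bar> \<le> 1/2" "Im x' \<ge> 1/2"
      using orbit_representative[OF xy(1)] by blast
    obtain y' where y': "(y, y') \<in> orbit_rel" "\<bar>Re y'\<bar> \<le> 1/2" "Im y' \<ge> 1/2"
      using orbit_representative[OF xy(2)] by blast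
    have j: "klein_j x' = w" "klein_j y' = w"
      using klein_j_orbit[OF x'(1)] klein_j_orbit[OF y'(1)] xy by auto
    have "x' \<notin> K" "y' \<notin> K" using M[of x'] M[of y'] j w by auto
    hence "Im x' > Y" "Im y' > Y" using x' y' by (auto simp: K_def in_cbox_complex_iff abs_le_iff)
    hence "(x', y') \<in> orbit_rel" using Y(2) j by simp
    hence "(x, y) \<in> orbit_rel" using x'(1) y'(1) orbit_rel_sym orbit_rel_trans by blast
    thus False using xy by simp
  qed
  thus ?thesis unfolding bounded_iff by blast
qed

text \<open>The set of values taken on two different orbits is open; off \<open>{0, 1728}\<close>, where \<open>j\<close> is locally
  injective, it is also closed. It is bounded, so it is empty by connectedness.\<close>

lemma bad_values_empty: "bad_values = {}"
proof -
  define S where "S = - {0, 1728 :: complex}"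
  have con: "connected S"
    unfolding S_def by (intro path_connected_imp_connected path_connected_complement_countable) auto
  have "openin (top_of_set S) (bad_values \<inter> S)"
    using openin_open_Int[OF open_bad_values, of S] by (simp only: Int_commute)
  moreover have "closedin (top_of_set S) (bad_values \<inter> S)"
  proof -
    have "closure (bad_values \<inter> S) \<inter> S \<subseteq> bad_values \<inter> S"
    proof
      fix l assume l: "l \<in> closure (bad_values \<inter> S) \<inter> S"
      then obtain w where "\<And>n. w n \<in> bad_values \<inter> S" "w \<longlonglongrightarrow> l"
        using closure_sequential[of l "bad_values \<inter> S"] by auto
      thus "l \<in> bad_values \<inter> S" using bad_values_limit[of w l] l by (auto simp: S_def)
    qed
    hence "bad_values \<inter> S = S \<inter> closure (bad_values \<inter> S)" using closure_subset by blast
    thus ?thesis by (metis closed_closure closedin_closed_Int)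
  qed
  ultimately have "bad_values \<inter> S = {} \<or> bad_values \<inter> S = S"
    using con unfolding connected_clopen by blast
  moreover have "bad_values \<inter> S \<noteq> S"
  proof
    assume "bad_values \<inter> S = S"
    hence "bounded S" using bounded_bad_values by (metis bounded_subset inf_le1)
    moreover have "bounded {0, 1728 :: complex}" by simp
    ultimately have "bounded (S \<union> {0, 1728})" by (simp only: bounded_Un)
    also have "S \<union> {0, 1728} = (UNIV :: complex set)" by (auto simp: S_def)
    finally show False using not_bounded_UNIV by blast
  qed
  \<comment> \<open>A finite open subset of the plane is empty, which settles the two exceptional
    values.\<close>
  ultimately have "bad_values \<subseteq> {0, 1728}" by (auto simp: S_def)
  hence "finite bad_values" by (rule finite_subset) simp
  thus ?thesis using open_bad_values finite_imp_not_open by blast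
qed

lemma klein_j_inj_orbit:
  assumes "Im z > 0" "Im w > 0" "klein_j z = klein_j w"
  shows "(z, w) \<in> orbit_rel"
  using assms bad_values_empty by (auto simp: bad_values_def)

section \<open>Orders of stabilisers\<close>

lemma card_stab_orbit:
  assumes "(z, w) \<in> orbit_rel"
  shows "card (stab w) = card (stab z)"
proof -
  obtain A where A: "A \<in> SL2Z" "w = moebius A z" "Im z > 0"
    using assms by (auto simp: orbit_rel_def)
  let ?B = "sl2_inv A"
  have B: "?B \<in> SL2Z" using A by (simp add: SL2Z_inv)
  have w: "Im w > 0" "moebius ?B w = z" using A by (simp_all add: moebius_inv_cancel)
  have "bij_betw (\<lambda>h. A ** (h ** ?B)) (stab z) (stab w)"
  proof (rule bij_betwI[of _ _ _ "\<lambda>h. ?B ** (h ** A)"])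
    show "(\<lambda>h. A ** (h ** ?B)) \<in> stab z \<rightarrow> stab w"
      using A B w by (auto simp: stab_def SL2Z_mult moebius_mult)
    show "(\<lambda>h. ?B ** (h ** A)) \<in> stab w \<rightarrow> stab z"
      using A B w by (auto simp: stab_def SL2Z_mult moebius_mult)
    fix h
    have "?B ** ((A ** (h ** ?B)) ** A) = (?B ** A) ** h ** (?B ** A)"
      by (simp only: matrix_mul_assoc)
    thus "?B ** ((A ** (h ** ?B)) ** A) = h" using A by (simp add: sl2_inv_mult)
    have "A ** ((?B ** (h ** A)) ** ?B) = (A ** ?B) ** h ** (A ** ?B)"
      by (simp only: matrix_mul_assoc)
    thus "A ** ((?B ** (h ** A)) ** ?B) = h" using A by (simp add: mult_sl2_inv)
  qed
  thus ?thesis by (simp add: bij_betw_same_card)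
qed

lemma moebius_fixed_iff:
  assumes "A \<in> SL2Z" "Im z > 0"
  shows "moebius A z = z \<longleftrightarrow> of_int (A $ 1 $ 1) * z + of_int (A $ 1 $ 2) = z * aut_factor A z"
  using aut_factor_nonzero[OF assms] by (auto simp: moebius_def field_simps)

text \<open>If a matrix fixes \<open>z\<close>, modularity of \<open>E4\<close> and
  \<open>E6\<close> forces its automorphy factor to have fourth and sixth power 1. The factor is
  then 1 or -1, and so is the matrix.\<close>

lemma card_stab_generic:
  assumes z: "Im z > 0" "E4 z \<noteq> 0" "E6 z \<noteq> 0"
  shows "card (stab z) = 2"
proof -
  have "stab z = {mat2 1 0 0 1, mat2 (-1) 0 0 (-1)}"
  proof (intro equalityI subsetI)
    fix A assume "A \<in> stab z"
    hence A: "A \<in> SL2Z" "moebius A z = z" by (auto simp: stab_def)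
    let ?u = "aut_factor A z"
    have u4: "?u ^ 4 = 1" and u6: "?u ^ 6 = 1"
      using E4_moebius[OF A(1) z(1)] E6_moebius[OF A(1) z(1)] A(2) z by auto
    have "?u ^ 6 = ?u ^ 4 * ?u\<^sup>2" by (simp flip: power_add)
    hence "?u\<^sup>2 = 1" using u4 u6 by simp
    hence u: "?u = 1 \<or> ?u = - 1" by (simp add: power2_eq_1_iff)
    hence "Im ?u = 0" by auto
    hence c: "A $ 2 $ 1 = 0" using z by (simp add: aut_factor_def)
    have "of_int (A $ 2 $ 2) = ?u" using c by (simp add: aut_factor_def)
    hence "of_int (A $ 2 $ 2) = (of_int 1 :: complex) \<or> of_int (A $ 2 $ 2) = (of_int (- 1) ::
        complex)"
      using u by simp
    hence d: "A $ 2 $ 2 = 1 \<or> A $ 2 $ 2 = - 1" by (simp only: of_int_eq_iff)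
    hence a: "A $ 1 $ 1 = A $ 2 $ 2" using A(1) c by (auto simp: SL2Z_iff)
    have "A $ 1 $ 2 = 0"
      using A(2) moebius_fixed_iff[OF A(1) z(1)] c a by (simp add: aut_factor_def mult.commute)
    thus "A \<in> {mat2 1 0 0 1, mat2 (-1) 0 0 (-1)}" using a c d by (auto simp: mat2_eq_iff)
  next
    fix A assume "A \<in> {mat2 1 0 0 1, mat2 (-1) 0 0 (-1)}"
    thus "A \<in> stab z" by (auto simp: stab_def SL2Z_iff moebius_def aut_factor_def)
  qed
  moreover have "mat2 1 0 0 1 \<noteq> mat2 (-1) 0 0 (-1)" by (simp add: mat2_eq_iff)
  ultimately show ?thesis by simp
qed

text \<open>The inversion fixes \<open>\<i>\<close> with automorphy factor \<open>\<i>\<close>, and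
  \<open>\<i> ^ 6 = -1\<close>.\<close>

lemma E6_i: "E6 \<i> = 0"
  using E6_moebius[OF moebius_S(1), of \<i>] power_mult[of \<i> 2 3] by (simp add: moebius_S)

lemma sum_squares_eq_1_int:
  fixes a c :: int
  assumes "a * a + c * c = 1"
  shows "(a, c) \<in> {(1, 0), (-1, 0), (0, 1), (0, -1)}"
proof -
  have "a\<^sup>2 \<le> 1\<^sup>2" "c\<^sup>2 \<le> 1\<^sup>2" using assms by (simp_all add: power2_eq_square) (metis add.commute
      le_add_same_cancel1 zero_le_square)+
  hence "\<bar>a\<bar> \<le> 1" "\<bar>c\<bar> \<le> 1" using abs_le_square_iff[of a 1] abs_le_square_iff[of c 1] by simp_all
  hence "a \<in> {-1, 0, 1}" "c \<in> {-1, 0, 1}" by auto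
  thus ?thesis using assms by auto
qed

lemma card_stab_i: "card (stab \<i>) = 4"
proof -
  have "stab \<i> = (\<lambda>(a, c). mat2 a (- c) c a) ` {(1, 0), (-1, 0), (0, 1), (0, -1)}"
  proof (intro equalityI subsetI)
    fix A assume "A \<in> stab \<i>"
    hence A: "A \<in> SL2Z" "moebius A \<i> = \<i>" by (auto simp: stab_def)
    have "of_int (A $ 1 $ 1) * \<i> + of_int (A $ 1 $ 2) = \<i> * aut_factor A \<i>"
      using moebius_fixed_iff[OF A(1), of \<i>] A(2) by simp
    hence "A $ 1 $ 2 = - A $ 2 $ 1" "A $ 1 $ 1 = A $ 2 $ 2"
      by (auto simp: aut_factor_def complex_eq_iff simp flip: of_int_minus of_int_eq_iff)
    moreover from this have "(A $ 2 $ 2, A $ 2 $ 1) \<in> {(1, 0), (-1, 0), (0, 1), (0, -1)}"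
      using A(1) by (intro sum_squares_eq_1_int) (simp add: SL2Z_iff)
    ultimately show "A \<in> (\<lambda>(a, c). mat2 a (- c) c a) ` {(1, 0), (-1, 0), (0, 1), (0, -1)}"
      by (intro image_eqI[of _ _ "(A $ 2 $ 2, A $ 2 $ 1)"]) (simp_all add: mat2_eq_iff)
  next
    fix A assume "A \<in> (\<lambda>(a, c). mat2 a (- c) c a) ` {(1, 0), (-1, 0), (0, 1), (0, -1)}"
    thus "A \<in> stab \<i>" by (auto simp: stab_def SL2Z_iff moebius_def aut_factor_def)
  qed
  moreover have "inj_on (\<lambda>(a, c). mat2 a (- c) c a) {(1, 0), (-1, 0), (0, 1), (0, -1)}"
    by (auto simp: inj_on_def mat2_eq_iff)
  ultimately show ?thesis by (simp add: card_image)
qed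

definition rho :: complex where "rho = Complex (-1/2) (sqrt 3 / 2)"

lemma rho: "Im rho > 0" "rho * rho = - 1 - rho"
  by (simp_all add: rho_def complex_eq_iff)

text \<open>The map \<open>z -> -1 / (z + 1)\<close> fixes \<open>rho\<close> with automorphy factor
  \<open>rho + 1\<close>, whose fourth power \<open>- 1 - rho\<close> differs from 1.\<close>

lemma E4_rho: "E4 rho = 0"
proof -
  let ?A = "mat2 0 (-1) 1 1"
  have A: "?A \<in> SL2Z" by (simp add: SL2Z_iff)
  have "moebius ?A rho = rho"
    using rho unfolding moebius_fixed_iff[OF A rho(1)] by (simp add: aut_factor_def algebra_simps)
  hence e1: "E4 rho = (rho + 1) ^ 4 * E4 rho"
    using E4_moebius[OF A rho(1)] by (simp add: aut_factor_def)
  have e2: "(rho + 1) ^ 4 = - 1 - rho"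
  proof -
    have s: "(rho + 1) * (rho + 1) = rho" using rho(2) by (simp add: algebra_simps)
    have "(rho + 1) ^ 4 = ((rho + 1) * (rho + 1)) * ((rho + 1) * (rho + 1))"
        by (simp only: power4_eq_xxxx mult.assoc)
    thus ?thesis unfolding s rho(2) .
  qed
  have "(2 + rho) * E4 rho = E4 rho - (- 1 - rho) * E4 rho" by (simp add: algebra_simps)
  also have "\<dots> = 0" using e1 unfolding e2 by (simp only: right_minus_eq)
  finally have "(2 + rho) * E4 rho = 0" .
  moreover have "2 + rho \<noteq> 0" by (simp add: rho_def complex_eq_iff)
  ultimately show ?thesis by simp
qed

text \<open>These are the six units of the Eisenstein integers; completing the square in either
  variable bounds both by 1.\<close>

lemma eisenstein_norm_eq_1:
  fixes c d :: int
  assumes "d * d - c * d + c * c = 1"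
  shows "(c, d) \<in> {(0, 1), (0, -1), (1, 0), (-1, 0), (1, 1), (-1, -1)}"
proof -
  have "(2 * d - c)\<^sup>2 + 3 * c\<^sup>2 = 4" "(2 * c - d)\<^sup>2 + 3 * d\<^sup>2 = 4"
    using assms by (simp_all add: power2_eq_square algebra_simps)
  hence "3 * c\<^sup>2 \<le> 4" "3 * d\<^sup>2 \<le> 4"
    using zero_le_power2[of "2 * d - c"] zero_le_power2[of "2 * c - d"] by linarith+
  hence "c\<^sup>2 \<le> 1\<^sup>2" "d\<^sup>2 \<le> 1\<^sup>2" by simp_all
  hence "\<bar>c\<bar> \<le> 1" "\<bar>d\<bar> \<le> 1" using abs_le_square_iff[of c 1] abs_le_square_iff[of d 1] by simp_all
  hence "c \<in> {-1, 0, 1}" "d \<in> {-1, 0, 1}" by auto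
  thus ?thesis using assms by auto
qed

lemma card_stab_rho: "card (stab rho) = 6"
proof -
  let ?X = "{(0, 1), (0, -1), (1, 0), (-1, 0), (1, 1), (-1, -1)} :: (int \<times> int) set"
  let ?m = "\<lambda>(c, d). mat2 (d - c) (- c) c d"
  have fixed: "moebius A rho = rho \<longleftrightarrow> A $ 1 $ 1 = A $ 2 $ 2 - A $ 2 $ 1 \<and> A $ 1 $ 2 = - A $ 2 $ 1"
    if "A \<in> SL2Z" for A
  proof -
    have "rho * aut_factor A rho = of_int (A $ 2 $ 1) * (rho * rho) + of_int (A $ 2 $ 2) * rho"
      by (simp add: aut_factor_def algebra_simps)
    also have "\<dots> = of_int (A $ 2 $ 2 - A $ 2 $ 1) * rho + of_int (- A $ 2 $ 1)"
      unfolding rho(2) by (simp add: algebra_simps)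
    finally have e: "rho * aut_factor A rho = of_int (A $ 2 $ 2 - A $ 2 $ 1) * rho + of_int (- A $ 2
        $ 1)" .
    have lin: "of_int a * rho + of_int b = of_int a' * rho + of_int b' \<longleftrightarrow> a = a' \<and> b = b'" for a b a'
        b' :: int
    proof
      assume *: "of_int a * rho + of_int b = of_int a' * rho + of_int b'"
      from arg_cong[OF this, of Im] have "real_of_int a * Im rho = real_of_int a' * Im rho" by simp
      hence "a = a'" using rho(1) by simp
      thus "a = a' \<and> b = b'" using * by simp
    qed simp
    show ?thesis unfolding moebius_fixed_iff[OF that rho(1)] e lin ..
  qed
  have "stab rho = ?m ` ?X"
  proof (intro equalityI subsetI)
    fix A assume "A \<in> stab rho"
    hence A: "A \<in> SL2Z" "A $ 1 $ 1 = A $ 2 $ 2 - A $ 2 $ 1" "A $ 1 $ 2 = - A $ 2 $ 1"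
      using fixed by (auto simp: stab_def)
    define c d where "c = A $ 2 $ 1" and "d = A $ 2 $ 2"
    have cd: "A $ 1 $ 1 = d - c" "A $ 1 $ 2 = - c" using A by (simp_all add: c_def d_def)
    have "d * d - c * d + c * c = 1"
      using A(1) unfolding SL2Z_iff cd c_def[symmetric] d_def[symmetric]
          by (simp add: algebra_simps)
    hence mem: "(c, d) \<in> ?X" by (rule eisenstein_norm_eq_1)
    have "A = ?m (c, d)" unfolding mat2_eq_iff using cd by (simp add: c_def d_def)
    from this mem show "A \<in> ?m ` ?X" by (rule image_eqI)
  next
    fix A assume "A \<in> ?m ` ?X"
    then obtain cd where cd: "cd \<in> ?X" "A = ?m cd" by (rule imageE)
    have "A \<in> SL2Z" unfolding SL2Z_iff cd(2) using cd(1) by auto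
    thus "A \<in> stab rho" unfolding stab_def using fixed[of A] cd(2)
      by (simp add: case_prod_unfold)
  qed
  moreover have "inj_on ?m ?X" by (auto simp: inj_on_def mat2_eq_iff)
  ultimately have "card (stab rho) = card ?X" by (simp add: card_image)
  thus ?thesis by simp
qed

lemma klein_j_rho: "klein_j rho = 0"
  using rho by (simp add: klein_j_eq E4_rho)

lemma klein_j_i: "klein_j \<i> = 1728"
  using klein_j_1728[of \<i>] by (simp add: E6_i)

lemma card_stab:
  assumes z: "Im z > 0"
  shows "card (stab z) = (if klein_j z = 0 then 6 else if klein_j z = 1728 then 4 else 2)"
proof -
  have "card (stab z) = 6" if "klein_j z = 0"
    using card_stab_orbit[OF klein_j_inj_orbit[OF z rho(1)]] that klein_j_rho card_stab_rho by simp
  moreover have "card (stab z) = 4" if "klein_j z = 1728"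
    using card_stab_orbit[OF klein_j_inj_orbit[OF z, of \<i>]] that klein_j_i card_stab_i by simp
  moreover have "card (stab z) = 2" if "klein_j z \<noteq> 0" "klein_j z \<noteq> 1728"
  proof (rule card_stab_generic[OF z])
    show "E4 z \<noteq> 0" using that(1) klein_j_eq[OF z] by auto
    show "E6 z \<noteq> 0" using that(2) klein_j_1728[OF z] by auto
  qed
  ultimately show ?thesis by simp
qed

section \<open>Divisors of modular forms\<close>

text \<open>An explicit local factorisation with a natural exponent: products and powers add
  exponents at once, and \<open>zorder\<close> is read off at the end.\<close>

definition vanishes_to :: "(complex \<Rightarrow> complex) \<Rightarrow> complex \<Rightarrow> nat \<Rightarrow> bool" where
  "vanishes_to f z n \<longleftrightarrow> (\<exists>S g. open S \<and> z \<in> S \<and> g holomorphic_on S \<and> g z \<noteq> 0 \<and> (\<forall>w\<in>S. f w =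
      g w * (w - z) ^ n))"

lemma vanishes_to_zorder: "vanishes_to f z n \<Longrightarrow> zorder f z = int n"
  unfolding vanishes_to_def by (elim exE conjE, rule zorder_eqI) auto

lemma vanishes_to_0:
  assumes "f holomorphic_on S" "open S" "z \<in> S" "f z \<noteq> 0"
  shows "vanishes_to f z 0"
  unfolding vanishes_to_def using assms by (intro exI[of _ S] exI[of _ f]) auto

lemma vanishes_to_mult:
  assumes "vanishes_to f z m" "vanishes_to g z n"
  shows "vanishes_to (\<lambda>w. f w * g w) z (m + n)"
proof -
  obtain S f' where S: "open S" "z \<in> S" "f' holomorphic_on S" "f' z \<noteq> 0" "\<And>w. w \<in> S \<Longrightarrow> f w =
      f' w * (w - z) ^ m"
    using assms(1) unfolding vanishes_to_def by blast
  obtain T g' where T: "open T" "z \<in> T" "g' holomorphic_on T" "g' z \<noteq> 0" "\<And>w. w \<in> T \<Longrightarrow> g w =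
      g' w * (w - z) ^ n"
    using assms(2) unfolding vanishes_to_def by blast
  have "(\<lambda>w. f' w * g' w) holomorphic_on S \<inter> T"
    by (intro holomorphic_intros holomorphic_on_subset[OF S(3)] holomorphic_on_subset[OF T(3)]) auto
  thus ?thesis unfolding vanishes_to_def using S T
    by (intro exI[of _ "S \<inter> T"] exI[of _ "\<lambda>w. f' w * g' w"]) (auto simp: power_add)
qed

lemma vanishes_to_power: "vanishes_to f z m \<Longrightarrow> vanishes_to (\<lambda>w. f w ^ n) z (m * n)"
proof (induction n)
  case 0
  show ?case by (auto intro: vanishes_to_0[where S = UNIV])
next
  case (Suc n)
  thus ?case using vanishes_to_mult[of f z m "\<lambda>w. f w ^ n" "m * n"] by simp
qed

lemma vanishes_to_cong:
  assumes "vanishes_to f z n" "open T" "z \<in> T" "\<And>w. w \<in> T \<Longrightarrow> f w = g w"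
  shows "vanishes_to g z n"
proof -
  obtain S h where S: "open S" "z \<in> S" "h holomorphic_on S" "h z \<noteq> 0" "\<And>w. w \<in> S \<Longrightarrow> f w =
      h w * (w - z) ^ n"
    using assms(1) unfolding vanishes_to_def by blast
  have "g w = h w * (w - z) ^ n" if "w \<in> S \<inter> T" for w
    using S(5)[of w] assms(4)[of w] that by simp
  moreover have "h holomorphic_on S \<inter> T" by (rule holomorphic_on_subset[OF S(3)]) auto
  ultimately show ?thesis unfolding vanishes_to_def using S(1,2,4) assms(2,3) by (intro exI[of _
      "S \<inter> T"] exI[of _ h]) auto
qed

lemma vanishes_to_nonconst:
  assumes "f holomorphic_on S" "open S" "connected S" "z \<in> S" "w \<in> S" "f w \<noteq> 0"
  shows "vanishes_to f z (nat (zorder f z))" "zorder f z \<ge> 0"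
proof -
  have *: "(if f z = 0 then 0 < zorder f z else zorder f z = 0) \<and>
    (\<exists>r>0. cball z r \<subseteq> S \<and> zor_poly f z holomorphic_on cball z r \<and>
      (\<forall>w\<in>cball z r. f w = zor_poly f z w * (w - z) ^ nat (zorder f z) \<and> zor_poly f z w \<noteq> 0))"
    by (rule zorder_exist_zero) (use assms in auto)
  thus "zorder f z \<ge> 0" by (auto split: if_splits)
  from * obtain r where r: "r > 0" "zor_poly f z holomorphic_on cball z r"
    "\<And>w. w \<in> cball z r \<Longrightarrow> f w = zor_poly f z w * (w - z) ^ nat (zorder f z) \<and> zor_poly f z w \<noteq> 0"
        by blast
  have "zor_poly f z holomorphic_on ball z r" by (rule holomorphic_on_subset[OF r(2)]) auto
  thus "vanishes_to f z (nat (zorder f z))" unfolding vanishes_to_def using r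
    by (intro exI[of _ "ball z r"] exI[of _ "zor_poly f z"]) auto
qed

lemma vanishes_to_1:
  assumes "f holomorphic_on S" "open S" "z \<in> S" "f z = 0" "(f has_field_derivative D) (at z)"
      "D \<noteq> 0"
  shows "vanishes_to f z 1"
proof -
  define g where "g w = (if w = z then deriv f z else (f w - f z) / (w - z))" for w
  have "g holomorphic_on S" unfolding g_def[abs_def] by (rule pole_lemma_open) (use assms in auto)
  moreover have "g z \<noteq> 0" using assms DERIV_imp_deriv by (auto simp: g_def)
  moreover have "f w = g w * (w - z) ^ 1" for w using assms(4) by (simp add: g_def)
  ultimately show ?thesis unfolding vanishes_to_def using assms(2,3) by blast
qed

text \<open>\<open>E4\<close> and \<open>E6\<close> have no common zero because \<open>Dl\<close>
  never vanishes; by Ramanujan's formulas their zeros are therefore simple. So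
  \<open>j = E4^3 / Dl\<close> and \<open>j - 1728 = E6^2 / Dl\<close> vanish to orders 3 and 2, and
  elsewhere the derivative of \<open>j\<close> is nonzero.\<close>

lemma klein_j_vanishes_to:
  assumes z: "Im z > 0"
  shows "vanishes_to (\<lambda>w. klein_j w - klein_j z) z (card (stab z) div 2)"
proof -
  have hol: "E4 holomorphic_on upper_half" "E6 holomorphic_on upper_half"
      "Dl holomorphic_on upper_half"
    using mform_holomorphic mform_E4 mform_E6 mform_Dl by blast+
  have D: "vanishes_to (\<lambda>w. 1 / Dl w) z 0"
    by (rule vanishes_to_0[where S = upper_half]) (use z hol in \<open>auto intro!: holomorphic_intros\<close>)
  consider "klein_j z = 0" | "klein_j z = 1728" | "klein_j z \<noteq> 0" "klein_j z \<noteq> 1728" by blast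
  thus ?thesis
  proof cases
    case 1
    have E4: "E4 z = 0" using 1 z by (simp add: klein_j_eq)
    have "E6 z \<noteq> 0" using E4 E4_cubed_minus_E6_squared[OF z] by auto
    hence "theta_disc e4 (qexp z) \<noteq> 0" using theta_e4[OF z] E4 by auto
    hence "vanishes_to E4 z 1"
      by (intro vanishes_to_1[OF hol(1) open_upper_half _ E4 mform_derivative[OF mform_E4 z]]) (use
          z in auto)
    from vanishes_to_mult[OF vanishes_to_power[OF this, of 3] D]
    have "vanishes_to (\<lambda>w. E4 w ^ 3 * (1 / Dl w)) z 3" by simp
    hence "vanishes_to (\<lambda>w. klein_j w - klein_j z) z 3"
      by (rule vanishes_to_cong[where T = upper_half]) (use z 1 klein_j_eq in auto)
    thus ?thesis using 1 by (simp add: card_stab[OF z])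
  next
    case 2
    have E6: "E6 z = 0" using 2 klein_j_1728[OF z] by simp
    have "E4 z \<noteq> 0" using E6 E4_cubed_minus_E6_squared[OF z] by auto
    hence "theta_disc e6 (qexp z) \<noteq> 0" using theta_e6[OF z] E6 by auto
    hence "vanishes_to E6 z 1"
      by (intro vanishes_to_1[OF hol(2) open_upper_half _ E6 mform_derivative[OF mform_E6 z]]) (use
          z in auto)
    from vanishes_to_mult[OF vanishes_to_power[OF this, of 2] D]
    have "vanishes_to (\<lambda>w. E6 w ^ 2 * (1 / Dl w)) z 2" by simp
    hence "vanishes_to (\<lambda>w. klein_j w - klein_j z) z 2"
      by (rule vanishes_to_cong[where T = upper_half]) (use z 2 klein_j_1728 in auto)
    thus ?thesis using 2 by (simp add: card_stab[OF z])
  next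
    case 3
    have d: "(klein_j has_field_derivative deriv klein_j z) (at z)"
      by (rule holomorphic_derivI[OF klein_j_holomorphic open_upper_half]) (use z in auto)
    have "vanishes_to (\<lambda>w. klein_j w - klein_j z) z 1"
    proof (rule vanishes_to_1[where S = upper_half])
      show "((\<lambda>w. klein_j w - klein_j z) has_field_derivative deriv klein_j z) (at z)"
        using DERIV_diff[OF d DERIV_const] by simp
    qed (use z klein_j_deriv_nonzero[OF z 3] klein_j_holomorphic in \<open>auto intro!:
        holomorphic_intros\<close>)
    thus ?thesis using 3 by (simp add: card_stab[OF z])
  qed
qed

section \<open>Polynomials in \<open>j\<close> and the sum over orbits\<close>

lemma poly_klein_j_vanishes_to:
  assumes z: "Im z > 0" and p: "p \<noteq> 0"
  shows "vanishes_to (\<lambda>w. poly p (klein_j w)) z (order (klein_j z) p * (card (stab z) div 2))"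
proof -
  obtain q where q: "p = [:- klein_j z, 1:] ^ order (klein_j z) p * q" "\<not> [:- klein_j z, 1:] dvd q"
    using order_decomp[OF p] by blast
  have "vanishes_to (\<lambda>w. poly q (klein_j w)) z 0"
    by (rule vanishes_to_0[where S = upper_half])
       (use z q klein_j_holomorphic in \<open>auto simp: poly_eq_0_iff_dvd intro!: holomorphic_intros\<close>)
  from vanishes_to_mult[OF vanishes_to_power[OF klein_j_vanishes_to[OF z], of "order (klein_j z) p"]
      this]
  have "vanishes_to (\<lambda>w. (klein_j w - klein_j z) ^ order (klein_j z) p * poly q (klein_j w)) z
     (order (klein_j z) p * (card (stab z) div 2))" by (simp add: mult.commute)
  moreover have "(klein_j w - klein_j z) ^ order (klein_j z) p * poly q (klein_j w) =
      poly p (klein_j w)" for w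
    using arg_cong[OF q(1), of "\<lambda>p. poly p (klein_j w)"] by (simp add: poly_power)
  ultimately show ?thesis by simp
qed

text \<open>Subtracting a multiple of a power of \<open>E4\<close>, which is \<open>Dl\<close> and
  \<open>j\<close> to matching powers, removes the value at the cusp. The remainder is divisible by
  \<open>Dl\<close>, and the weight drops by 12.\<close>

lemma mform_polynomial_klein_j:
  assumes "mform (12 * n) F G"
  shows "\<exists>p. \<forall>z. Im z > 0 \<longrightarrow> F z = Dl z ^ n * poly p (klein_j z)"
  using assms
proof (induction n arbitrary: F G)
  case 0
  hence "mform 0 F G" by simp
  thus ?case using mform_0_const' by (intro exI[of _ "[:G 0:]"]) auto
next
  case (Suc n)
  define a where "a = G 0"
  have "mform (4 * (3 * Suc n)) (\<lambda>z. E4 z ^ (3 * Suc n)) (\<lambda>q. e4 q ^ (3 * Suc n))"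
    by (rule mform_power[OF mform_E4])
  hence "mform (12 * Suc n) (\<lambda>z. E4 z ^ (3 * Suc n)) (\<lambda>q. e4 q ^ (3 * Suc n))" by simp
  from mform_diff[OF Suc.prems mform_cmult[OF this, of a]]
  have m: "mform (12 * n + 12) (\<lambda>z. F z - a * E4 z ^ (3 * Suc n)) (\<lambda>q. G q - a * e4 q ^ (3 * Suc
      n))"
    by (simp add: add.commute)
  have "G 0 - a * e4 0 ^ (3 * Suc n) = 0" by (simp add: a_def)
  from Suc.IH[OF mform_divide_Dl[OF m this]]
  obtain p where p: "\<And>z. Im z > 0 \<Longrightarrow> (F z - a * E4 z ^ (3 * Suc n)) / Dl z = Dl z ^ n * poly p
      (klein_j z)" by blast
  have "F z = Dl z ^ Suc n * poly (p + monom a (Suc n)) (klein_j z)" if z: "Im z > 0" for z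
  proof -
    have "E4 z ^ (3 * Suc n) = Dl z ^ Suc n * klein_j z ^ Suc n"
      unfolding power_mult klein_j_eq[OF z] by (simp add: power_divide del: power_Suc)
    moreover have "F z = Dl z * (Dl z ^ n * poly p (klein_j z)) + a * E4 z ^ (3 * Suc n)"
      using p[OF z] by (simp add: field_simps)
    ultimately show ?thesis by (simp add: poly_monom algebra_simps)
  qed
  thus ?case by blast
qed

lemma poly_log_derivative:
  fixes p :: "complex poly"
  assumes p: "p \<noteq> 0" and x: "poly p x \<noteq> 0"
  shows "poly (pderiv p) x / poly p x = (\<Sum>w | poly p w = 0. of_nat (order w p) / (x - w))"
proof -
  define R where "R = {w. poly p w = 0}"
    have nz: "x - w \<noteq> 0" if "w \<in> R" for w using that x by (auto simp: R_def)
  have p_eq: "poly p y = lead_coeff p * (\<Prod>w\<in>R. (y - w) ^ order w p)" for y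
    using arg_cong[OF complex_poly_decompose[of p], of "\<lambda>p. poly p y"] by (simp add: poly_prod
        poly_power R_def)
  have "((\<lambda>y. \<Prod>w\<in>R. (y - w) ^ order w p) has_field_derivative
      (\<Prod>w\<in>R. (x - w) ^ order w p) * (\<Sum>w\<in>R. (of_nat (order w p) * (1 * (x - w) ^ (order w p - Suc
          0))) / (x - w) ^ order w p)) (at x)"
    by (rule has_field_derivative_prod')
       (use nz in \<open>auto intro!: derivative_eq_intros\<close>)
  also have "(\<Sum>w\<in>R. (of_nat (order w p) * (1 * (x - w) ^ (order w p - Suc 0))) / (x - w) ^ order w
      p) =
      (\<Sum>w\<in>R. of_nat (order w p) / (x - w))"
  proof (rule sum.cong)
    fix w assume "w \<in> R"
    thus "(of_nat (order w p) * (1 * (x - w) ^ (order w p - Suc 0))) / (x - w) ^ order w p =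
        of_nat (order w p) / (x - w)"
      using nz[of w] by (cases "order w p") auto
  qed simp
  finally have "((\<lambda>y. \<Prod>w\<in>R. (y - w) ^ order w p) has_field_derivative
      (\<Prod>w\<in>R. (x - w) ^ order w p) * (\<Sum>w\<in>R. of_nat (order w p) / (x - w))) (at x)" .
  from DERIV_cmult[OF this, of "lead_coeff p"]
  have "(poly p has_field_derivative poly p x * (\<Sum>w\<in>R. of_nat (order w p) / (x - w))) (at x)"
    unfolding p_eq[abs_def] by (simp add: mult_ac)
  hence "poly (pderiv p) x = poly p x * (\<Sum>w\<in>R. of_nat (order w p) / (x - w))"
    using DERIV_unique poly_DERIV by blast
  thus ?thesis using x by (simp add: R_def)
qed

definition klein_fiber :: "complex \<Rightarrow> complex set" where
  "klein_fiber w = {z. Im z > 0 \<and> klein_j z = w}"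

lemma klein_fiber_nonempty: "klein_fiber w \<noteq> {}"
  using klein_j_surj[of w] by (auto simp: klein_fiber_def)

lemma orbit_rel_image: "Im z > 0 \<Longrightarrow> orbit_rel `` {z} = klein_fiber (klein_j z)"
  unfolding Image_def klein_fiber_def
  by (intro Collect_cong) (metis klein_j_inj_orbit klein_j_orbit singletonD singletonI
      equiv_orbit_rel
      equiv_type mem_Sigma_iff subsetD upper_half_iff)

text \<open>Since \<open>j\<close> is surjective and separates orbits, the orbits are parametrised
  by the complex numbers; the sum in \<open>fdiv\<close> thereby becomes a sum over values of
  \<open>j\<close>.\<close>

lemma orbits_eq_fibers: "upper_half // orbit_rel = range klein_fiber"
proof
  show "upper_half // orbit_rel \<subseteq> range klein_fiber"
    by (auto simp: quotient_def orbit_rel_image)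
  show "range klein_fiber \<subseteq> upper_half // orbit_rel"
  proof clarify
    fix w
    obtain z where "Im z > 0" "klein_j z = w" using klein_j_surj by blast
    thus "klein_fiber w \<in> upper_half // orbit_rel"
      unfolding quotient_def using orbit_rel_image[of z] by auto
  qed
qed

lemma inj_klein_fiber: "inj klein_fiber"
proof (rule injI)
  fix v w assume *: "klein_fiber v = klein_fiber w"
  obtain z where "z \<in> klein_fiber v" using klein_fiber_nonempty by blast
  with * show "v = w" by (auto simp: klein_fiber_def)
qed

lemma klein_fiber_some: "Im (SOME z. z \<in> klein_fiber w) > 0" "klein_j (SOME z. z \<in> klein_fiber w) =
    w"
  using some_in_eq[of "klein_fiber w"] klein_fiber_nonempty[of w] by (auto simp: klein_fiber_def)

lemma fdiv_mform:
  assumes f: "mform (2 * k) f g" and \<tau>: "Im \<tau> > 0" "f \<tau> \<noteq> 0"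
  shows "fdiv f \<tau> = - (deriv f \<tau> / (2 * of_real pi * \<i> * f \<tau>)) + of_nat k / 6 * E2 \<tau>"
proof -
  have "mform (12 * k) (\<lambda>z. f z ^ 6) (\<lambda>q. g q ^ 6)" using mform_power[OF f, of 6] by simp
  then obtain p where p: "\<And>z. Im z > 0 \<Longrightarrow> f z ^ 6 = Dl z ^ k * poly p (klein_j z)"
    using mform_polynomial_klein_j by blast
  have pj: "poly p (klein_j \<tau>) \<noteq> 0" using p[OF \<tau>(1)] \<tau>(2) by auto
  hence p0: "p \<noteq> 0" by auto
  have hf: "f holomorphic_on upper_half" by (rule mform_holomorphic[OF f])
  have hD: "Dl holomorphic_on upper_half" by (rule mform_holomorphic[OF mform_Dl])
  \<comment> \<open>Orders at \<open>z\<close> of the two sides of \<open>f^6 = Dl^k p(j)\<close>: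
    \<open>Dl\<close> contributes nothing, and each root of \<open>p\<close> counts
    \<open>card (stab z) / 2\<close> times its multiplicity. The weight
    \<open>2 / card (stab z)\<close> in the divisor will cancel this factor.\<close>
  have zord: "6 * zorder f z = int (order (klein_j z) p * (card (stab z) div 2))" if z: "Im z > 0"
      for z
  proof -
    note v = vanishes_to_nonconst[OF hf open_upper_half convex_connected[OF convex_upper_half], of z
        \<tau>]
    have 1: "vanishes_to (\<lambda>w. f w ^ 6) z (nat (zorder f z) * 6)"
      by (rule vanishes_to_power[OF v(1)]) (use z \<tau> in auto)
    have "vanishes_to (\<lambda>w. Dl w ^ k) z 0"
      by (rule vanishes_to_0[where S = upper_half]) (use z hD in \<open>auto intro!: holomorphic_intros\<close>)
    from vanishes_to_mult[OF this poly_klein_j_vanishes_to[OF z p0]]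
    have "vanishes_to (\<lambda>w. Dl w ^ k * poly p (klein_j w)) z (order (klein_j z) p * (card (stab z)
        div 2))"
      by simp
    hence 2: "vanishes_to (\<lambda>w. f w ^ 6) z (order (klein_j z) p * (card (stab z) div 2))"
      by (rule vanishes_to_cong[where T = upper_half]) (use z p in auto)
    have "int (nat (zorder f z) * 6) = int (order (klein_j z) p * (card (stab z) div 2))"
      unfolding vanishes_to_zorder[OF 1, symmetric] vanishes_to_zorder[OF 2, symmetric] ..
    thus ?thesis using v(2) z \<tau> by simp
  qed
  define J where "J = deriv klein_j \<tau> / (2 * of_real pi * \<i>)"
  let ?R = "{w. poly p w = 0}"
  have fin: "finite ?R" by (rule poly_roots_finite[OF p0])
  have "fdiv f \<tau> = (\<Sum>\<^sub>\<infinity>orb\<in>range klein_fiber. div_term f \<tau> (SOME z. z \<in> orb))"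
    by (simp add: fdiv_def orbits_eq_fibers)
  also have "\<dots> = (\<Sum>\<^sub>\<infinity>w. div_term f \<tau> (SOME z. z \<in> klein_fiber w))"
    by (subst infsum_reindex) (simp_all add: inj_klein_fiber o_def)
  also have "\<dots> = (\<Sum>\<^sub>\<infinity>w. of_nat (order w p) / 6 * (J / (w - klein_j \<tau>)))"
  proof (rule infsum_cong)
    fix w
    define z where "z = (SOME z. z \<in> klein_fiber w)"
    have z: "Im z > 0" "klein_j z = w" using klein_fiber_some by (simp_all add: z_def)
    define s where "s = card (stab z) div 2"
    have s: "card (stab z) = 2 * s" "s > 0" by (auto simp: s_def card_stab[OF z(1)])
    have "of_int (6 * zorder f z) = (of_int (int (order w p * s)) :: complex)"
      using zord[OF z(1)] by (simp add: z(2) s_def)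
    hence "of_int (zorder f z) = (of_nat (order w p) * of_nat s / 6 :: complex)"
        by (simp add: field_simps)
    hence zo: "2 / of_nat (card (stab z)) * of_int (zorder f z) = (of_nat (order w p) / 6 ::
        complex)"
      using s by simp
    have "H_fun z \<tau> = J / (w - klein_j \<tau>)" unfolding H_fun_def z(2) J_def by simp
    thus "div_term f \<tau> (SOME z. z \<in> klein_fiber w) = of_nat (order w p) / 6 * (J / (w - klein_j \<tau>))"
      unfolding z_def[symmetric] div_term_def zo by simp
  qed
  \<comment> \<open>Only roots of \<open>p\<close> have nonzero order, and
    \<open>klein_j \<tau>\<close> is not a root because \<open>f \<tau> \<noteq> 0\<close>; hence no
    denominator in the finite sum vanishes.\<close>
  also have "\<dots> = (\<Sum>\<^sub>\<infinity>w\<in>?R. of_nat (order w p) / 6 * (J / (w - klein_j \<tau>)))"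
    by (rule infsum_cong_neutral) (use p0 in \<open>auto simp: order_root\<close>)
  also have "\<dots> = (\<Sum>w\<in>?R. of_nat (order w p) / 6 * (J / (w - klein_j \<tau>)))"
    by (rule infsum_finite[OF fin])
  also have "\<dots> = - (J / 6) * (\<Sum>w\<in>?R. of_nat (order w p) / (klein_j \<tau> - w))"
    unfolding sum_distrib_left
  proof (rule sum.cong)
    fix w
    have "of_nat (order w p) / 6 * (J / (w - klein_j \<tau>)) = J / 6 * (of_nat (order w p) / (w -
        klein_j \<tau>))"
      by simp
    also have "of_nat (order w p) / (w - klein_j \<tau>) = - (of_nat (order w p) / (klein_j \<tau> - w))"
      by (metis minus_diff_eq minus_divide_right)
    finally show "of_nat (order w p) / 6 * (J / (w - klein_j \<tau>)) = - (J / 6) * (of_nat (order w p) /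
        (klein_j \<tau> - w))"
      by simp
  qed simp
  also have "\<dots> = - (J / 6) * (poly (pderiv p) (klein_j \<tau>) / poly p (klein_j \<tau>))"
    by (simp add: poly_log_derivative[OF p0 pj])
  finally have fd: "fdiv f \<tau> = - (J / 6) * (poly (pderiv p) (klein_j \<tau>) / poly p (klein_j \<tau>))" .
  let ?D = "deriv f \<tau>" and ?L = "poly (pderiv p) (klein_j \<tau>)" and ?p = "poly p (klein_j \<tau>)"
  have df: "(f has_field_derivative ?D) (at \<tau>)"
    by (rule holomorphic_derivI[OF hf open_upper_half]) (use \<tau> in auto)
  have dj: "(klein_j has_field_derivative deriv klein_j \<tau>) (at \<tau>)"
    by (rule holomorphic_derivI[OF klein_j_holomorphic open_upper_half]) (use \<tau> in auto)
  have 1: "((\<lambda>z. f z ^ 6) has_field_derivative of_nat 6 * (?D * f \<tau> ^ (6 - Suc 0))) (at \<tau>)"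
    by (rule DERIV_power[OF df])
  have "((\<lambda>z. Dl z ^ k * poly p (klein_j z)) has_field_derivative
      (of_nat k * (2 * of_real pi * \<i> * E2 \<tau> * Dl \<tau> * Dl \<tau> ^ (k - Suc 0))) * ?p + ?L * deriv klein_j
          \<tau> * Dl \<tau> ^ k) (at \<tau>)"
    by (rule DERIV_mult[OF DERIV_power[OF Dl_derivative[OF \<tau>(1)]] DERIV_chain2[OF poly_DERIV dj]])
  moreover have "eventually (\<lambda>z. f z ^ 6 = Dl z ^ k * poly p (klein_j z)) (nhds \<tau>)"
    using eventually_nhds_in_open[OF open_upper_half, of \<tau>] \<tau>(1) p by (auto elim!: eventually_mono)
  ultimately have 2: "((\<lambda>z. f z ^ 6) has_field_derivative
      (of_nat k * (2 * of_real pi * \<i> * E2 \<tau> * Dl \<tau> * Dl \<tau> ^ (k - Suc 0))) * ?p + ?L * deriv klein_j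
          \<tau> * Dl \<tau> ^ k) (at \<tau>)"
    by (subst DERIV_cong_ev[OF refl _ refl])
  have ke: "of_nat k * (2 * of_real pi * \<i> * E2 \<tau> * Dl \<tau> * Dl \<tau> ^ (k - Suc 0)) = of_nat k * (2 *
      of_real pi * \<i> * E2 \<tau>) * Dl \<tau> ^ k"
    by (cases k) (simp_all add: mult_ac)
  have "6 * (?D * f \<tau> ^ 5) = of_nat k * (2 * of_real pi * \<i> * E2 \<tau>) * (Dl \<tau> ^ k * ?p) + ?L * deriv
      klein_j \<tau> * Dl \<tau> ^ k"
    using DERIV_unique[OF 1 2] unfolding ke by (simp add: mult_ac)
  also have "Dl \<tau> ^ k * ?p = f \<tau> ^ 6" using p[OF \<tau>(1)] by simp
  also have "Dl \<tau> ^ k = f \<tau> ^ 6 / ?p" using p[OF \<tau>(1)] pj by simp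
  finally have e: "6 * (?D * f \<tau> ^ 5) = of_nat k * (2 * of_real pi * \<i> * E2 \<tau>) * f \<tau> ^ 6 + ?L *
      deriv klein_j \<tau> * (f \<tau> ^ 6 / ?p)" .
  define c where "c = 2 * of_real pi * \<i>"
  have c: "c \<noteq> 0" by (simp add: c_def)
  have "f \<tau> ^ 5 * (6 * ?D) = f \<tau> ^ 5 * (of_nat k * c * E2 \<tau> * f \<tau> + ?L / ?p * deriv klein_j \<tau> * f
      \<tau>)"
    using e by (simp add: c_def eval_nat_numeral algebra_simps)
  hence "6 * ?D = of_nat k * c * E2 \<tau> * f \<tau> + ?L / ?p * deriv klein_j \<tau> * f \<tau>"
    using \<tau>(2) by simp
  hence "?L / ?p * deriv klein_j \<tau> = 6 * ?D / f \<tau> - of_nat k * c * E2 \<tau>"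
    using \<tau>(2) by (simp add: field_simps)
  moreover have "fdiv f \<tau> = - (?L / ?p * deriv klein_j \<tau>) / (6 * c)"
    unfolding fd J_def c_def[symmetric] by (simp add: mult_ac)
  ultimately have "fdiv f \<tau> = - (6 * ?D / f \<tau> - of_nat k * c * E2 \<tau>) / (6 * c)" by simp
  also have "\<dots> = - (?D / (c * f \<tau>)) + of_nat k / 6 * E2 \<tau>"
    using c \<tau>(2) by (simp add: field_simps)
  finally show ?thesis by (simp add: c_def)
qed

section \<open>The series of Zagier\<close>

lemma bqf_eval_1: "bqf_eval (a, b, c) z 1 = of_int a * z\<^sup>2 + of_int b * z + of_int c"
  by (simp add: bqf_eval_def)

lemma bqf_deriv: "((\<lambda>w. bqf_eval (a, b, c) w 1) has_field_derivative 2 * of_int a * z + of_int b)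
    (at z)"
  unfolding bqf_eval_1 by (auto intro!: derivative_eq_intros)

lemma bqf_real_scaled: "Im z \<noteq> 0 \<Longrightarrow> Im z * bqf_real (a, b, c) z = of_int a * (cmod z)\<^sup>2 + of_int b *
    Re z + of_int c"
  by (simp add: bqf_real_def)

lemma bqf_real_eq:
  assumes "Im z > 0"
  shows "of_real (bqf_real Q z) = - \<i> * deriv (\<lambda>w. bqf_eval Q w 1) z + 1 / of_real (Im z) * bqf_eval
      Q z 1"
proof -
  obtain a b c where Q: "Q = (a, b, c)" by (cases Q)
  have y: "of_real (Im z) \<noteq> (0::complex)" using assms by simp
  have "of_real (Im z) * of_real (bqf_real Q z) = of_real (Im z * bqf_real Q z)" by simp
  also have "Im z * bqf_real Q z = of_int a * (cmod z)\<^sup>2 + of_int b * Re z + of_int c"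
    using assms bqf_real_scaled by (simp add: Q)
  also have "of_real \<dots> = - \<i> * of_real (Im z) * (2 * of_int a * z + of_int b) + bqf_eval (a, b, c) z
      1"
    unfolding bqf_eval_1 cmod_power2 by (simp add: complex_eq_iff power2_eq_square algebra_simps)
  finally have "of_real (Im z) * of_real (bqf_real Q z) =
      of_real (Im z) * (- \<i> * deriv (\<lambda>w. bqf_eval Q w 1) z + 1 / of_real (Im z) * bqf_eval Q z 1)"
    using y DERIV_imp_deriv[OF bqf_deriv, of a b c z] by (simp add: Q ring_distribs mult_ac)
  thus ?thesis using y mult_left_cancel by blast
qed

text \<open>In terms of \<open>Q_z\<close> the identity reads
  \<open>|Q(z,1)|^2 = y^2 (Q_z^2 + D)\<close>; for \<open>D \<ge> 0\<close> it bounds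
  \<open>y |Q_z|\<close> by \<open>|Q(z,1)|\<close>.\<close>

lemma bqf_norm_square:
  assumes "(a, b, c) \<in> bqf_of_disc D"
  shows "(cmod (bqf_eval (a, b, c) z 1))\<^sup>2 = (of_int a * (cmod z)\<^sup>2 + of_int b * Re z + of_int c)\<^sup>2
      + of_int D * (Im z)\<^sup>2"
proof -
  have "D = b\<^sup>2 - 4 * a * c" using assms by (simp add: bqf_of_disc_def)
  hence D: "real_of_int D = (of_int b)\<^sup>2 - 4 * of_int a * of_int c" by simp
  show ?thesis unfolding bqf_eval_1 cmod_power2 D by (simp add: power2_eq_square algebra_simps)
qed

text \<open>With \<open>R = y Q_z\<close>, the real part of \<open>Q(z,1)\<close> is
  \<open>R - 2 a y^2\<close>. It and \<open>R\<close> are both at most \<open>N\<close> in absolute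
  value, which bounds \<open>a\<close>; the imaginary part bounds the other combination.\<close>

lemma bqf_coeff_bound:
  assumes Q: "(a, b, c) \<in> bqf_of_disc D" and D: "D \<ge> 0" and y: "Im z > 0"
  defines "N \<equiv> cmod (bqf_eval (a, b, c) z 1)"
  shows "\<bar>real_of_int a\<bar> * (Im z)\<^sup>2 \<le> N" "\<bar>2 * real_of_int a * Re z + real_of_int b\<bar> * Im z \<le> N"
proof -
  let ?R = "of_int a * (cmod z)\<^sup>2 + of_int b * Re z + of_int c"
  have "?R\<^sup>2 \<le> N\<^sup>2" unfolding N_def bqf_norm_square[OF Q] using D by simp
  hence R: "\<bar>?R\<bar> \<le> N" by (simp add: N_def abs_le_square_iff[symmetric])
  have re: "Re (bqf_eval (a, b, c) z 1) = ?R - 2 * of_int a * (Im z)\<^sup>2"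
    unfolding bqf_eval_1 cmod_power2 by (simp add: power2_eq_square algebra_simps)
  have "\<bar>?R - 2 * of_int a * (Im z)\<^sup>2\<bar> \<le> N" using abs_Re_le_cmod unfolding N_def re[symmetric] .
  hence "\<bar>2 * of_int a * (Im z)\<^sup>2\<bar> \<le> 2 * N" using R by linarith
  thus "\<bar>real_of_int a\<bar> * (Im z)\<^sup>2 \<le> N" by (simp add: abs_mult)
  have "Im (bqf_eval (a, b, c) z 1) = (2 * of_int a * Re z + of_int b) * Im z"
    unfolding bqf_eval_1 by (simp add: power2_eq_square algebra_simps)
  hence "\<bar>(2 * real_of_int a * Re z + of_int b) * Im z\<bar> \<le> N"
    using abs_Im_le_cmod[of "bqf_eval (a, b, c) z 1"] by (simp add: N_def)
  thus "\<bar>2 * real_of_int a * Re z + real_of_int b\<bar> * Im z \<le> N" using y by (simp add: abs_mult)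
qed

text \<open>For \<open>a \<noteq> 0\<close> the pair \<open>(a, b)\<close> determines \<open>c\<close>, and for \<open>a = 0\<close> only \<open>(b, c)\<close> is left; hence
  a two-variable lattice sum majorises the series.\<close>

definition bqf_size :: "bqf \<Rightarrow> real" where
  "bqf_size = (\<lambda>(a, b, c). if a = 0 then \<bar>real_of_int b\<bar> + \<bar>real_of_int c\<bar> else \<bar>real_of_int a\<bar> +
      \<bar>real_of_int b\<bar>)"

lemma bqf_size_pos:
  assumes "Q \<in> bqf_of_disc D" "D > 0"
  shows "bqf_size Q > 0"
proof -
  obtain a b c where Q: "Q = (a, b, c)" by (cases Q)
  have "b \<noteq> 0" if "a = 0" using assms that by (auto simp: Q bqf_of_disc_def)
  thus ?thesis by (auto simp: Q bqf_size_def intro: add_pos_nonneg)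
qed

lemma bqf_size_summable:
  assumes D: "D > 0" and k: "k \<ge> 3"
  shows "(\<lambda>Q. 1 / bqf_size Q ^ k) summable_on bqf_of_disc D"
proof -
  let ?l = "\<lambda>(m::int, n::int). 1 / (\<bar>real_of_int m\<bar> + \<bar>real_of_int n\<bar>) ^ k"
  let ?A = "{(a, b, c) \<in> bqf_of_disc D. a = 0}" and ?B = "{(a, b, c) \<in> bqf_of_disc D. a \<noteq> 0}"
  have "?l summable_on ((\<lambda>(a, b, c). (b, c)) ` ?A)"
    by (rule summable_on_subset[OF lattice_summable[OF k]]) (use D in \<open>auto simp: bqf_of_disc_def\<close>)
  hence "(?l \<circ> (\<lambda>(a, b, c). (b, c))) summable_on ?A"
    by (subst (asm) summable_on_reindex) (auto simp: inj_on_def)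
  hence A: "(\<lambda>Q. 1 / bqf_size Q ^ k) summable_on ?A"
    by (rule summable_on_cong[THEN iffD1, rotated]) (auto simp: bqf_size_def)
  have inj: "inj_on (\<lambda>(a, b, c). (a, b)) ?B"
  proof (rule inj_onI)
    fix P Q assume *: "P \<in> ?B" "Q \<in> ?B" "(\<lambda>(a, b, c). (a, b)) P = (\<lambda>(a, b, c). (a, b)) Q"
    obtain a b c where P: "P = (a, b, c)" by (cases P)
    obtain a' b' c' where Q: "Q = (a', b', c')" by (cases Q)
    have eqs: "a' = a" "b' = b" "a \<noteq> 0" "b\<^sup>2 - 4 * a * c = D" "b'\<^sup>2 - 4 * a' * c' = D"
      using * by (auto simp: P Q bqf_of_disc_def)
    have "4 * a * c = 4 * a * c'" using eqs(4) eqs(5)[unfolded eqs(1,2)] by linarith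
    hence "c = c'" using eqs(3) by simp
    thus "P = Q" using eqs(1,2) by (simp add: P Q)
  qed
  have "?l summable_on ((\<lambda>(a, b, c). (a, b)) ` ?B)"
    by (rule summable_on_subset[OF lattice_summable[OF k]]) auto
  hence "(?l \<circ> (\<lambda>(a, b, c). (a, b))) summable_on ?B"
    by (subst (asm) summable_on_reindex[OF inj])
  hence B: "(\<lambda>Q. 1 / bqf_size Q ^ k) summable_on ?B"
    by (rule summable_on_cong[THEN iffD1, rotated]) (auto simp: bqf_size_def)
  have "?A \<union> ?B = bqf_of_disc D" by auto
  with summable_on_union[OF A B] show ?thesis by simp
qed

text \<open>The constant is uniform on a half strip that is unbounded upwards, so the majorant built
  on it serves near the cusp as well as on compact sets.\<close>

lemma bqf_lower_bound:
  assumes D: "D > 0" and \<eta>: "\<eta> > 0" and X: "X \<ge> 0"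
  obtains \<epsilon> where "\<epsilon> > 0" "\<And>Q z. Q \<in> bqf_of_disc D \<Longrightarrow> Im z \<ge> \<eta> \<Longrightarrow> \<bar>Re z\<bar> \<le> X \<Longrightarrow> \<epsilon> * bqf_size Q \<le>
      cmod (bqf_eval Q z 1)"
proof -
  \<comment> \<open>The first entry serves the forms with \<open>a \<noteq> 0\<close>, where
    \<open>\<bar>a\<bar> + \<bar>b\<bar>\<close> is bounded, the second those with
    \<open>a = 0\<close>, where \<open>\<bar>b\<bar> + \<bar>c\<bar>\<close> is.\<close>
  define K where "K = max (1 / \<eta>\<^sup>2 + (1 / \<eta> + 2 * X / \<eta>\<^sup>2)) (1 / \<eta> + (2 + X / \<eta>))"
  have K: "K > 0" unfolding K_def using \<eta> X by (intro max.strict_coboundedI1 add_pos_nonneg) auto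
  have "bqf_size Q \<le> K * cmod (bqf_eval Q z 1)" if Q: "Q \<in> bqf_of_disc D" and z: "Im z \<ge> \<eta>"
      "\<bar>Re z\<bar> \<le> X" for Q z
  proof -
    obtain a b c where abc: "Q = (a, b, c)" by (cases Q)
    define N where "N = cmod (bqf_eval (a, b, c) z 1)"
    have y: "Im z > 0" using z \<eta> by linarith
    have N0: "N \<ge> 0" by (simp add: N_def)
    note bd = bqf_coeff_bound[OF Q[unfolded abc] less_imp_le[OF D] y, folded N_def]
    have "\<bar>real_of_int a\<bar> * \<eta>\<^sup>2 \<le> \<bar>real_of_int a\<bar> * (Im z)\<^sup>2"
      using z \<eta> by (intro mult_left_mono power_mono) auto
    hence a: "\<bar>real_of_int a\<bar> \<le> N / \<eta>\<^sup>2" using bd(1) \<eta> by (simp add: field_simps)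
    have "\<bar>2 * real_of_int a * Re z + real_of_int b\<bar> * \<eta> \<le> \<bar>2 * real_of_int a * Re z + real_of_int
        b\<bar> * Im z"
      using z by (intro mult_left_mono) auto
    hence ab: "\<bar>2 * real_of_int a * Re z + real_of_int b\<bar> \<le> N / \<eta>" using bd(2) \<eta>
        by (simp add: field_simps)
    show ?thesis
    proof (cases "a = 0")
      case False
      have "\<bar>2 * real_of_int a * Re z\<bar> \<le> 2 * (N / \<eta>\<^sup>2) * X"
        unfolding abs_mult using a z N0 by (intro mult_mono) auto
      hence "\<bar>real_of_int b\<bar> \<le> N / \<eta> + 2 * (N / \<eta>\<^sup>2) * X" using ab by linarith
      hence "\<bar>real_of_int a\<bar> + \<bar>real_of_int b\<bar> \<le> (1 / \<eta>\<^sup>2 + (1 / \<eta> + 2 * X / \<eta>\<^sup>2)) * N"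
        using a by (simp add: algebra_simps)
      also have "\<dots> \<le> K * N" unfolding K_def using N0 by (intro mult_right_mono) auto
      finally show ?thesis using False by (simp add: abc bqf_size_def N_def)
    next
      case True
      have b: "\<bar>real_of_int b\<bar> \<le> N / \<eta>" using ab True by simp
      have bI: "\<bar>real_of_int b\<bar> * Im z \<le> N" using bd(2) True by simp
      have "N = cmod (of_int b * z + of_int c)" unfolding N_def bqf_eval_1 using True by simp
      hence "\<bar>Re (of_int b * z + of_int c)\<bar> \<le> N" using abs_Re_le_cmod by metis
      hence re: "\<bar>real_of_int b * Re z + real_of_int c\<bar> \<le> N" by simp
      have "\<bar>real_of_int b * Re z\<bar> \<le> N / \<eta> * X" unfolding abs_mult using b z N0 \<eta>
          by (intro mult_mono) auto
      hence "\<bar>real_of_int c\<bar> \<le> N + N / \<eta> * X" using re by linarith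
      hence "\<bar>real_of_int b\<bar> + \<bar>real_of_int c\<bar> \<le> N / \<eta> + (2 * N + N / \<eta> * X)" using b N0 by linarith
      also have "\<dots> = (1 / \<eta> + (2 + X / \<eta>)) * N" by (simp add: algebra_simps)
      also have "\<dots> \<le> K * N" unfolding K_def using N0 by (intro mult_right_mono) auto
      finally show ?thesis using True by (simp add: abc bqf_size_def N_def)
    qed
  qed
  hence "1 / K * bqf_size Q \<le> cmod (bqf_eval Q z 1)" if "Q \<in> bqf_of_disc D" "Im z \<ge> \<eta>" "\<bar>Re z\<bar> \<le> X"
      for Q z
    using that K by (simp add: divide_le_eq mult.commute)
  thus ?thesis using K by (intro that[of "1 / K"]) auto
qed

lemma bqf_eval_nonzero:
  assumes "D > 0" "Q \<in> bqf_of_disc D" "Im z > 0"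
  shows "bqf_eval Q z 1 \<noteq> 0"
proof -
  obtain \<epsilon> where \<epsilon>: "\<epsilon> > 0" "\<And>Q w. Q \<in> bqf_of_disc D \<Longrightarrow> Im w \<ge> Im z \<Longrightarrow> \<bar>Re w\<bar> \<le> \<bar>Re z\<bar> \<Longrightarrow>
      \<epsilon> * bqf_size Q \<le> cmod (bqf_eval Q w 1)"
    using bqf_lower_bound[OF assms(1,3), of "\<bar>Re z\<bar>"] by auto
  have "\<epsilon> * bqf_size Q > 0" using \<epsilon>(1) bqf_size_pos[OF assms(2,1)] by simp
  thus ?thesis using \<epsilon>(2)[OF assms(2), of z] by auto
qed

lemma bqf_term_bound:
  assumes D: "D > 0" and \<eta>: "\<eta> > 0" and X: "X \<ge> 0"
  obtains C where "\<And>Q z. Q \<in> bqf_of_disc D \<Longrightarrow> Im z \<ge> \<eta> \<Longrightarrow> \<bar>Re z\<bar> \<le> X \<Longrightarrow> cmod (1 / bqf_eval Q z 1 ^ k) \<le>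
      C * (1 / bqf_size Q ^ k)"
proof -
  obtain \<epsilon> where \<epsilon>: "\<epsilon> > 0" "\<And>Q z. Q \<in> bqf_of_disc D \<Longrightarrow> Im z \<ge> \<eta> \<Longrightarrow> \<bar>Re z\<bar> \<le> X \<Longrightarrow> \<epsilon> * bqf_size Q \<le>
      cmod (bqf_eval Q z 1)"
    using bqf_lower_bound[OF assms] by metis
  show ?thesis
  proof (rule that[of "1 / \<epsilon> ^ k"])
    fix Q z assume Q: "Q \<in> bqf_of_disc D" "Im z \<ge> \<eta>" "\<bar>Re z\<bar> \<le> X"
    have pos: "\<epsilon> * bqf_size Q > 0" using \<epsilon>(1) bqf_size_pos[OF Q(1) D] by simp
    have "(\<epsilon> * bqf_size Q) ^ k \<le> cmod (bqf_eval Q z 1) ^ k"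
      using \<epsilon>(2)[OF Q] pos by (intro power_mono) auto
    hence "1 / cmod (bqf_eval Q z 1) ^ k \<le> 1 / (\<epsilon> * bqf_size Q) ^ k"
      using pos by (intro divide_left_mono mult_pos_pos zero_less_power less_le_trans[OF
          zero_less_power[OF pos]]) auto
    thus "cmod (1 / bqf_eval Q z 1 ^ k) \<le> 1 / \<epsilon> ^ k * (1 / bqf_size Q ^ k)"
      by (simp add: norm_divide norm_power power_mult_distrib)
  qed
qed

text \<open>The majorant makes the finite partial sums converge uniformly on a disc, and
  Weierstrass's theorem for uniform limits gives holomorphy together with the termwise derivative as
  an unordered sum.\<close>

lemma zagier_derivative:
  assumes D: "D > 0" and k: "k \<ge> 3" and z: "Im z > 0"
  obtains d where "(zagier_f k D has_field_derivative d) (at z)"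
    "((\<lambda>Q. - of_nat k * (deriv (\<lambda>w. bqf_eval Q w 1) z / bqf_eval Q z 1 ^ (k + 1))) has_sum d)
        (bqf_of_disc D)"
proof -
  \<comment> \<open>Half the height: the closed disc of this radius stays at height at least
    \<open>r\<close>.\<close>
  define r where "r = Im z / 2"
  have r: "r > 0" using z by (simp add: r_def)
  have ball: "Im w \<ge> r \<and> \<bar>Re w\<bar> \<le> \<bar>Re z\<bar> + r" if "w \<in> cball z r" for w
  proof -
    have "cmod (w - z) \<le> r" using that by (simp add: dist_norm norm_minus_commute)
    hence "\<bar>Re w - Re z\<bar> \<le> r" "\<bar>Im w - Im z\<bar> \<le> r"
      using abs_Re_le_cmod[of "w - z"] abs_Im_le_cmod[of "w - z"] by auto
    moreover have "Im z = 2 * r" by (simp add: r_def)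
    ultimately show ?thesis by linarith
  qed
  obtain C where C: "\<And>Q w. Q \<in> bqf_of_disc D \<Longrightarrow> Im w \<ge> r \<Longrightarrow> \<bar>Re w\<bar> \<le> \<bar>Re z\<bar> + r \<Longrightarrow> cmod (1 / bqf_eval Q
      w 1 ^ k) \<le> C * (1 / bqf_size Q ^ k)"
    using bqf_term_bound[OF D r, of "\<bar>Re z\<bar> + r" k] r by auto
  define S where "S = bqf_of_disc D"
  define f where "f X w = (\<Sum>Q\<in>X. 1 / bqf_eval Q w 1 ^ k)" for X w
  define f' where "f' X w = (\<Sum>Q\<in>X. - of_nat k * (deriv (\<lambda>w. bqf_eval Q w 1) w / bqf_eval Q w 1 ^ (k
      + 1)))" for X w
  have ul: "uniform_limit (cball z r) f (zagier_f k D) (finite_subsets_at_top S)"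
    unfolding f_def[abs_def] zagier_f_def[abs_def] S_def
    by (rule Weierstrass_m_test_general[where M = "\<lambda>Q. C * (1 / bqf_size Q ^ k)"])
       (use C ball bqf_size_summable[OF D k] in \<open>auto intro!: summable_on_cmult_right simp del:
           times_divide_eq_right\<close>)
  have d1: "((\<lambda>w. 1 / bqf_eval Q w 1 ^ k) has_field_derivative
      - of_nat k * (deriv (\<lambda>w. bqf_eval Q w 1) w / bqf_eval Q w 1 ^ (k + 1))) (at w)"
    if Q: "Q \<in> S" and w: "w \<in> cball z r" for Q w
  proof -
    obtain a b c where abc: "Q = (a, b, c)" by (cases Q)
    have nz: "bqf_eval Q w 1 \<noteq> 0" using bqf_eval_nonzero[OF D] Q ball[OF w] r by (auto simp: S_def)
    have d: "((\<lambda>w. bqf_eval Q w 1) has_field_derivative deriv (\<lambda>w. bqf_eval Q w 1) w) (at w)"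
      using bqf_deriv[of a b c w] DERIV_imp_deriv[OF bqf_deriv[of a b c w]] by (simp add: abc)
    obtain j where j: "k = Suc j" using k by (cases k) auto
    have "((\<lambda>w. 1 / bqf_eval Q w 1 ^ k) has_field_derivative
        (0 * bqf_eval Q w 1 ^ k - 1 * (of_nat k * (deriv (\<lambda>w. bqf_eval Q w 1) w * bqf_eval Q w 1 ^
            (k - Suc 0)))) /
        (bqf_eval Q w 1 ^ k * bqf_eval Q w 1 ^ k)) (at w)"
      by (rule DERIV_divide[OF DERIV_const DERIV_power[OF d]]) (use nz in simp)
    thus ?thesis by (rule DERIV_cong) (use nz in \<open>simp add: j del: of_nat_Suc\<close>)
  qed
  have cont: "eventually (\<lambda>X. continuous_on (cball z r) (f X) \<and>
      (\<forall>w\<in>ball z r. (f X has_field_derivative f' X w) (at w))) (finite_subsets_at_top S)"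
  proof (rule eventually_finite_subsets_at_top_weakI)
    fix X assume X: "finite X" "X \<subseteq> S"
    have *: "(f X has_field_derivative f' X w) (at w)" if "w \<in> cball z r" for w
      unfolding f_def f'_def by (rule DERIV_sum) (use d1 X that in blast)
    moreover from * have "continuous_on (cball z r) (f X)"
      by (intro continuous_at_imp_continuous_on ballI DERIV_isCont) blast
    ultimately show "continuous_on (cball z r) (f X) \<and> (\<forall>w\<in>ball z r. (f X has_field_derivative f' X
        w) (at w))" by auto
  qed
  have "\<not> trivial_limit (finite_subsets_at_top S)" by simp
  from has_complex_derivative_uniform_limit[OF cont ul this r]
  obtain g' where g': "\<And>w. w \<in> ball z r \<Longrightarrow> (zagier_f k D has_field_derivative g' w) (at w) \<and>
      ((\<lambda>X. f' X w) \<longlongrightarrow> g' w) (finite_subsets_at_top S)"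
    by metis
  show ?thesis
    by (rule that[of "g' z"]) (use g'[of z] r in \<open>auto simp: has_sum_def f'_def S_def\<close>)
qed

lemma zagier_summable:
  assumes D: "D > 0" and k: "k \<ge> 3" and z: "Im z > 0"
  shows "(\<lambda>Q. 1 / bqf_eval Q z 1 ^ k) summable_on bqf_of_disc D"
proof -
  obtain C where C: "\<And>Q w. Q \<in> bqf_of_disc D \<Longrightarrow> Im w \<ge> Im z \<Longrightarrow> \<bar>Re w\<bar> \<le> \<bar>Re z\<bar> \<Longrightarrow> cmod (1 / bqf_eval Q
      w 1 ^ k) \<le> C * (1 / bqf_size Q ^ k)"
    using bqf_term_bound[OF D z, of "\<bar>Re z\<bar>" k] by auto
  have "(\<lambda>Q. cmod (1 / bqf_eval Q z 1 ^ k)) summable_on bqf_of_disc D"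
    by (rule summable_on_comparison_test[OF summable_on_cmult_right[OF bqf_size_summable[OF D k], of
        C]])
       (use C in auto)
  thus ?thesis by (rule abs_summable_summable)
qed

lemma zagier_bounded:
  assumes D: "D > 0" and k: "k \<ge> 3"
  obtains B where "\<And>z. Im z \<ge> 1 \<Longrightarrow> \<bar>Re z\<bar> \<le> 1 \<Longrightarrow> cmod (zagier_f k D z) \<le> B"
proof -
  obtain C where C: "\<And>Q w. Q \<in> bqf_of_disc D \<Longrightarrow> Im w \<ge> 1 \<Longrightarrow> \<bar>Re w\<bar> \<le> 1 \<Longrightarrow> cmod (1 / bqf_eval Q w 1 ^ k)
      \<le> C * (1 / bqf_size Q ^ k)"
    using bqf_term_bound[OF D, of 1 1 k] by auto
  have s: "(\<lambda>Q. C * (1 / bqf_size Q ^ k)) summable_on bqf_of_disc D"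
    by (rule summable_on_cmult_right[OF bqf_size_summable[OF D k]])
  show ?thesis
  proof (rule that)
    fix z assume z: "Im z \<ge> 1" "\<bar>Re z\<bar> \<le> 1"
    have "cmod (zagier_f k D z) \<le> (\<Sum>\<^sub>\<infinity>Q\<in>bqf_of_disc D. C * (1 / bqf_size Q ^ k))"
      unfolding zagier_f_def by (rule norm_infsum_le[OF has_sum_infsum[OF zagier_summable[OF D k]]
          has_sum_infsum[OF s]])
        (use C z in auto)
    thus "cmod (zagier_f k D z) \<le> infsum (\<lambda>Q. C * (1 / bqf_size Q ^ k)) (bqf_of_disc D)" .
  qed
qed

section \<open>The modular group acting on quadratic forms\<close>

definition bqf_act :: "int^2^2 \<Rightarrow> bqf \<Rightarrow> bqf" where
  "bqf_act A = (\<lambda>(a, b, c). let \<alpha> = A $ 1 $ 1; \<beta> = A $ 1 $ 2; \<gamma> = A $ 2 $ 1; \<delta> = A $ 2 $ 2 in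
     (a * \<alpha>\<^sup>2 + b * \<alpha> * \<gamma> + c * \<gamma>\<^sup>2, 2 * a * \<alpha> * \<beta> + b * (\<alpha> * \<delta> + \<beta> * \<gamma>) + 2 * c * \<gamma> * \<delta>,
      a * \<beta>\<^sup>2 + b * \<beta> * \<delta> + c * \<delta>\<^sup>2))"

text \<open>\<open>bqf_act A\<close> substitutes the linear map \<open>A\<close> into the variables,
  a right action; hence the reversed order of the product.\<close>

lemma bqf_act_mult: "bqf_act A (bqf_act B Q) = bqf_act (B ** A) Q"
  by (cases Q) (simp add: bqf_act_def Let_def power2_eq_square algebra_simps)

lemma bqf_act_one: "bqf_act (mat 1) Q = Q"
  by (cases Q) (simp add: bqf_act_def)

lemma bqf_act_disc:
  assumes "A \<in> SL2Z" "Q \<in> bqf_of_disc D"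
  shows "bqf_act A Q \<in> bqf_of_disc D"
proof -
  obtain a b c where Q: "Q = (a, b, c)" by (cases Q)
  define \<alpha> \<beta> \<gamma> \<delta> where "\<alpha> = A $ 1 $ 1" "\<beta> = A $ 1 $ 2" "\<gamma> = A $ 2 $ 1" "\<delta> = A $ 2 $ 2"
  note defs = this
  have "(2 * a * \<alpha> * \<beta> + b * (\<alpha> * \<delta> + \<beta> * \<gamma>) + 2 * c * \<gamma> * \<delta>)\<^sup>2
      - 4 * (a * \<alpha>\<^sup>2 + b * \<alpha> * \<gamma> + c * \<gamma>\<^sup>2) * (a * \<beta>\<^sup>2 + b * \<beta> * \<delta> + c * \<delta>\<^sup>2)
      = (b\<^sup>2 - 4 * a * c) * (\<alpha> * \<delta> - \<beta> * \<gamma>)\<^sup>2"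
    by (simp add: power2_eq_square algebra_simps)
  also have "\<alpha> * \<delta> - \<beta> * \<gamma> = 1" using assms(1) by (simp add: SL2Z_iff defs)
  finally show ?thesis using assms(2) by (simp add: Q bqf_act_def Let_def bqf_of_disc_def defs)
qed

lemma bij_betw_bqf_act:
  assumes "A \<in> SL2Z"
  shows "bij_betw (bqf_act A) (bqf_of_disc D) (bqf_of_disc D)"
  by (rule bij_betwI[of _ _ _ "bqf_act (sl2_inv A)"])
     (auto simp: bqf_act_mult sl2_inv_mult mult_sl2_inv bqf_act_one assms
       intro: bqf_act_disc bqf_act_disc[OF SL2Z_inv[OF assms]])

lemma bqf_eval_act:
  assumes "A \<in> SL2Z" "Im z > 0"
  shows "bqf_eval (bqf_act A Q) z 1 = aut_factor A z ^ 2 * bqf_eval Q (moebius A z) 1"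
proof -
  obtain a b c where Q: "Q = (a, b, c)" by (cases Q)
  define n where "n = of_int (A $ 1 $ 1) * z + of_int (A $ 1 $ 2)"
  have j: "aut_factor A z \<noteq> 0" by (rule aut_factor_nonzero[OF assms])
  have "aut_factor A z ^ 2 * bqf_eval Q (moebius A z) 1 =
      of_int a * n ^ 2 + of_int b * (n * aut_factor A z) + of_int c * aut_factor A z ^ 2"
    using j unfolding Q bqf_eval_1 moebius_def n_def[symmetric] by (simp add: field_simps
        power2_eq_square)
  also have "\<dots> = bqf_eval (bqf_act A Q) z 1"
    by (simp add: Q bqf_act_def Let_def bqf_eval_1 n_def aut_factor_def power2_eq_square
        algebra_simps)
  finally show ?thesis ..
qed

text \<open>Numerator and denominator of \<open>Q_z\<close> at the image point both carry the
  squared modulus of the automorphy factor, so \<open>Q_z\<close> itself has weight 0.\<close>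

lemma bqf_real_act:
  assumes "A \<in> SL2Z" "Im z > 0"
  shows "bqf_real (bqf_act A Q) z = bqf_real Q (moebius A z)"
proof -
  obtain a b c where Q: "Q = (a, b, c)" by (cases Q)
  define n where "n = of_int (A $ 1 $ 1) * z + of_int (A $ 1 $ 2)"
  define j where "j = aut_factor A z"
  have j: "cmod j > 0" using aut_factor_nonzero[OF assms] by (simp add: j_def)
  have Rew: "Re (moebius A z) = (Re n * Re j + Im n * Im j) / (cmod j)\<^sup>2"
    unfolding moebius_def n_def[symmetric] j_def[symmetric] by (simp add: Re_divide cmod_power2)
  have nw: "(cmod (moebius A z))\<^sup>2 = (cmod n)\<^sup>2 / (cmod j)\<^sup>2"
    unfolding moebius_def n_def[symmetric] j_def[symmetric] by (simp add: norm_divide power_divide)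
  have Imw: "Im (moebius A z) = Im z / (cmod j)\<^sup>2"
    using Im_moebius[OF assms] by (simp add: j_def)
  have "bqf_real Q (moebius A z) = 1 / Im z * (of_int a * (cmod n)\<^sup>2 + of_int b * (Re n * Re j + Im
      n * Im j) + of_int c * (cmod j)\<^sup>2)"
    unfolding Q bqf_real_def prod.case Rew nw Imw using j assms(2) by (simp add: field_simps)
  also have "of_int a * (cmod n)\<^sup>2 + of_int b * (Re n * Re j + Im n * Im j) + of_int c * (cmod j)\<^sup>2
      =
      of_int (fst (bqf_act A Q)) * (cmod z)\<^sup>2 + of_int (fst (snd (bqf_act A Q))) * Re z + of_int
          (snd (snd (bqf_act A Q)))"
    unfolding cmod_power2 by (simp add: Q bqf_act_def Let_def n_def j_def aut_factor_def
        power2_eq_square algebra_simps)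
  finally show ?thesis by (simp add: bqf_real_def case_prod_unfold)
qed

lemma zagier_moebius:
  assumes A: "A \<in> SL2Z" and z: "Im z > 0"
  shows "zagier_f k D (moebius A z) = aut_factor A z ^ (2 * k) * zagier_f k D z"
proof -
  have j: "aut_factor A z \<noteq> 0" by (rule aut_factor_nonzero[OF assms])
  have "aut_factor A z ^ (2 * k) * zagier_f k D z =
      (\<Sum>\<^sub>\<infinity>Q\<in>bqf_of_disc D. aut_factor A z ^ (2 * k) * (1 / bqf_eval Q z 1 ^ k))"
    unfolding zagier_f_def by (rule infsum_cmult_right'[symmetric])
  also have "\<dots> = (\<Sum>\<^sub>\<infinity>Q\<in>bqf_of_disc D. aut_factor A z ^ (2 * k) * (1 / bqf_eval (bqf_act A Q) z 1 ^
      k))"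
    by (rule infsum_reindex_bij_betw[OF bij_betw_bqf_act[OF A], symmetric])
  also have "\<dots> = zagier_f k D (moebius A z)"
    unfolding zagier_f_def bqf_eval_act[OF A z] using j
    by (intro infsum_cong) (simp add: power_mult_distrib power_mult)
  finally show ?thesis ..
qed

lemma omega_moebius:
  assumes A: "A \<in> SL2Z" and z: "Im z > 0"
  shows "omega m D (moebius A z) = aut_factor A z ^ (2 * m) * omega m D z"
proof -
  have j: "aut_factor A z \<noteq> 0" by (rule aut_factor_nonzero[OF assms])
  have "aut_factor A z ^ (2 * m) * omega m D z =
      (\<Sum>\<^sub>\<infinity>Q\<in>bqf_of_disc D. aut_factor A z ^ (2 * m) * (of_real (bqf_real Q z) / bqf_eval Q z 1 ^
          m))"
    unfolding omega_def by (rule infsum_cmult_right'[symmetric])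
  also have "\<dots> = (\<Sum>\<^sub>\<infinity>Q\<in>bqf_of_disc D. aut_factor A z ^ (2 * m) * (of_real (bqf_real (bqf_act A Q) z)
      / bqf_eval (bqf_act A Q) z 1 ^ m))"
    by (rule infsum_reindex_bij_betw[OF bij_betw_bqf_act[OF A], symmetric])
  also have "\<dots> = omega m D (moebius A z)"
    unfolding omega_def bqf_eval_act[OF A z] bqf_real_act[OF A z] using j
    by (intro infsum_cong) (simp add: power_mult_distrib power_mult)
  finally show ?thesis ..
qed

lemma zagier_holomorphic:
  assumes "D > 0" "k \<ge> 3"
  shows "zagier_f k D holomorphic_on upper_half"
  unfolding holomorphic_on_open[OF open_upper_half]
proof
  fix z assume "z \<in> upper_half"
  hence "Im z > 0" by simp
  from zagier_derivative[OF assms this] show "\<exists>f'. (zagier_f k D has_field_derivative f') (at z)"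
      by blast
qed

lemma mform_zagier:
  assumes D: "D > 0" and k: "k \<ge> 3"
  obtains g where "mform (2 * k) (zagier_f k D) g"
proof -
  have per: "zagier_f k D (z + 1) = zagier_f k D z" if "Im z > 0" for z
    using zagier_moebius[of "mat2 1 1 0 1" z k D] that by (simp add: SL2Z_iff moebius_def
        aut_factor_def)
  obtain B where B: "\<And>z. Im z \<ge> 1 \<Longrightarrow> \<bar>Re z\<bar> \<le> 1 \<Longrightarrow> cmod (zagier_f k D z) \<le> B"
    using zagier_bounded[OF assms] by metis
  have bd: "cmod (zagier_f k D z) \<le> B" if "Im z > 1" for z
  proof -
    have "\<bar>Re (z + of_int (- round (Re z)))\<bar> \<le> 1"
      using of_int_round_abs_le[of "Re z"] by (simp add: abs_minus_commute)
    moreover have "zagier_f k D (z + of_int (- round (Re z))) = zagier_f k D z"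
      by (rule periodic_of_int[of "zagier_f k D"]) (use per that in auto)
    ultimately show ?thesis using B[of "z + of_int (- round (Re z))"] that by simp
  qed
  obtain g where g: "g holomorphic_on ball 0 1" "\<And>z. Im z > 0 \<Longrightarrow> zagier_f k D z = g (qexp z)"
    using periodic_factor_qexp[OF zagier_holomorphic[OF assms] per bd] by metis
  have "zagier_f k D (- 1 / z) = z ^ (2 * k) * zagier_f k D z" if "Im z > 0" for z
    using zagier_moebius[OF moebius_S(1) that, of k D] by (simp add: moebius_S)
  thus ?thesis using that[of g] g unfolding mform_def by blast
qed

text \<open>The series of \<open>Q'\<close> is, up to the factor \<open>- k\<close>, the termwise
  derivative of \<open>zagier_f\<close>. By \<open>bqf_real_eq\<close> the series of
  \<open>omega\<close> is a linear combination of it and \<open>zagier_f\<close>, and inherits its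
  convergence.\<close>

lemma omega_series:
  assumes D: "D > 0" and k: "k \<ge> 3" and z: "Im z > 0"
  shows "(\<lambda>Q. deriv (\<lambda>w. bqf_eval Q w 1) z / bqf_eval Q z 1 ^ (k + 1)) summable_on bqf_of_disc D"
    and "deriv (zagier_f k D) z = - of_nat k * (\<Sum>\<^sub>\<infinity>Q\<in>bqf_of_disc D. deriv (\<lambda>w. bqf_eval Q w 1) z /
        bqf_eval Q z 1 ^ (k + 1))"
    and "(\<lambda>Q. of_real (bqf_real Q z) / bqf_eval Q z 1 ^ (k + 1)) summable_on bqf_of_disc D"
    and "omega (k + 1) D z = - \<i> * (\<Sum>\<^sub>\<infinity>Q\<in>bqf_of_disc D. deriv (\<lambda>w. bqf_eval Q w 1) z / bqf_eval Q z
        1 ^ (k + 1))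
           + 1 / of_real (Im z) * zagier_f k D z"
proof -
  let ?t = "\<lambda>Q. deriv (\<lambda>w. bqf_eval Q w 1) z / bqf_eval Q z 1 ^ (k + 1)"
  obtain d where d: "(zagier_f k D has_field_derivative d) (at z)" "((\<lambda>Q. - of_nat k * ?t Q) has_sum
      d) (bqf_of_disc D)"
    using zagier_derivative[OF D k z] by blast
  have k0: "- of_nat k \<noteq> (0 :: complex)" using k by simp
  show s: "?t summable_on bqf_of_disc D"
    using summable_on_cmult_right'[OF k0, of ?t "bqf_of_disc D"] has_sum_imp_summable[OF d(2)]
        by blast
  have "d = - of_nat k * infsum ?t (bqf_of_disc D)"
    using has_sum_unique[OF d(2) has_sum_cmult_right[OF has_sum_infsum[OF s]]] .
  thus "deriv (zagier_f k D) z = - of_nat k * infsum ?t (bqf_of_disc D)" using DERIV_imp_deriv[OF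
      d(1)] by simp
  have h: "((\<lambda>Q. - \<i> * ?t Q + 1 / of_real (Im z) * (1 / bqf_eval Q z 1 ^ k)) has_sum
      (- \<i> * infsum ?t (bqf_of_disc D) + 1 / of_real (Im z) * zagier_f k D z)) (bqf_of_disc D)"
    unfolding zagier_f_def
    by (intro has_sum_add has_sum_cmult_right has_sum_infsum s zagier_summable assms)
  have "- \<i> * ?t Q + 1 / of_real (Im z) * (1 / bqf_eval Q z 1 ^ k) = of_real (bqf_real Q z) /
      bqf_eval Q z 1 ^ (k + 1)"
    if "Q \<in> bqf_of_disc D" for Q
    unfolding bqf_real_eq[OF z] using bqf_eval_nonzero[OF D that z] by (simp add: add_divide_distrib
        diff_divide_distrib)
  with h have h': "((\<lambda>Q. of_real (bqf_real Q z) / bqf_eval Q z 1 ^ (k + 1)) has_sum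
      (- \<i> * infsum ?t (bqf_of_disc D) + 1 / of_real (Im z) * zagier_f k D z)) (bqf_of_disc D)"
    by (simp cong: has_sum_cong)
  show "(\<lambda>Q. of_real (bqf_real Q z) / bqf_eval Q z 1 ^ (k + 1)) summable_on bqf_of_disc D"
    by (rule has_sum_imp_summable[OF h'])
  show "omega (k + 1) D z = - \<i> * infsum ?t (bqf_of_disc D) + 1 / of_real (Im z) * zagier_f k D z"
    unfolding omega_def by (rule infsumI[OF h'])
qed

section \<open>Real-analytic properties and the theorem\<close>

text \<open>Both partial derivatives are values of the total derivative, at 1 and at
  \<open>\<i>\<close>, so they can be computed by the rules for
  \<open>has_derivative\<close>.\<close>

lemma partial_eqs:
  assumes "(f has_derivative F) (at z)"
  shows "partial_x f z = F 1" "partial_y f z = F \<i>"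
proof -
  have f: "(f has_derivative F) (at (Complex (Re z) (Im z)))" using assms by simp
  have "((\<lambda>t. Complex t (Im z)) has_vector_derivative 1) (at (Re z))"
    unfolding Complex_eq by (auto intro!: derivative_eq_intros)
  from vector_derivative_diff_chain_within[OF this has_derivative_at_withinI[OF f]]
  show "partial_x f z = F 1" unfolding partial_x_def
    by (intro vector_derivative_at) (simp add: o_def)
  have "((\<lambda>t. Complex (Re z) t) has_vector_derivative \<i>) (at (Im z))"
    unfolding Complex_eq by (auto intro!: derivative_eq_intros)
  from vector_derivative_diff_chain_within[OF this has_derivative_at_withinI[OF f]]
  show "partial_y f z = F \<i>" unfolding partial_y_def
    by (intro vector_derivative_at) (simp add: o_def)
qed

lemma partial_cong:
  assumes "\<And>z. Im z > 0 \<Longrightarrow> f z = g z" "Im z > 0"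
  shows "partial_x f z = partial_x g z" "partial_y f z = partial_y g z"
proof -
  \<comment> \<open>A horizontal line through \<open>z\<close> stays in the half plane, so the
    functions agree on all of it; along a vertical line they agree only near
    \<open>z\<close>.\<close>
  have "(\<lambda>t. f (Complex t (Im z))) = (\<lambda>t. g (Complex t (Im z)))"
    using assms by (intro ext) simp
  thus "partial_x f z = partial_x g z" by (simp add: partial_x_def)
  have "eventually (\<lambda>t. t > 0) (nhds (Im z))"
    using eventually_nhds_in_open[of "{0<..}" "Im z"] assms(2) by simp
  hence "eventually (\<lambda>t. f (Complex (Re z) t) = g (Complex (Re z) t)) (nhds (Im z))"
    by eventually_elim (use assms in simp)
  thus "partial_y f z = partial_y g z"
    unfolding partial_y_def by (intro vector_derivative_cong_eq) auto
qed

lemma partial_add: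
  assumes "f differentiable at z" "g differentiable at z"
  shows "partial_x (\<lambda>z. f z + g z) z = partial_x f z + partial_x g z"
    "partial_y (\<lambda>z. f z + g z) z = partial_y f z + partial_y g z"
proof -
  obtain F G where FG: "(f has_derivative F) (at z)" "(g has_derivative G) (at z)"
    using assms unfolding differentiable_def by blast
  show "partial_x (\<lambda>z. f z + g z) z = partial_x f z + partial_x g z"
    "partial_y (\<lambda>z. f z + g z) z = partial_y f z + partial_y g z"
    by (simp_all add: partial_eqs[OF FG(1)] partial_eqs[OF FG(2)] partial_eqs[OF
        has_derivative_add[OF FG]])
qed

lemma differentiable_on_upper_half:
  "f differentiable_on upper_half \<longleftrightarrow> (\<forall>z. Im z > 0 \<longrightarrow> f differentiable at z)"
  unfolding differentiable_on_def using at_within_open[OF _ open_upper_half] by auto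

lemma differentiable_cong_upper_half:
  assumes "\<And>z. Im z > 0 \<Longrightarrow> f z = g z" "f differentiable at z" "Im z > 0"
  shows "g differentiable at z"
proof -
  obtain F where "(f has_derivative F) (at z)" using assms(2) unfolding differentiable_def by blast
  hence "(g has_derivative F) (at z)"
    by (rule has_derivative_transform_within_open[OF _ open_upper_half]) (use assms in auto)
  thus ?thesis unfolding differentiable_def by blast
qed

lemma C_diff_cong:
  assumes "C_diff n upper_half f" "\<And>z. Im z > 0 \<Longrightarrow> f z = g z"
  shows "C_diff n upper_half g"
  using assms
proof (induction n arbitrary: f g)
  case 0
  thus ?case using continuous_on_cong[OF refl, of upper_half f g] by simp
next
  case (Suc n)
  have "g differentiable_on upper_half"
    using Suc.prems differentiable_cong_upper_half[of f g]
        by (auto simp: differentiable_on_upper_half)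
  moreover have "C_diff n upper_half (partial_x g)" "C_diff n upper_half (partial_y g)"
    using Suc.prems partial_cong[of f g] by (auto intro: Suc.IH[of "partial_x f"] Suc.IH[of
        "partial_y f"])
  ultimately show ?case by simp
qed

lemma C_diff_add:
  assumes "C_diff n upper_half f" "C_diff n upper_half g"
  shows "C_diff n upper_half (\<lambda>z. f z + g z)"
  using assms
proof (induction n arbitrary: f g)
  case 0
  thus ?case by (auto intro: continuous_on_add)
next
  case (Suc n)
  have d: "f differentiable at z" "g differentiable at z" if "Im z > 0" for z
    using Suc.prems that by (auto simp: differentiable_on_upper_half)
  have c: "C_diff n upper_half (\<lambda>z. partial_x f z + partial_x g z)" "C_diff n upper_half (\<lambda>z.
      partial_y f z + partial_y g z)"
    using Suc by auto
  have "C_diff n upper_half (partial_x (\<lambda>z. f z + g z))"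
    by (rule C_diff_cong[OF c(1)]) (simp add: partial_add d)
  moreover have "C_diff n upper_half (partial_y (\<lambda>z. f z + g z))"
    by (rule C_diff_cong[OF c(2)]) (simp add: partial_add d)
  ultimately show ?case using d by (auto simp: differentiable_on_upper_half intro:
      differentiable_add)
qed

text \<open>Sums of these functions form a class that is closed under both partial derivatives.\<close>

definition hol_over_y :: "(complex \<Rightarrow> complex) \<Rightarrow> nat \<Rightarrow> complex \<Rightarrow> complex" where
  "hol_over_y h j z = h z / of_real (Im z) ^ j"

lemma hol_over_y_has_derivative:
  assumes h: "h holomorphic_on upper_half" and z: "Im z > 0"
  shows "(hol_over_y h j has_derivative
    (\<lambda>v. deriv h z * v / of_real (Im z) ^ j - of_nat j * h z * of_real (Im v) / of_real (Im z) ^ (j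
        + 1))) (at z)"
proof -
  have "(h has_field_derivative deriv h z) (at z)"
    by (rule holomorphic_derivI[OF h open_upper_half]) (use z in simp)
  hence dh: "(h has_derivative (\<lambda>v. deriv h z * v)) (at z)" by (simp add: has_field_derivative_def)
  have dy: "((\<lambda>w. complex_of_real (Im w)) has_derivative (\<lambda>v. of_real (Im v))) (at z)"
    by (intro derivative_intros)
  have y: "complex_of_real (Im z) \<noteq> 0" using z by simp
  have "((\<lambda>w. h w / of_real (Im w) ^ j) has_derivative
      (\<lambda>v. - h z * (inverse (of_real (Im z) ^ j) * (of_nat j * of_real (Im v) * of_real (Im z) ^ (j
          - 1)) * inverse (of_real (Im z) ^ j))
         + deriv h z * v / of_real (Im z) ^ j)) (at z)"
    by (rule has_derivative_divide[OF dh has_derivative_power[OF dy]]) (use y in simp)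
  moreover have "- h z * (inverse (of_real (Im z) ^ j) * (of_nat j * of_real (Im v) * of_real (Im z)
      ^ (j - 1)) * inverse (of_real (Im z) ^ j))
      = - (of_nat j * h z * of_real (Im v) / of_real (Im z) ^ (j + 1))" for v
    using y by (cases j) (simp_all add: field_simps)
  ultimately show ?thesis unfolding hol_over_y_def[abs_def] by simp
qed

lemma hol_over_y_differentiable:
  "h holomorphic_on upper_half \<Longrightarrow> Im z > 0 \<Longrightarrow> hol_over_y h j differentiable at z"
  using hol_over_y_has_derivative unfolding differentiable_def by blast

lemma hol_over_y_partial:
  assumes "h holomorphic_on upper_half" "Im z > 0"
  shows "partial_x (hol_over_y h j) z = hol_over_y (deriv h) j z"
    "partial_y (hol_over_y h j) z = hol_over_y (\<lambda>z. \<i> * deriv h z) j z + hol_over_y (\<lambda>z. - of_nat j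
        * h z) (j + 1) z"
  by (simp_all add: partial_eqs[OF hol_over_y_has_derivative[OF assms]] hol_over_y_def mult.commute)

lemma C_diff_hol_over_y:
  "h holomorphic_on upper_half \<Longrightarrow> C_diff n upper_half (hol_over_y h j)"
proof (induction n arbitrary: h j)
  case 0
  have "hol_over_y h j differentiable_on upper_half"
    using hol_over_y_differentiable[OF 0] by (simp add: differentiable_on_upper_half)
  thus ?case by (simp add: differentiable_imp_continuous_on)
next
  case (Suc n)
  have h: "deriv h holomorphic_on upper_half" "(\<lambda>z. \<i> * deriv h z) holomorphic_on upper_half"
    "(\<lambda>z. - of_nat j * h z) holomorphic_on upper_half"
    using Suc.prems by (auto intro!: holomorphic_intros)
  have "C_diff n upper_half (partial_x (hol_over_y h j))"
    by (rule C_diff_cong[OF Suc.IH[OF h(1), of j]]) (simp add: hol_over_y_partial[OF Suc.prems])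
  moreover have "C_diff n upper_half (partial_y (hol_over_y h j))"
    by (rule C_diff_cong[OF C_diff_add[OF Suc.IH[OF h(2), of j] Suc.IH[OF h(3), of "j + 1"]]])
       (simp add: hol_over_y_partial[OF Suc.prems])
  ultimately show ?case
    using hol_over_y_differentiable[OF Suc.prems] by (simp add: differentiable_on_upper_half)
qed

section \<open>Uniqueness of Fourier coefficients\<close>

lemma pser_zero_imp_coeff_zero:
  assumes a: "conv1 a" and z: "\<And>q. q \<in> ball 0 1 - {0} \<Longrightarrow> pser a q = 0"
  shows "a n = 0"
proof -
  have "pser a \<midarrow>0\<rightarrow> pser a 0"
    using DERIV_isCont[OF pser_has_field_derivative[OF a, of 0]] by (simp add: isCont_def)
  moreover have "pser a \<midarrow>0\<rightarrow> 0"
    by (rule tendsto_eventually, unfold eventually_at, rule exI[of _ 1]) (use z in auto)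
  ultimately have a0: "a 0 = 0" using LIM_unique by fastforce
  show ?thesis
  proof (rule ccontr)
    assume n: "a n \<noteq> 0"
    hence "n > 0" using a0 by (cases n) auto
    moreover have "(\<lambda>n. a n * (x - 0) ^ n) sums pser a x" if "norm (x - 0) < 1" for x
      using pser_sums[OF a] that by simp
    ultimately obtain s where s: "s > 0" "\<And>q. q \<in> cball 0 s - {0} \<Longrightarrow> pser a q \<noteq> 0"
      using powser_0_nonzero[of 1 0 a "pser a" n] n a0 by auto
    define q where "q = complex_of_real (min s (1/2))"
    have "q \<in> cball 0 s - {0}" "q \<in> ball 0 1 - {0}" using s(1) by (auto simp: q_def min_def)
    thus False using s(2) z by blast
  qed
qed

text \<open>The description in \<open>fourier_coeff\<close> needs uniqueness: two expansions differ
  by a power series that vanishes on the punctured disc.\<close>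

lemma fourier_coeff_eqI:
  assumes "\<And>z. Im z > 0 \<Longrightarrow> (\<lambda>n. a n * qexp z ^ n) sums f z"
  shows "fourier_coeff f = a"
proof -
  have conv: "conv1 b" if b: "\<And>z. Im z > 0 \<Longrightarrow> (\<lambda>n. b n * qexp z ^ n) sums f z" for b
    unfolding conv1_def
  proof (intro allI impI)
    fix q :: complex assume q: "cmod q < 1"
    show "summable (\<lambda>n. b n * q ^ n)"
    proof (cases "q = 0")
      case True
      thus ?thesis using summable_finite[of "{0}" "\<lambda>n. b n * q ^ n"] by auto
    next
      case False
      then obtain z where "Im z > 0" "qexp z = q" using qexp_surj q by metis
      thus ?thesis using b[of z] by (auto simp: sums_iff)
    qed
  qed
  show ?thesis unfolding fourier_coeff_def
  proof (rule the_equality)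
    show "\<forall>z\<in>upper_half. (\<lambda>n. a n * qexp z ^ n) sums f z" using assms by simp
    fix b assume "\<forall>z\<in>upper_half. (\<lambda>n. b n * qexp z ^ n) sums f z"
    hence b: "\<And>z. Im z > 0 \<Longrightarrow> (\<lambda>n. b n * qexp z ^ n) sums f z" by simp
    have d: "conv1 (\<lambda>n. b n - a n)"
      unfolding conv1_def
    proof (intro allI impI)
      fix q :: complex assume q: "cmod q < 1"
      have "summable (\<lambda>n. b n * q ^ n - a n * q ^ n)"
        using conv[OF b] conv[OF assms] q unfolding conv1_def by (intro summable_diff) auto
      thus "summable (\<lambda>n. (b n - a n) * q ^ n)" by (simp only: left_diff_distrib)
    qed
    have "pser (\<lambda>n. b n - a n) q = 0" if q: "q \<in> ball 0 1 - {0}" for q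
    proof -
      obtain z where z: "Im z > 0" "qexp z = q" using qexp_surj[of q] q by auto
      have "(\<lambda>n. b n * q ^ n - a n * q ^ n) sums (f z - f z)"
        using sums_diff[OF b[OF z(1)] assms[OF z(1)]] unfolding z(2) .
      hence "(\<lambda>n. (b n - a n) * q ^ n) sums 0" by (simp only: left_diff_distrib diff_self)
      thus ?thesis unfolding pser_def by (rule sums_unique[symmetric])
    qed
    from pser_zero_imp_coeff_zero[OF d this] show "b = a" by (intro ext) simp
  qed
qed

lemma first_fourier_coeff_nonzero:
  assumes f: "mform k f g" and nz: "Im z > 0" "f z \<noteq> 0"
  shows "first_fourier_coeff f \<noteq> 0"
proof -
  define a where "a n = (deriv ^^ n) g 0 / fact n" for n
  have g: "g holomorphic_on ball 0 1" using f by (simp add: mform_def)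
  have s: "(\<lambda>n. a n * qexp w ^ n) sums f w" if "Im w > 0" for w
    using holomorphic_power_series[OF g, of "qexp w"] that by (simp add: a_def mform_qexp[OF f])
  have fc: "fourier_coeff f = a" by (rule fourier_coeff_eqI[OF s])
  have "\<exists>n. a n \<noteq> 0"
  proof (rule ccontr)
    assume "\<not> ?thesis"
    hence "(\<lambda>n. 0) sums f z" using s[OF nz(1)] by simp
    from sums_unique2[OF this sums_zero] show False using nz(2) by simp
  qed
  hence "a (LEAST n. a n \<noteq> 0) \<noteq> 0" by (rule LeastI_ex)
  thus ?thesis by (simp add: first_fourier_coeff_def fc)
qed

section \<open>Cusp limit, Laplace equation and divisor formula\<close>

lemma omega_eq:
  assumes D: "D > 0" and k: "k \<ge> 3" and z: "Im z > 0"
  shows "omega (k + 1) D z = \<i> / of_nat k * deriv (zagier_f k D) z + zagier_f k D z / of_real (Im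
      z)"
proof -
  have "of_nat k \<noteq> (0::complex)" using k by simp
  thus ?thesis unfolding omega_series(4)[OF assms] omega_series(2)[OF assms] by simp
qed

text \<open>The derivative of \<open>zagier_f\<close> is a multiple of \<open>q g'(q)\<close> and
  vanishes at \<open>q = 0\<close>, while \<open>g(q) / y\<close> tends to 0 because
  \<open>g\<close> is continuous at 0.\<close>

lemma omega_tendsto_0:
  assumes D: "D > 0" and k: "k \<ge> 3"
  shows "(omega (k + 1) D \<longlongrightarrow> 0) at_i_inf"
proof -
  obtain g where g: "mform (2 * k) (zagier_f k D) g" using mform_zagier[OF assms] by metis
  have hol: "g holomorphic_on ball 0 1" using g by (simp add: mform_def)
  have lim: "((\<lambda>z. h (qexp z)) \<longlongrightarrow> h 0) at_i_inf" if "h holomorphic_on ball 0 1" for h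
  proof (rule isCont_tendsto_compose[OF _ qexp_at_i_inf])
    show "isCont h 0"
      using holomorphic_on_imp_continuous_on[OF that] by (simp add: continuous_on_eq_continuous_at)
  qed
  have "filterlim Im at_top at_i_inf" unfolding at_i_inf_def by (rule filterlim_filtercomap)
  hence "((\<lambda>z. inverse (Im z)) \<longlongrightarrow> 0) at_i_inf" by (rule tendsto_inverse_0_at_top)
  hence inv: "((\<lambda>z. complex_of_real (inverse (Im z))) \<longlongrightarrow> of_real 0) at_i_inf"
      by (rule tendsto_of_real)
  have "((\<lambda>z. \<i> / of_nat k * (2 * of_real pi * \<i> * theta_disc g (qexp z)) + g (qexp z) * of_real
      (inverse (Im z)))
      \<longlongrightarrow> \<i> / of_nat k * (2 * of_real pi * \<i> * theta_disc g 0) + g 0 * of_real 0) at_i_inf"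
    by (intro tendsto_intros lim hol holomorphic_theta_disc inv)
  hence l: "((\<lambda>z. \<i> / of_nat k * (2 * of_real pi * \<i> * theta_disc g (qexp z)) + g (qexp z) * of_real
      (inverse (Im z)))
      \<longlongrightarrow> 0) at_i_inf" by simp
  have "eventually (\<lambda>z. Im z > 0) at_i_inf"
    unfolding at_i_inf_def by (intro eventually_filtercomapI eventually_gt_at_top)
  hence "eventually (\<lambda>z. \<i> / of_nat k * (2 * of_real pi * \<i> * theta_disc g (qexp z)) + g (qexp z) *
      of_real (inverse (Im z))
      = omega (k + 1) D z) at_i_inf"
  proof eventually_elim
    case (elim z)
    have "deriv (zagier_f k D) z = 2 * of_real pi * \<i> * theta_disc g (qexp z)"
      by (rule DERIV_imp_deriv[OF mform_derivative[OF g elim]])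
    thus ?case using mform_qexp[OF g elim] unfolding omega_eq[OF D k elim]
      by (simp add: divide_inverse)
  qed
  with l show ?thesis by (rule Lim_transform_eventually)
qed

lemma weak_maass_form_omega:
  assumes D: "D > 0" and k: "k \<ge> 3"
  shows "weak_maass_form (2 * int k + 2) (2 * of_nat k) (omega (k + 1) D)"
  unfolding weak_maass_form_def
proof (intro conjI ballI)
  define f where "f = zagier_f k D"
  have f: "f holomorphic_on upper_half" unfolding f_def by (rule zagier_holomorphic[OF assms])
  define h where "h z = \<i> / of_nat k * deriv f z" for z
  have h: "h holomorphic_on upper_half" unfolding h_def[abs_def] by (intro holomorphic_intros f)
      simp
  have w: "hol_over_y h 0 z + hol_over_y f 1 z = omega (k + 1) D z" if "Im z > 0" for z
    using omega_eq[OF D k that] by (simp add: hol_over_y_def h_def f_def)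
  show "smooth_fun_on upper_half (omega (k + 1) D)"
    unfolding smooth_fun_on_def
    by (intro allI C_diff_cong[OF C_diff_add[OF C_diff_hol_over_y[OF h, of _ 0] C_diff_hol_over_y[OF
        f, of _ 1]] w])
  show "\<exists>C::real. (\<lambda>z. norm (omega (k + 1) D z)) \<in> O[at_i_inf](\<lambda>z. exp (C * Im z))"
  proof
    \<comment> \<open>A function with limit 0 at the cusp is bounded there, so the growth exponent 0
      serves as witness.\<close>
    have "eventually (\<lambda>z. cmod (omega (k + 1) D z) < 1) at_i_inf"
      using order_tendstoD(2)[OF tendsto_norm[OF omega_tendsto_0[OF assms]], of 1] by simp
    thus "(\<lambda>z. norm (omega (k + 1) D z)) \<in> O[at_i_inf](\<lambda>z. exp (0 * Im z))"
      by (intro bigoI[where c = 1]) (auto elim: eventually_mono)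
  qed
  fix z assume "z \<in> upper_half"
  hence z: "Im z > 0" by simp
  show "slash (2 * int k + 2) A (omega (k + 1) D) z = omega (k + 1) D z" if A: "A \<in> SL2Z" for A
  proof -
    have "aut_factor A z powi (2 * int k + 2) = aut_factor A z powi (int (2 * (k + 1)))"
      by (rule arg_cong[where f = "power_int (aut_factor A z)"]) simp
    hence p: "aut_factor A z powi (2 * int k + 2) = aut_factor A z ^ (2 * (k + 1))"
      by (simp only: power_int_of_nat)
    have nz: "aut_factor A z ^ (2 * (k + 1)) \<noteq> 0" using aut_factor_nonzero[OF A z] by simp
    show ?thesis unfolding slash_def power_int_minus omega_moebius[OF A z] p
      by (simp only: mult.assoc[symmetric] left_inverse[OF nz] mult_1_left)
  qed
  let ?y = "complex_of_real (Im z)"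
  have df: "deriv f holomorphic_on upper_half" "deriv (deriv f) holomorphic_on upper_half"
    "deriv h holomorphic_on upper_half"
    using f h by (auto intro!: holomorphic_intros)
  have px: "partial_x (omega (k + 1) D) z = hol_over_y (deriv h) 0 z + hol_over_y (deriv f) 1 z"
      if z: "Im z > 0" for z
  proof -
    have "partial_x (omega (k + 1) D) z = partial_x (\<lambda>z. hol_over_y h 0 z + hol_over_y f 1 z) z"
      by (rule partial_cong(1)) (simp_all only: w z)
    also have "\<dots> = partial_x (hol_over_y h 0) z + partial_x (hol_over_y f 1) z"
      by (intro partial_add(1) hol_over_y_differentiable f h z)
    finally show ?thesis by (simp only: hol_over_y_partial(1)[OF f z] hol_over_y_partial(1)[OF h z])
  qed
  define F where "F z = hol_over_y (\<lambda>z. \<i> * deriv f z) 1 z + hol_over_y (\<lambda>z. - f z) 2 z" for z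
  have py: "partial_y (omega (k + 1) D) z = hol_over_y (\<lambda>z. \<i> * deriv h z) 0 z + F z"
      if z: "Im z > 0" for z
  proof -
    have "partial_y (omega (k + 1) D) z = partial_y (\<lambda>z. hol_over_y h 0 z + hol_over_y f 1 z) z"
      by (rule partial_cong(2)) (simp_all only: w z)
    also have "\<dots> = partial_y (hol_over_y h 0) z + partial_y (hol_over_y f 1) z"
      by (intro partial_add(2) hol_over_y_differentiable f h z)
    finally show ?thesis unfolding hol_over_y_partial(2)[OF f z] hol_over_y_partial(2)[OF h z]
      by (simp add: hol_over_y_def F_def numeral_2_eq_2)
  qed
  have hol: "(\<lambda>z. \<i> * deriv h z) holomorphic_on upper_half" "(\<lambda>z. \<i> * deriv f z) holomorphic_on
      upper_half"
    "(\<lambda>z. - f z) holomorphic_on upper_half"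
    by (intro holomorphic_intros df f)+
  have pxx: "partial_x (partial_x (omega (k + 1) D)) z = hol_over_y (deriv (deriv h)) 0 z +
      hol_over_y (deriv (deriv f)) 1 z"
  proof -
    have "partial_x (partial_x (omega (k + 1) D)) z = partial_x (\<lambda>z. hol_over_y (deriv h) 0 z +
        hol_over_y (deriv f) 1 z) z"
      by (rule partial_cong(1)) (simp_all only: px z)
    also have "\<dots> = partial_x (hol_over_y (deriv h) 0) z + partial_x (hol_over_y (deriv f) 1) z"
      by (intro partial_add(1) hol_over_y_differentiable df z)
    finally show ?thesis by (simp only: hol_over_y_partial(1)[OF df(1) z] hol_over_y_partial(1)[OF
        df(3) z])
  qed
  have pyy: "partial_y (partial_y (omega (k + 1) D)) z =
      \<i> * deriv (\<lambda>z. \<i> * deriv h z) z + ((\<i> * deriv (\<lambda>z. \<i> * deriv f z) z / ?y - \<i> * deriv f z / ?y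
          ^ 2)
        + (\<i> * deriv (\<lambda>z. - f z) z / ?y ^ 2 + 2 * f z / ?y ^ 3))"
  proof -
    have dF: "F differentiable at z"
      unfolding F_def[abs_def] by (intro differentiable_add hol_over_y_differentiable hol z)
    have "partial_y (partial_y (omega (k + 1) D)) z = partial_y (\<lambda>z. hol_over_y (\<lambda>z. \<i> * deriv h z)
        0 z + F z) z"
      by (rule partial_cong(2)) (simp_all only: py z)
    also have "\<dots> = partial_y (hol_over_y (\<lambda>z. \<i> * deriv h z) 0) z + partial_y F z"
      by (intro partial_add(2) hol_over_y_differentiable hol dF z)
    also have "partial_y F z = partial_y (hol_over_y (\<lambda>z. \<i> * deriv f z) 1) z + partial_y
        (hol_over_y (\<lambda>z. - f z) 2) z"
      unfolding F_def[abs_def] by (intro partial_add(2) hol_over_y_differentiable hol z)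
    finally show ?thesis
      unfolding hol_over_y_partial(2)[OF hol(1) z] hol_over_y_partial(2)[OF hol(2) z]
          hol_over_y_partial(2)[OF hol(3) z]
      by (simp add: hol_over_y_def eval_nat_numeral)
  qed
  have d: "deriv (\<lambda>z. \<i> * deriv h z) z = \<i> * deriv (deriv h) z" "deriv (\<lambda>z. \<i> * deriv f z) z =
      \<i> * deriv (deriv f) z"
    "deriv (\<lambda>z. - f z) z = - deriv f z"
    using holomorphic_derivI[OF df(3) open_upper_half, of z] holomorphic_derivI[OF df(1)
        open_upper_half, of z]
      holomorphic_derivI[OF f open_upper_half, of z] z
    by (auto intro!: DERIV_imp_deriv derivative_eq_intros)
  have y: "?y \<noteq> 0" using z by simp
  have kk: "of_nat k \<noteq> (0::complex)" using k by simp
  \<comment> \<open>The Euclidean Laplacian annihilates the holomorphic part and the second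
    derivatives of \<open>f\<close>; only the terms in which \<open>1 / y\<close> is differentiated
    survive.\<close>
  have L1: "partial_x (partial_x (omega (k + 1) D)) z + partial_y (partial_y (omega (k + 1) D)) z
      = - 2 * \<i> * deriv f z / ?y ^ 2 + 2 * f z / ?y ^ 3"
    unfolding pxx pyy d by (simp add: hol_over_y_def algebra_simps)
  \<comment> \<open>\<open>\<partial>_x + i \<partial>_y\<close> annihilates holomorphic functions
    and sees only the factor \<open>1 / y\<close>.\<close>
  have L2: "partial_x (omega (k + 1) D) z + \<i> * partial_y (omega (k + 1) D) z = - \<i> * f z / ?y ^ 2"
    unfolding px[OF z] py[OF z] by (simp add: hol_over_y_def F_def algebra_simps)
  have "hyp_laplace (2 * int k + 2) (omega (k + 1) D) z =
     - ?y\<^sup>2 * (- 2 * \<i> * deriv f z / ?y ^ 2 + 2 * f z / ?y ^ 3) + \<i> * (2 * of_nat k + 2) * ?y * (- \<i>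
         * f z / ?y ^ 2)"
    unfolding hyp_laplace_def L1 L2 by simp
  also have "\<dots> = 2 * \<i> * deriv f z + 2 * of_nat k * f z / ?y"
    using y by (simp add: field_simps eval_nat_numeral)
  also have "\<dots> = 2 * of_nat k * omega (k + 1) D z"
    unfolding omega_eq[OF D k z] f_def[symmetric] using kk by (simp add: ring_distribs)
  finally show "hyp_laplace (2 * int k + 2) (omega (k + 1) D) z = 2 * of_nat k * omega (k + 1) D z"
      .
qed

text \<open>The normalising constant drops out of the logarithmic derivative. The summand
  \<open>k / (2 pi y)\<close> that \<open>f / y\<close> adds through \<open>omega\<close> is what
  \<open>3 / (pi y)\<close> in \<open>E2_star\<close> removes, so the formula reduces to the
  holomorphic identity \<open>fdiv_mform\<close>.\<close>

lemma fdiv_zagier: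
  assumes D: "D > 0" and k: "k \<ge> 3" and z: "Im z > 0" "zagier_f k D z \<noteq> 0"
  shows "fdiv (\<lambda>w. 1 / first_fourier_coeff (zagier_f k D) * zagier_f k D w) z =
          of_nat k / (2 * of_real pi) * (omega (k + 1) D z / zagier_f k D z) + of_nat k / 6 *
              E2_star z"
proof -
  obtain g where g: "mform (2 * k) (zagier_f k D) g" using mform_zagier[OF D k] by metis
  define c where "c = 1 / first_fourier_coeff (zagier_f k D)"
  have c: "c \<noteq> 0" using first_fourier_coeff_nonzero[OF g z] by (simp add: c_def)
  define F where "F = zagier_f k D z"
  define F' where "F' = deriv (zagier_f k D) z"
  have df: "(zagier_f k D has_field_derivative F') (at z)"
    unfolding F'_def by (rule holomorphic_derivI[OF zagier_holomorphic[OF D k] open_upper_half])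
        (use z in simp)
  have F: "F \<noteq> 0" using z by (simp add: F_def)
  have dc: "deriv (\<lambda>w. c * zagier_f k D w) z = c * F'"
    by (rule DERIV_imp_deriv[OF DERIV_cmult[OF df]])
  have "fdiv (\<lambda>w. c * zagier_f k D w) z =
      - (deriv (\<lambda>w. c * zagier_f k D w) z / (2 * of_real pi * \<i> * (c * zagier_f k D z))) + of_nat k
          / 6 * E2 z"
    by (rule fdiv_mform[OF mform_cmult[OF g] z(1)]) (use c z in simp)
  also have "\<dots> = \<i> * F' / (2 * of_real pi * F) + of_nat k / 6 * E2 z"
    unfolding dc F_def[symmetric] using c F by (simp add: field_simps)
  also have "\<dots> = of_nat k / (2 * of_real pi) * (omega (k + 1) D z / F) + of_nat k / 6 * E2_star z"
  proof -
    have kk: "of_nat k \<noteq> (0::complex)" using k by simp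
    have y: "complex_of_real (Im z) \<noteq> 0" using z by simp
    have e1: "of_nat k / (2 * of_real pi) * (omega (k + 1) D z / F) =
        \<i> * F' / (2 * of_real pi * F) + of_nat k / (2 * of_real pi * of_real (Im z))"
      unfolding omega_eq[OF D k z(1)] F_def[symmetric] F'_def[symmetric]
      using kk y F by (simp add: field_simps)
    have e2: "of_nat k / 6 * E2_star z = of_nat k / 6 * E2 z - of_nat k / (2 * of_real pi * of_real
        (Im z))"
      using y by (simp add: E2_star_def field_simps)
    show ?thesis unfolding e1 e2 by simp
  qed
  finally show ?thesis by (simp add: c_def F_def)
qed

theorem theorem1p1:
  fixes k :: nat and D :: int
  assumes "k > 2" and "even k"
    and "D > 0" and "D mod 4 = 0 \<or> D mod 4 = 1"
  shows
    "((\<forall>z\<in>upper_half. (\<lambda>Q. of_real (bqf_real Q z) / bqf_eval Q z 1 ^ (k + 1))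
          summable_on bqf_of_disc D) \<and>
      weak_maass_form (2 * int k + 2) (2 * of_nat k) (omega (k + 1) D) \<and>
      (omega (k + 1) D \<longlongrightarrow> 0) at_i_inf) \<and>
     (\<forall>z\<in>upper_half.
        (\<lambda>Q. deriv (\<lambda>w. bqf_eval Q w 1) z / bqf_eval Q z 1 ^ (k + 1))
          summable_on bqf_of_disc D \<and>
        omega (k + 1) D z =
          - \<i> * (\<Sum>\<^sub>\<infinity>Q\<in>bqf_of_disc D.
                  deriv (\<lambda>w. bqf_eval Q w 1) z / bqf_eval Q z 1 ^ (k + 1))
          + 1 / of_real (Im z) * zagier_f k D z) \<and>
     ((\<exists>z\<in>upper_half. zagier_f k D z \<noteq> 0) \<longrightarrow>
      (\<forall>z\<in>upper_half. zagier_f k D z \<noteq> 0 \<longrightarrow>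
        fdiv (\<lambda>w. 1 / first_fourier_coeff (zagier_f k D) * zagier_f k D w) z =
          of_nat k / (2 * of_real pi) * (omega (k + 1) D z / zagier_f k D z)
          + of_nat k / 6 * E2_star z))"
proof -
  have k: "k \<ge> 3" using assms(1) by simp
  note s = omega_series[OF assms(3) k]
  show ?thesis
    by (intro conjI ballI impI s(1,3,4) weak_maass_form_omega[OF assms(3) k] omega_tendsto_0[OF
        assms(3) k]
        fdiv_zagier[OF assms(3) k]) simp_all
qed

end
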